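(* Let $M_t$ be a family of smooth closed strictly convex surfaces in $\mathbb{R}^3$ moving according to $\frac{d}{dt}X=\frac1K\nu$. Then $$\max_{M_t}\frac{(\lambda_1^2+\lambda_2^2)(\lambda_1-\lambda_2)^2}{8(\lambda_1+\lambda_2)\lambda_1^3\lambda_2^3}=\max_{M_t}\frac{|A|^2(2|A|^2-H^2)}{H(H^2-|A|^2)^3}$$ is non-increasing in time.
   Context: $X$ denotes the embedding, $\nu$ the outer unit normal, $\lambda_1,\lambda_2>0$ the principal curvatures, $K=\lambda_1\lambda_2$, $H=\lambda_1+\lambda_2$, $|A|^2=\lambda_1^2+\lambda_2^2$. *)

theory Defs
  imports "HOL-Analysis.Analysis"
begin

text \<open>C^k and C^infinity regularity on a set (meant for open sets) of maps
between Euclidean spaces, via iterated Frechet derivatives.\<close>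
fun Ck_on :: "nat \<Rightarrow> 'a::euclidean_space set \<Rightarrow> ('a \<Rightarrow> 'b::euclidean_space) \<Rightarrow> bool" where
  "Ck_on 0 U f = continuous_on U f"
| "Ck_on (Suc k) U f =
     ((\<forall>x\<in>U. f differentiable (at x)) \<and>
      (\<forall>v. Ck_on k U (\<lambda>x. frechet_derivative f (at x) v)))"

definition smooth_on :: "'a::euclidean_space set \<Rightarrow> ('a \<Rightarrow> 'b::euclidean_space) \<Rightarrow> bool" where
  "smooth_on U f \<longleftrightarrow> (\<forall>k. Ck_on k U f)"

abbreviation S2 :: "(real^3) set" where
  "S2 \<equiv> sphere 0 1"

definition dsl :: "((real^3) \<times> real \<Rightarrow> real^3) \<Rightarrow> real \<Rightarrow> real^3 \<Rightarrow> real^3 \<Rightarrow> real^3" where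
  "dsl F t p = frechet_derivative (\<lambda>q. F (q, t)) (at p within S2)"

text \<open>k is a principal curvature of the surface X(.,t) at the point X(p,t)
(with unit normal field nu): an eigenvalue of the Weingarten map,
i.e. d nu (u) = k dX (u) for a nonzero tangent vector u of S^2 at p.\<close>
definition principal_curvature ::
  "((real^3) \<times> real \<Rightarrow> real^3) \<Rightarrow> ((real^3) \<times> real \<Rightarrow> real^3) \<Rightarrow> real \<Rightarrow> real^3 \<Rightarrow> real \<Rightarrow> bool" where
  "principal_curvature X \<nu> t p k \<longleftrightarrow>
     (\<exists>u. u \<bullet> p = 0 \<and> u \<noteq> 0 \<and> dsl \<nu> t p u = k *\<^sub>R dsl X t p u)"

definition lambda1 where
  "lambda1 X \<nu> t p = Max {k. principal_curvature X \<nu> t p k}"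

definition lambda2 where
  "lambda2 X \<nu> t p = Min {k. principal_curvature X \<nu> t p k}"

definition gauss_curv where
  "gauss_curv X \<nu> t p = lambda1 X \<nu> t p * lambda2 X \<nu> t p"

definition Qfun where
  "Qfun X \<nu> t p =
    (let l1 = lambda1 X \<nu> t p; l2 = lambda2 X \<nu> t p in
      (l1^2 + l2^2) * (l1 - l2)^2 / (8 * (l1 + l2) * l1^3 * l2^3))"

end

theory Submission
  imports Defs
begin

text \<open>Parametrise the surfaces by the inverse of the Gauss map and let \<open>H\<close> be the support function, extended to be
  homogeneous of degree one. Its gradient is the position vector, its Hessian is the inverse of the Weingarten map
  (extended by zero in the radial direction), and the flow becomes \<open>\<partial>\<^sub>t H = |z|\<^sup>3 e\<^sub>2(D\<^sup>2 H)\<close>, where \<open>e\<^sub>2\<close> is the second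
  elementary symmetric function. With \<open>T\<close> and \<open>S\<close> the sum and the product of the principal radii of curvature, the
  quantity is \<open>Q = (T\<^sup>2 - 2S)(T\<^sup>2 - 4S) / (8T)\<close>. At a spatial maximum of \<open>Q\<close> choose the principal frame. The
  fourth-order terms of \<open>\<partial>\<^sub>t Q\<close> are \<open>r\<^sub>2 \<partial>\<^sub>1\<^sub>1 Q + r\<^sub>1 \<partial>\<^sub>2\<^sub>2 Q\<close> up to lower order, the third-order terms have a sign once
  \<open>\<nabla>Q = 0\<close> is used, and so have the zero-order terms; hence \<open>\<partial>\<^sub>t Q \<le> 0\<close> there. The maximum principle concludes.

  The normal field \<open>\<nu>\<close> is not assumed to be continuous. Where it is not differentiable, the principal curvatures
  are junk values, so its regularity has to come from the condition that it points outward, through the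
  Jordan-Brouwer separation theorem.\<close>

section \<open>Calculus of smooth maps\<close>

text \<open>The maximum over a time slice does not depend on the parametrisation, so points with the
  same normal can be compared at different times instead of following particles. The principal
  curvatures need not be differentiable at umbilic points, but \<open>T\<close> and \<open>S\<close>
  are; multiplying \<open>Q - Q0\<close> by \<open>8 T\<close> gives a polynomial in them whose sign
  near a maximum is known. Covariant calculus on the sphere is replaced by calculus on the lines
  \<open>g + s e\<close>, which project centrally to great circles: homogeneity determines the
  radial entries of the Hessian there, and the one-variable second derivative test yields all
  conditions. In each principal direction the gradient condition is one linear relation between two
  third derivatives, so after substitution the sign of the third-order terms is that of a polynomial
  in the two radii. The maximum as a function of time is only bounded from the left, by the value at
  a fixed normal, because the maximiser may jump. The Gauss map is inverted only locally; strict
  convexity enters through the invertibility of its differential and the positivity of the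
  radii.\<close>

lemma Ck_on_cong:
  assumes "open U" "\<And>x. x \<in> U \<Longrightarrow> f x = g x" "Ck_on k U f"
  shows "Ck_on k U g"
  using assms(2,3)
proof (induction k arbitrary: f g)
  case 0
  then show ?case using continuous_on_cong[OF refl, of U f g] by simp
next
  case (Suc k)
  have d: "g differentiable (at x)" "frechet_derivative f (at x) = frechet_derivative g (at x)" if "x \<in> U" for x
  proof -
    have "(f has_derivative frechet_derivative f (at x)) (at x)"
      using Suc.prems(2) that frechet_derivative_works by auto
    then have "(g has_derivative frechet_derivative f (at x)) (at x)"
      using has_derivative_transform_within_open[OF _ assms(1) that] Suc.prems(1) by metis
    then show "g differentiable (at x)" "frechet_derivative f (at x) = frechet_derivative g (at x)"
      using frechet_derivative_at differentiable_def by blast+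
  qed
  then show ?case
    using Suc.prems(2) Suc.IH[of "\<lambda>x. frechet_derivative f (at x) v" "\<lambda>x. frechet_derivative g (at x) v" for v]
    by simp
qed

text \<open>\<open>frechet_derivative\<close> is a choice operator; uniqueness of the derivative on
  an open set lets an explicit formula stand in for it.\<close>

lemma Ck_on_SucI:
  assumes "open U" "\<And>x. x \<in> U \<Longrightarrow> (f has_derivative f' x) (at x)" "\<And>v. Ck_on k U (\<lambda>x. f' x v)"
  shows "Ck_on (Suc k) U f"
proof -
  have "f' x v = frechet_derivative f (at x) v" if "x \<in> U" for x v
    using frechet_derivative_at[OF assms(2)[OF that]] by simp
  then have "Ck_on k U (\<lambda>x. frechet_derivative f (at x) v)" for v
    by (intro Ck_on_cong[OF assms(1) _ assms(3)[of v]])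
  then show ?thesis
    using assms(2) by (auto simp: differentiable_def)
qed

lemma Ck_on_continuous: "Ck_on k U f \<Longrightarrow> open U \<Longrightarrow> continuous_on U f"
  by (cases k) (auto simp: continuous_at_imp_continuous_on differentiable_imp_continuous_within)

lemma Ck_on_SucD: "Ck_on (Suc k) U f \<Longrightarrow> open U \<Longrightarrow> Ck_on k U f"
proof (induction k arbitrary: f)
  case 0
  then show ?case using Ck_on_continuous[OF 0] by simp
qed (metis Ck_on.simps(2))

lemma Ck_on_has_derivative:
  "Ck_on (Suc k) U f \<Longrightarrow> x \<in> U \<Longrightarrow> (f has_derivative frechet_derivative f (at x)) (at x)"
  using frechet_derivative_works by auto

lemma Ck_on_subset: "Ck_on k U f \<Longrightarrow> V \<subseteq> U \<Longrightarrow> Ck_on k V f"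
  by (induction k arbitrary: f) (auto intro: continuous_on_subset)

lemma Ck_on_const: "Ck_on k U (\<lambda>x. c)"
  by (induction k arbitrary: c) (auto)

lemma Ck_on_linear:
  assumes "open U" "bounded_linear L"
  shows "Ck_on k U L"
proof (cases k)
  case 0
  then show ?thesis by (simp add: assms(2) linear_continuous_on)
next
  case (Suc j)
  have "(L has_derivative L) (at x)" for x
    using assms(2) by (simp add: bounded_linear_imp_has_derivative)
  then show ?thesis
    unfolding Suc by (rule Ck_on_SucI[OF assms(1)]) (rule Ck_on_const)
qed

lemma Ck_on_add:
  assumes "open U" "Ck_on k U f" "Ck_on k U g"
  shows "Ck_on k U (\<lambda>x. f x + g x)"
  using assms(2,3)
proof (induction k arbitrary: f g)
  case (Suc k)
  show ?case
  proof (rule Ck_on_SucI[OF assms(1)])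
    show "((\<lambda>x. f x + g x) has_derivative (\<lambda>v. frechet_derivative f (at x) v + frechet_derivative g (at x) v)) (at x)"
      if "x \<in> U" for x
      using that Suc.prems by (intro has_derivative_add Ck_on_has_derivative)
    show "Ck_on k U (\<lambda>x. frechet_derivative f (at x) v + frechet_derivative g (at x) v)" for v
      using Suc by auto
  qed
qed (auto intro: continuous_on_add)

lemma Ck_on_bilinear:
  assumes "bounded_bilinear h" "open U" "Ck_on k U f" "Ck_on k U g"
  shows "Ck_on k U (\<lambda>x. h (f x) (g x))"
  using assms(3,4)
proof (induction k arbitrary: f g)
  case 0
  then show ?case by (simp add: bounded_bilinear.continuous_on[OF assms(1)])
next
  case (Suc k)
  show ?case
  proof (rule Ck_on_SucI[OF assms(2)])
    show "((\<lambda>x. h (f x) (g x)) has_derivative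
        (\<lambda>v. h (f x) (frechet_derivative g (at x) v) + h (frechet_derivative f (at x) v) (g x))) (at x)"
      if "x \<in> U" for x
      using that Suc.prems by (intro bounded_bilinear.FDERIV[OF assms(1)] Ck_on_has_derivative)
    have "Ck_on k U f" "Ck_on k U g"
      using Suc.prems Ck_on_SucD assms(2) by blast+
    then show "Ck_on k U (\<lambda>x. h (f x) (frechet_derivative g (at x) v) + h (frechet_derivative f (at x) v) (g x))" for v
      using Suc by (intro Ck_on_add assms) auto
  qed
qed

lemma Ck_on_linear_comp:
  assumes "bounded_linear L" "open U" "Ck_on k U f"
  shows "Ck_on k U (\<lambda>x. L (f x))"
  using assms(3)
proof (induction k arbitrary: f)
  case 0
  then show ?case by (simp add: assms(1) bounded_linear.continuous_on)
next
  case (Suc k)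
  show ?case
  proof (rule Ck_on_SucI[OF assms(2)])
    show "((\<lambda>x. L (f x)) has_derivative (\<lambda>v. L (frechet_derivative f (at x) v))) (at x)" if "x \<in> U" for x
      using that Suc.prems by (intro bounded_linear.has_derivative[OF assms(1)] Ck_on_has_derivative)
    show "Ck_on k U (\<lambda>x. L (frechet_derivative f (at x) v))" for v
      using Suc by auto
  qed
qed

lemma Ck_on_sum:
  assumes "open U" "\<And>i. i \<in> I \<Longrightarrow> Ck_on k U (f i)"
  shows "Ck_on k U (\<lambda>x. \<Sum>i\<in>I. f i x)"
  using assms(2) by (induction I rule: infinite_finite_induct) (auto intro: Ck_on_const Ck_on_add assms(1))

lemma Ck_on_compose:
  assumes "open U" "open V" "Ck_on k U f" "Ck_on k V g" "f ` U \<subseteq> V"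
  shows "Ck_on k U (\<lambda>x. g (f x))"
  using assms(3,4)
proof (induction k arbitrary: g)
  case 0
  then show ?case using continuous_on_compose2[of V g U f] assms(5) by simp
next
  case (Suc k)
  \<comment> \<open>\<open>Ck_on\<close> differentiates in fixed directions only, while in the chain
    rule the inner direction moves with the point. Expanding it in the basis leaves fixed directions
    and variable coefficients.\<close>
  have lin: "g' (f' v) = (\<Sum>b\<in>Basis. (f' v \<bullet> b) *\<^sub>R g' b)" if "linear g'" for f' :: "'a \<Rightarrow> 'b" and g' v
  proof -
    have "g' (f' v) = g' (\<Sum>b\<in>Basis. (f' v \<bullet> b) *\<^sub>R b)"
      by (simp add: euclidean_representation)
    then show ?thesis
      using that by (simp add: linear_sum linear_scale)
  qed
  show ?case
  proof (rule Ck_on_SucI[OF assms(1)])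
    show "((\<lambda>x. g (f x)) has_derivative
        (\<lambda>v. \<Sum>b\<in>Basis. (frechet_derivative f (at x) v \<bullet> b) *\<^sub>R frechet_derivative g (at (f x)) b)) (at x)"
      if "x \<in> U" for x
    proof -
      have g: "(g has_derivative frechet_derivative g (at (f x))) (at (f x))"
        using that assms(5) Suc.prems by (intro Ck_on_has_derivative) auto
      have f: "(f has_derivative frechet_derivative f (at x)) (at x)"
        using that Suc.prems by (intro Ck_on_has_derivative)
      have "((\<lambda>x. g (f x)) has_derivative (\<lambda>v. frechet_derivative g (at (f x)) (frechet_derivative f (at x) v))) (at x)"
        using has_derivative_compose[OF f g] .
      then show ?thesis
        using lin[OF has_derivative_linear[OF g]] by simp
    qed
    have "Ck_on k U f" using Suc.prems(1) Ck_on_SucD assms(1) by blast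
    then show "Ck_on k U (\<lambda>x. \<Sum>b\<in>Basis. (frechet_derivative f (at x) v \<bullet> b) *\<^sub>R frechet_derivative g (at (f x)) b)" for v
      using Suc.prems
      by (intro Ck_on_sum assms(1) Ck_on_bilinear[OF bounded_bilinear_scaleR]
            Ck_on_linear_comp[OF bounded_linear_inner_left] Suc.IH) auto
  qed
qed

text \<open>Serves functions whose derivative is an expression in the function itself: the
  reciprocal, the norm and a local inverse.\<close>

lemma smooth_on_bootstrap: "(\<And>k. Ck_on k U f \<Longrightarrow> Ck_on (Suc k) U f) \<Longrightarrow> continuous_on U f \<Longrightarrow> smooth_on U f"
  unfolding smooth_on_def
proof
  fix k assume "\<And>k. Ck_on k U f \<Longrightarrow> Ck_on (Suc k) U f" "continuous_on U f"
  then show "Ck_on k U f" by (induction k) auto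
qed

lemma smooth_on_subset: "smooth_on U f \<Longrightarrow> V \<subseteq> U \<Longrightarrow> smooth_on V f"
  unfolding smooth_on_def using Ck_on_subset by blast
lemma smooth_on_const: "smooth_on U (\<lambda>x. c)"
  by (simp add: smooth_on_def Ck_on_const)
lemma smooth_on_linear: "open U \<Longrightarrow> bounded_linear L \<Longrightarrow> smooth_on U L"
  by (simp add: smooth_on_def Ck_on_linear)
lemma smooth_on_add: "open U \<Longrightarrow> smooth_on U f \<Longrightarrow> smooth_on U g \<Longrightarrow> smooth_on U (\<lambda>x. f x + g x)"
  by (simp add: smooth_on_def Ck_on_add)
lemma smooth_on_bilinear:
  "bounded_bilinear h \<Longrightarrow> open U \<Longrightarrow> smooth_on U f \<Longrightarrow> smooth_on U g \<Longrightarrow> smooth_on U (\<lambda>x. h (f x) (g x))"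
  by (simp add: smooth_on_def Ck_on_bilinear)
lemma smooth_on_linear_comp:
  "bounded_linear L \<Longrightarrow> open U \<Longrightarrow> smooth_on U f \<Longrightarrow> smooth_on U (\<lambda>x. L (f x))"
  by (simp add: smooth_on_def Ck_on_linear_comp)
lemma smooth_on_compose:
  "open U \<Longrightarrow> open V \<Longrightarrow> smooth_on U f \<Longrightarrow> smooth_on V g \<Longrightarrow> f ` U \<subseteq> V \<Longrightarrow> smooth_on U (\<lambda>x. g (f x))"
  by (simp add: smooth_on_def Ck_on_compose)
lemma smooth_on_deriv: "smooth_on U f \<Longrightarrow> smooth_on U (\<lambda>x. frechet_derivative f (at x) v)"
  unfolding smooth_on_def by (metis Ck_on.simps(2))
lemma smooth_on_continuous_on: "smooth_on U f \<Longrightarrow> continuous_on U f"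
  unfolding smooth_on_def by (metis Ck_on.simps(1))
lemma smooth_on_has_derivative:
  "smooth_on U f \<Longrightarrow> x \<in> U \<Longrightarrow> (f has_derivative frechet_derivative f (at x)) (at x)"
  unfolding smooth_on_def by (metis Ck_on_has_derivative)

lemmas smooth_on_scaleR = smooth_on_bilinear[OF bounded_bilinear_scaleR]
lemmas smooth_on_mult = smooth_on_bilinear[OF bounded_bilinear_mult]
lemmas smooth_on_inner = smooth_on_bilinear[OF bounded_bilinear_inner]

lemma smooth_on_Pair:
  assumes "open U" "smooth_on U f" "smooth_on U g"
  shows "smooth_on U (\<lambda>x. (f x, g x))"
proof -
  have "bounded_linear (\<lambda>x::'b. (x, 0::'c))" "bounded_linear (\<lambda>x::'c. (0::'b, x))"
    by (simp_all add: bounded_linear_Pair bounded_linear_ident bounded_linear_zero)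
  then have "smooth_on U (\<lambda>x. (f x, 0::'c))" "smooth_on U (\<lambda>x. (0::'b, g x))"
    using smooth_on_linear_comp assms by blast+
  then show ?thesis
    using smooth_on_add[OF assms(1), of "\<lambda>x. (f x, 0)" "\<lambda>x. (0, g x)"] by simp
qed

lemma smooth_on_inverse: "smooth_on (- {0}) (inverse :: real \<Rightarrow> real)"
proof (rule smooth_on_bootstrap)
  show "continuous_on (- {0}) (inverse :: real \<Rightarrow> real)"
    by (intro continuous_on_inverse continuous_intros) auto
next
  fix k assume k: "Ck_on k (- {0}) (inverse :: real \<Rightarrow> real)"
  show "Ck_on (Suc k) (- {0}) (inverse :: real \<Rightarrow> real)"
  proof (rule Ck_on_SucI)
    show "(inverse has_derivative (\<lambda>v. (- v) * (inverse x * inverse x))) (at x)" if "x \<in> - {0}" for x :: real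
      using has_derivative_inverse'[of x UNIV] that by (simp add: algebra_simps)
    show "Ck_on k (- {0}) (\<lambda>x. (- v) * (inverse x * inverse x))" for v :: real
      by (intro Ck_on_bilinear[OF bounded_bilinear_mult] Ck_on_const k) auto
  qed auto
qed

lemma smooth_on_inverse_comp:
  fixes f :: "'a::euclidean_space \<Rightarrow> real"
  assumes "open U" "smooth_on U f" "\<And>x. x \<in> U \<Longrightarrow> f x \<noteq> 0"
  shows "smooth_on U (\<lambda>x. inverse (f x))"
  by (rule smooth_on_compose[OF assms(1) _ assms(2) smooth_on_inverse]) (use assms in auto)

lemma smooth_on_norm: "smooth_on (- {0}) (norm :: 'a::euclidean_space \<Rightarrow> real)"
proof (rule smooth_on_bootstrap)
  show "continuous_on (- {0}) (norm :: 'a \<Rightarrow> real)"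
    by (intro continuous_intros)
next
  fix k assume k: "Ck_on k (- {0}) (norm :: 'a \<Rightarrow> real)"
  show "Ck_on (Suc k) (- {0}) (norm :: 'a \<Rightarrow> real)"
  proof (rule Ck_on_SucI)
    show "(norm has_derivative (\<lambda>v. (x \<bullet> v) * inverse (norm x))) (at x)" if "x \<in> - {0}" for x :: 'a
      using has_derivative_norm[of x] that by (simp add: sgn_div_norm inner_commute field_simps)
    have "Ck_on k (- {0::'a}) (\<lambda>x. inverse (norm x))"
      using smooth_on_inverse by (intro Ck_on_compose[OF _ _ k, of "- {0}"]) (auto simp: smooth_on_def)
    then show "Ck_on k (- {0}) (\<lambda>x. (x \<bullet> v) * inverse (norm x))" for v :: 'a
      by (intro Ck_on_bilinear[OF bounded_bilinear_mult] Ck_on_linear[OF _ bounded_linear_inner_left]) auto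
  qed auto
qed

lemma smooth_on_norm_comp:
  assumes "open U" "smooth_on U f" "\<And>x. x \<in> U \<Longrightarrow> f x \<noteq> 0"
  shows "smooth_on U (\<lambda>x. norm (f x))"
  by (rule smooth_on_compose[OF assms(1) _ assms(2) smooth_on_norm]) (use assms in auto)

section \<open>Directional derivatives\<close>

unbundle cross3_syntax

text \<open>The direction precedes the point so that derivatives iterate:
  \<open>pd (pd f u) v\<close> is a function again.\<close>

definition pd :: "('a::euclidean_space \<Rightarrow> 'b::euclidean_space) \<Rightarrow> 'a \<Rightarrow> 'a \<Rightarrow> 'b" where
  "pd f v = (\<lambda>x. frechet_derivative f (at x) v)"

lemma smooth_on_pd: "smooth_on U f \<Longrightarrow> smooth_on U (pd f v)"
  by (simp add: pd_def smooth_on_deriv)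

lemma pd_eqI: "(f has_derivative f') (at x) \<Longrightarrow> pd f v x = f' v"
  by (simp add: pd_def frechet_derivative_at[symmetric])

lemma pd_has_derivative: "smooth_on U f \<Longrightarrow> x \<in> U \<Longrightarrow> (f has_derivative (\<lambda>v. pd f v x)) (at x)"
  by (simp add: pd_def smooth_on_has_derivative)

lemma pd_bounded_linear: "smooth_on U f \<Longrightarrow> x \<in> U \<Longrightarrow> bounded_linear (\<lambda>v. pd f v x)"
  using pd_has_derivative has_derivative_bounded_linear by blast

lemma pd_linear: "smooth_on U f \<Longrightarrow> x \<in> U \<Longrightarrow> linear (\<lambda>v. pd f v x)"
  using pd_bounded_linear bounded_linear.linear by blast

lemma pd_cong:
  assumes "open U" "x \<in> U" "\<And>y. y \<in> U \<Longrightarrow> f y = g y" "smooth_on U f"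
  shows "pd f v x = pd g v x"
proof -
  have "(g has_derivative (\<lambda>v. pd f v x)) (at x)"
    using has_derivative_transform_within_open[OF pd_has_derivative[OF assms(4,2)] assms(1,2)] assms(3) by blast
  then show ?thesis
    by (simp add: pd_eqI)
qed

lemma pd_linear_comp:
  assumes "smooth_on U f" "x \<in> U" "bounded_linear L"
  shows "pd (\<lambda>y. L (f y)) v x = L (pd f v x)"
  by (rule pd_eqI) (rule bounded_linear.has_derivative[OF assms(3) pd_has_derivative[OF assms(1,2)]])

lemma pd_DERIV_line:
  fixes f :: "'a::euclidean_space \<Rightarrow> real"
  assumes "smooth_on U f" "x + s *\<^sub>R v \<in> U"
  shows "((\<lambda>s. f (x + s *\<^sub>R v)) has_real_derivative pd f v (x + s *\<^sub>R v)) (at s)"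
proof -
  have "((\<lambda>s. f (x + s *\<^sub>R v)) has_derivative (\<lambda>h. pd f (h *\<^sub>R v) (x + s *\<^sub>R v))) (at s)"
  proof -
    have "((\<lambda>s. x + s *\<^sub>R v) has_derivative (\<lambda>h. h *\<^sub>R v)) (at s)"
      by (auto intro!: derivative_eq_intros)
    then show ?thesis
      by (rule has_derivative_compose[of _ _ _ _ f]) (rule pd_has_derivative[OF assms])
  qed
  then show ?thesis
    using linear_scale[OF pd_linear[OF assms]] by (simp add: has_field_derivative_def mult_commute_abs)
qed

section \<open>Symmetry of second derivatives and local inverses\<close>

text \<open>The mean value theorem, once in direction \<open>u\<close> and once in direction
  \<open>v\<close>. The left side is symmetric in \<open>u\<close> and \<open>v\<close>, the right
  side is not; \<open>pd_commute_real\<close> exploits this.\<close>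

lemma second_difference:
  fixes f :: "'a::euclidean_space \<Rightarrow> real"
  assumes "open U" "smooth_on U f" "0 < h"
    and U: "\<And>s t. 0 \<le> s \<Longrightarrow> s \<le> h \<Longrightarrow> 0 \<le> t \<Longrightarrow> t \<le> h \<Longrightarrow> x + s *\<^sub>R u + t *\<^sub>R v \<in> U"
  obtains s t where "0 < s" "s < h" "0 < t" "t < h"
    "f (x + h *\<^sub>R u + h *\<^sub>R v) - f (x + h *\<^sub>R u) - f (x + h *\<^sub>R v) + f x
       = h * h * pd (pd f u) v (x + s *\<^sub>R u + t *\<^sub>R v)"
proof -
  define \<phi> where "\<phi> s = f ((x + h *\<^sub>R v) + s *\<^sub>R u) - f (x + s *\<^sub>R u)" for s
  have "\<exists>s>0. s < h \<and> \<phi> h - \<phi> 0 = (h - 0) * (pd f u ((x + h *\<^sub>R v) + s *\<^sub>R u) - pd f u (x + s *\<^sub>R u))"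
    unfolding \<phi>_def
  proof (rule MVT2[OF assms(3)])
    fix s assume "0 \<le> s" "s \<le> h"
    then have "(x + h *\<^sub>R v) + s *\<^sub>R u \<in> U" "x + s *\<^sub>R u \<in> U"
      using U[of s h] U[of s 0] assms(3) by (auto simp: algebra_simps)
    then show "((\<lambda>s. f ((x + h *\<^sub>R v) + s *\<^sub>R u) - f (x + s *\<^sub>R u)) has_real_derivative
        (pd f u ((x + h *\<^sub>R v) + s *\<^sub>R u) - pd f u (x + s *\<^sub>R u))) (at s)"
      by (intro DERIV_diff pd_DERIV_line[OF assms(2)])
  qed
  then obtain s where s: "0 < s" "s < h"
    "\<phi> h - \<phi> 0 = h * (pd f u ((x + h *\<^sub>R v) + s *\<^sub>R u) - pd f u (x + s *\<^sub>R u))" by auto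
  have "\<exists>t>0. t < h \<and> pd f u ((x + s *\<^sub>R u) + h *\<^sub>R v) - pd f u ((x + s *\<^sub>R u) + 0 *\<^sub>R v)
      = (h - 0) * pd (pd f u) v ((x + s *\<^sub>R u) + t *\<^sub>R v)"
    using s U by (intro MVT2[OF assms(3)] pd_DERIV_line[OF smooth_on_pd[OF assms(2)]]) auto
  then obtain t where t: "0 < t" "t < h"
    "pd f u ((x + s *\<^sub>R u) + h *\<^sub>R v) - pd f u (x + s *\<^sub>R u) = h * pd (pd f u) v ((x + s *\<^sub>R u) + t *\<^sub>R v)"
    by auto
  have "\<phi> h - \<phi> 0 = h * h * pd (pd f u) v (x + s *\<^sub>R u + t *\<^sub>R v)"
    using s(3) t(3) by (simp add: algebra_simps)
  with s t show thesis
    by (intro that[of s t]) (auto simp: \<phi>_def algebra_simps)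
qed

lemma pd_commute_real:
  fixes f :: "'a::euclidean_space \<Rightarrow> real"
  assumes "open U" "smooth_on U f" "x \<in> U"
  shows "pd (pd f u) v x = pd (pd f v) u x"
proof (rule ccontr)
  assume ne: "pd (pd f u) v x \<noteq> pd (pd f v) u x"
  define e where "e = \<bar>pd (pd f u) v x - pd (pd f v) u x\<bar> / 2"
  have e: "e > 0" using ne by (simp add: e_def)
  have cont: "continuous (at x) (pd (pd f u) v)" "continuous (at x) (pd (pd f v) u)"
    using smooth_on_continuous_on[OF smooth_on_pd[OF smooth_on_pd[OF assms(2)]]] assms(1,3)
    by (simp_all add: continuous_on_eq_continuous_at)
  obtain d1 where d1: "d1 > 0" "\<And>y. dist y x < d1 \<Longrightarrow> dist (pd (pd f u) v y) (pd (pd f u) v x) < e"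
    using cont(1) e by (auto simp: continuous_at_eps_delta dist_norm)
  obtain d2 where d2: "d2 > 0" "\<And>y. dist y x < d2 \<Longrightarrow> dist (pd (pd f v) u y) (pd (pd f v) u x) < e"
    using cont(2) e by (auto simp: continuous_at_eps_delta dist_norm)
  obtain d3 where d3: "d3 > 0" "ball x d3 \<subseteq> U"
    using assms openE by blast
  define d where "d = min d1 (min d2 d3)"
  \<comment> \<open>The parallelogram with edges \<open>h u\<close> and \<open>h v\<close> has to
    stay in all three balls; the summand 1 keeps the denominator nonzero when both directions
    vanish.\<close>
  define h where "h = d / (2 * (norm u + norm v + 1))"
  have h: "0 < h" "h * (norm u + norm v) < d"
  proof -
    show "0 < h"
      using d1 d2 d3 by (auto simp: h_def d_def intro!: divide_pos_pos add_nonneg_pos)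
    have "h * (2 * (norm u + norm v + 1)) = d"
      unfolding h_def by (smt (verit) nonzero_eq_divide_eq norm_ge_zero)
    then show "h * (norm u + norm v) < d"
      using \<open>0 < h\<close> mult_nonneg_nonneg[of h "norm u"] mult_nonneg_nonneg[of h "norm v"]
      by (simp add: algebra_simps del: mult_nonneg_nonneg)
  qed
  have dist: "dist (x + s *\<^sub>R u + t *\<^sub>R v) x < d" if "0 \<le> s" "s \<le> h" "0 \<le> t" "t \<le> h" for s t
  proof -
    have "norm (s *\<^sub>R u + t *\<^sub>R v) \<le> s * norm u + t * norm v"
      using that norm_triangle_ineq[of "s *\<^sub>R u" "t *\<^sub>R v"] by simp
    also have "\<dots> \<le> h * norm u + h * norm v"
      using that by (intro add_mono mult_right_mono) auto
    finally show ?thesis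
      using h by (simp add: dist_norm algebra_simps)
  qed
  have U1: "x + s *\<^sub>R u + t *\<^sub>R v \<in> U" if "0 \<le> s" "s \<le> h" "0 \<le> t" "t \<le> h" for s t
    using dist[OF that] d3 by (auto simp: d_def dist_commute)
  have U2: "x + s *\<^sub>R v + t *\<^sub>R u \<in> U" if "0 \<le> s" "s \<le> h" "0 \<le> t" "t \<le> h" for s t
    using U1[OF that(3,4,1,2)] by (simp add: add_ac)
  obtain s t where st: "0 < s" "s < h" "0 < t" "t < h"
    "f (x + h *\<^sub>R u + h *\<^sub>R v) - f (x + h *\<^sub>R u) - f (x + h *\<^sub>R v) + f x
       = h * h * pd (pd f u) v (x + s *\<^sub>R u + t *\<^sub>R v)"
    using second_difference[OF assms(1,2) h(1) U1] by blast
  obtain s' t' where st': "0 < s'" "s' < h" "0 < t'" "t' < h"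
    "f (x + h *\<^sub>R v + h *\<^sub>R u) - f (x + h *\<^sub>R v) - f (x + h *\<^sub>R u) + f x
       = h * h * pd (pd f v) u (x + s' *\<^sub>R v + t' *\<^sub>R u)"
    using second_difference[OF assms(1,2) h(1) U2] by blast
  have "h * h * pd (pd f u) v (x + s *\<^sub>R u + t *\<^sub>R v) = h * h * pd (pd f v) u (x + t' *\<^sub>R u + s' *\<^sub>R v)"
  proof -
    have "x + h *\<^sub>R v + h *\<^sub>R u = x + h *\<^sub>R u + h *\<^sub>R v" "x + s' *\<^sub>R v + t' *\<^sub>R u = x + t' *\<^sub>R u + s' *\<^sub>R v"
      by (simp_all add: add_ac)
    then show ?thesis
      using st(5) st'(5) by (metis (no_types, opaque_lifting) add.commute diff_diff_eq)
  qed
  then have eq: "pd (pd f u) v (x + s *\<^sub>R u + t *\<^sub>R v) = pd (pd f v) u (x + t' *\<^sub>R u + s' *\<^sub>R v)"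
    using h(1) by simp
  have "\<bar>pd (pd f u) v (x + s *\<^sub>R u + t *\<^sub>R v) - pd (pd f u) v x\<bar> < e"
    using d1(2)[of "x + s *\<^sub>R u + t *\<^sub>R v"] dist[of s t] st by (auto simp: d_def dist_real_def)
  moreover have "\<bar>pd (pd f v) u (x + t' *\<^sub>R u + s' *\<^sub>R v) - pd (pd f v) u x\<bar> < e"
    using d2(2)[of "x + t' *\<^sub>R u + s' *\<^sub>R v"] dist[of t' s'] st' by (auto simp: d_def dist_real_def)
  ultimately show False
    using eq unfolding e_def by (smt (verit) field_sum_of_halves)
qed

lemma pd_commute:
  assumes "open U" "smooth_on U f" "x \<in> U"
  shows "pd (pd f u) v x = pd (pd f v) u x"
proof (rule euclidean_eqI)
  fix b :: 'b assume "b \<in> Basis"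
  have *: "pd (pd f u) v x \<bullet> b = pd (pd (\<lambda>y. f y \<bullet> b) u) v x" for u v
  proof -
    have sm: "smooth_on U (\<lambda>y. pd f u y \<bullet> b)"
      by (intro smooth_on_linear_comp[OF bounded_linear_inner_left] assms smooth_on_pd)
    have "pd (pd f u) v x \<bullet> b = pd (\<lambda>y. pd f u y \<bullet> b) v x"
      by (rule pd_linear_comp[OF smooth_on_pd[OF assms(2)] assms(3) bounded_linear_inner_left, symmetric])
    also have "\<dots> = pd (pd (\<lambda>y. f y \<bullet> b) u) v x"
      by (rule pd_cong[OF assms(1,3) _ sm])
        (rule pd_linear_comp[OF assms(2) _ bounded_linear_inner_left, symmetric])
    finally show ?thesis .
  qed
  have "smooth_on U (\<lambda>y. f y \<bullet> b)"
    by (intro smooth_on_linear_comp[OF bounded_linear_inner_left] assms)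
  then show "pd (pd f u) v x \<bullet> b = pd (pd f v) u x \<bullet> b"
    unfolding * by (intro pd_commute_real[OF assms(1) _ assms(3)])
qed

section \<open>Cramer's rule and smooth local inverses\<close>

lemma bounded_bilinear_cross3: "bounded_bilinear cross3"
  using bilinear_cross bilinear_conv_bounded_bilinear by blast

lemmas smooth_on_cross3 = smooth_on_bilinear[OF bounded_bilinear_cross3]

abbreviation ax :: "3 \<Rightarrow> real^3" where "ax i \<equiv> axis i 1"

text \<open>The adjugate matrix, written with cross products of the columns of \<open>L\<close>. It
  is polynomial in the columns, so its smooth dependence on a parameter is immediate.\<close>

definition cofac :: "(real^3 \<Rightarrow> real^3) \<Rightarrow> real^3 \<Rightarrow> real^3" where
  "cofac L w = (w \<bullet> (L (ax 2) \<times> L (ax 3))) *\<^sub>R ax 1 + (w \<bullet> (L (ax 3) \<times> L (ax 1))) *\<^sub>R ax 2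
     + (w \<bullet> (L (ax 1) \<times> L (ax 2))) *\<^sub>R ax 3"

lemma vec3_expand: "(u::real^3) = (u$1) *\<^sub>R ax 1 + (u$2) *\<^sub>R ax 2 + (u$3) *\<^sub>R ax 3"
  by (simp add: vec_eq_iff forall_3 axis_def)

lemma linear_vec3: "linear L \<Longrightarrow> L u = (u$1) *\<^sub>R L (ax 1) + (u$2) *\<^sub>R L (ax 2) + (u$3) *\<^sub>R L (ax 3)"
  for L :: "real^3 \<Rightarrow> 'b::real_vector"
  by (subst vec3_expand) (simp add: linear_add linear_scale)

lemma cofac_apply:
  assumes "linear L"
  shows "cofac L (L u) = (L (ax 1) \<bullet> (L (ax 2) \<times> L (ax 3))) *\<^sub>R u"
proof -
  obtain a b c where abc: "L (ax 1) = a" "L (ax 2) = b" "L (ax 3) = c" by simp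
  show ?thesis
    unfolding cofac_def linear_vec3[OF assms, of u] abc
    by (simp add: vec_eq_iff forall_3 axis_def cross3_simps)
qed

text \<open>A vanishing determinant makes the adjugate zero on the range, hence everywhere. The
  columns are then pairwise parallel, and surjectivity forces the first one to vanish.\<close>

lemma det_nonzero:
  assumes "linear L" "inj L"
  shows "L (ax 1) \<bullet> (L (ax 2) \<times> L (ax 3)) \<noteq> (0::real)"
proof
  assume 0: "L (ax 1) \<bullet> (L (ax 2) \<times> L (ax 3)) = 0"
  have "surj L" using assms linear_injective_imp_surjective by blast
  then have "cofac L w = 0" for w
    using cofac_apply[OF assms(1)] 0 by (metis scale_zero_left surjD)
  then have z: "w \<bullet> (L (ax 2) \<times> L (ax 3)) = 0" "w \<bullet> (L (ax 3) \<times> L (ax 1)) = 0"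
     "w \<bullet> (L (ax 1) \<times> L (ax 2)) = 0" for w
    unfolding cofac_def by (auto simp: vec_eq_iff forall_3 axis_def)
  then have c: "L (ax 2) \<times> L (ax 3) = 0" "L (ax 3) \<times> L (ax 1) = 0" "L (ax 1) \<times> L (ax 2) = 0"
    using inner_eq_zero_iff by blast+
  have "L u \<times> L (ax 1) = 0" for u
    unfolding linear_vec3[OF assms(1), of u] using c cross_skew[of "L (ax 2)" "L (ax 1)"]
    by (simp add: cross_add_left cross_mult_left)
  then have "L (ax 1) = 0"
    using \<open>surj L\<close> by (metis cross_basis_nonzero cross_skew neg_equal_0_iff_equal surjD)
  then have "ax 1 = 0"
    using assms by (metis injD linear_0)
  then show False by (simp add: axis_eq_0_iff)
qed

lemma smooth_on_cofac:
  assumes "open U" "\<And>i. smooth_on U (\<lambda>x. L x (ax i))" "smooth_on U w"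
  shows "smooth_on U (\<lambda>x. cofac (L x) (w x))"
  unfolding cofac_def
  by (intro smooth_on_add smooth_on_scaleR smooth_on_inner smooth_on_cross3 smooth_on_const assms)

text \<open>Time is carried along as a second component, so the Jacobian is block triangular and
  only its spatial block has to be injective. The inverse function theorem supplies a differentiable
  inverse; smoothness follows by bootstrapping from a formula for its derivative.\<close>

lemma smooth_local_inverse:
  fixes N :: "(real^3) \<times> real \<Rightarrow> real^3"
  assumes "open U" "smooth_on U N" "x0 \<in> U" and inj: "\<And>u. pd N (u, 0) x0 = 0 \<Longrightarrow> u = 0"
  obtains W V g where "open W" "W \<subseteq> U" "x0 \<in> W" "open V"
    "homeomorphism W V (\<lambda>x. (N x, snd x)) g" "smooth_on V g"
    "\<And>x u. x \<in> W \<Longrightarrow> pd N (u, 0) x = 0 \<Longrightarrow> u = 0"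
proof -
  define F where "F x = (N x, snd x)" for x
  define F' where "F' x = Blinfun (\<lambda>v. (pd N v x, snd v))" for x
  have F': "blinfun_apply (F' x) = (\<lambda>v. (pd N v x, snd v))" if "x \<in> U" for x
    unfolding F'_def using pd_bounded_linear[OF assms(2) that]
    by (intro bounded_linear_Blinfun_apply bounded_linear_Pair bounded_linear_snd)
  have derF: "(F has_derivative blinfun_apply (F' x)) (at x)" if "x \<in> U" for x
    unfolding F'[OF that] F_def
    by (intro has_derivative_Pair pd_has_derivative[OF assms(2) that] has_derivative_snd has_derivative_ident)
  have contF': "continuous_on U F'"
  proof (rule continuous_on_blinfun_componentwise)
    fix i :: "(real^3) \<times> real"
    have "continuous_on U (\<lambda>x. (pd N i x, snd i))"
      by (intro continuous_on_Pair smooth_on_continuous_on smooth_on_pd assms continuous_on_const)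
    then show "continuous_on U (\<lambda>x. blinfun_apply (F' x) i)"
      by (rule continuous_on_eq) (simp add: F')
  qed
  have lin0: "linear (\<lambda>v. (pd N v x0, snd v))"
    using blinfun.bounded_linear_right[of "F' x0"] F'[OF assms(3)] by (simp add: bounded_linear.linear)
  have "inj (blinfun_apply (F' x0))"
    unfolding F'[OF assms(3)] linear_injective_0[OF lin0] using inj by (auto simp: prod_eq_iff)
  then obtain G where G: "linear G" "G \<circ> blinfun_apply (F' x0) = id"
    using linear_injective_left_inverse blinfun.bounded_linear_right bounded_linear.linear by blast
  have "Blinfun G o\<^sub>L F' x0 = id_blinfun"
    using G by (intro blinfun_eqI) (simp add: bounded_linear_Blinfun_apply linear_conv_bounded_linear pointfree_idE)
  from inverse_function_theorem[OF assms(1) derF contF' assms(3) this]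
  obtain W V g g' where W: "open W" "W \<subseteq> U" "x0 \<in> W" "open V" and hom: "homeomorphism W V F g"
    and g: "\<And>y. y \<in> V \<Longrightarrow> (g has_derivative (g' y)) (at y)"
    and bij: "\<And>y. y \<in> V \<Longrightarrow> bij (blinfun_apply (F' (g y)))"
    by metis
  have gW: "g y \<in> W" "F (g y) = y" if "y \<in> V" for y
    using hom that by (auto simp: homeomorphism_def)
  have injW: "u = 0" if "x \<in> W" "pd N (u, 0) x = 0" for x u
  proof -
    have "x = g (F x)" "F x \<in> V" using hom that by (auto simp: homeomorphism_def)
    then have "inj (blinfun_apply (F' x))" using bij bij_is_inj by metis
    moreover have "blinfun_apply (F' x) (u, 0) = blinfun_apply (F' x) 0"
    proof -
      have "x \<in> U" using that W(2) by blast
      then show ?thesis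
        using that by (simp only: F') (simp add: linear_0[OF pd_linear[OF assms(2)]])
    qed
    ultimately have "(u, 0::real) = 0"
      using injD by metis
    then show ?thesis by (simp add: zero_prod_def)
  qed
  define L where "L x u = pd N (u, 0) x" for x u
  define d where "d x = L x (ax 1) \<bullet> (L x (ax 2) \<times> L x (ax 3))" for x
  have linL: "linear (L x)" if "x \<in> W" for x
  proof -
    have "x \<in> U" using that W(2) by blast
    have "linear (\<lambda>u::real^3. (u, 0::real))"
      by (simp add: linear_iff)
    from linear_compose[OF this pd_linear[OF assms(2) \<open>x \<in> U\<close>]] show ?thesis
      by (simp add: L_def[abs_def] o_def)
  qed
  have d: "d x \<noteq> 0" if "x \<in> W" for x
    unfolding d_def
  proof (rule det_nonzero[OF linL[OF that]])
    show "inj (L x)"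
      unfolding linear_injective_0[OF linL[OF that]] using injW[OF that] by (simp add: L_def)
  qed
  \<comment> \<open>The solution \<open>w\<close> of \<open>pd N w x = fst v\<close> and
    \<open>snd w = snd v\<close> by Cramer's rule: move the time derivative to the other side, then
    apply the adjugate divided by the determinant.\<close>
  define E where "E v x = (inverse (d x) *\<^sub>R cofac (L x) (fst v - snd v *\<^sub>R pd N (0, 1) x), snd v)" for v x
  have NW: "smooth_on W N" using assms(2) W(2) smooth_on_subset by blast
  have smL: "smooth_on W (\<lambda>x. L x u)" for u
    unfolding L_def by (rule smooth_on_pd[OF NW])
  have smd: "smooth_on W (\<lambda>x. inverse (d x))"
  proof (rule smooth_on_inverse_comp[OF W(1) _ d])
    show "smooth_on W d"
      unfolding d_def by (intro smooth_on_inner smooth_on_cross3 smL W(1))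
  qed
  have smE: "smooth_on W (E v)" for v
  proof -
    have "smooth_on W (\<lambda>x. fst v - snd v *\<^sub>R pd N (0, 1) x)"
      using smooth_on_add[OF W(1) smooth_on_const smooth_on_scaleR[OF W(1) smooth_on_const smooth_on_pd[OF NW]],
        of "fst v" "- snd v" "(0,1)"] by simp
    then show ?thesis
      unfolding E_def
      by (intro smooth_on_Pair smooth_on_const smooth_on_scaleR smd smooth_on_cofac smL W(1))
  qed
  have g'E: "g' y v = E v (g y)" if "y \<in> V" for y v
  proof -
    have gyU: "g y \<in> U" using gW(1)[OF that] W(2) by blast
    have "((\<lambda>y. F (g y)) has_derivative (\<lambda>v. F' (g y) (g' y v))) (at y)"
      by (rule has_derivative_compose[OF g[OF that] derF[OF gyU]])
    moreover have "((\<lambda>y. F (g y)) has_derivative (\<lambda>v. v)) (at y)"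
      by (rule has_derivative_transform_within_open[OF has_derivative_ident \<open>open V\<close> that]) (simp add: gW)
    ultimately have "(\<lambda>v. F' (g y) (g' y v)) = (\<lambda>v. v)"
      by (rule has_derivative_unique)
    then have "F' (g y) (g' y v) = v"
      by (rule fun_cong)
    then have v: "pd N (g' y v) (g y) = fst v" "snd (g' y v) = snd v"
      by (auto simp: F'[OF gyU] prod_eq_iff)
    have "g' y v = (fst (g' y v), 0) + snd v *\<^sub>R (0, 1)"
      using v(2) by (simp add: prod_eq_iff)
    then have "fst v = pd N (fst (g' y v), 0) (g y) + snd v *\<^sub>R pd N (0, 1) (g y)"
      using linear_add[OF pd_linear[OF assms(2) gyU], of "(fst (g' y v), 0)" "snd v *\<^sub>R (0, 1)"]
        linear_scale[OF pd_linear[OF assms(2) gyU], of "snd v" "(0, 1)"] v(1) by simp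
    then have "L (g y) (fst (g' y v)) = fst v - snd v *\<^sub>R pd N (0, 1) (g y)"
      by (simp add: L_def)
    then have "cofac (L (g y)) (fst v - snd v *\<^sub>R pd N (0, 1) (g y)) = d (g y) *\<^sub>R fst (g' y v)"
      using cofac_apply[OF linL[OF gW(1)[OF that]], of "fst (g' y v)"] by (simp add: d_def)
    then show ?thesis
      using d[OF gW(1)[OF that]] v(2) by (simp add: E_def prod_eq_iff)
  qed
  have "smooth_on V g"
  proof (rule smooth_on_bootstrap)
    show "continuous_on V g" using hom by (auto simp: homeomorphism_def)
    fix k assume k: "Ck_on k V g"
    show "Ck_on (Suc k) V g"
    proof (rule Ck_on_SucI[OF \<open>open V\<close>])
      show "(g has_derivative (\<lambda>v. E v (g y))) (at y)" if "y \<in> V" for y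
      proof -
        have "g' y = (\<lambda>v. E v (g y))" using g'E[OF that] by (intro ext)
        then show ?thesis using g[OF that] by simp
      qed
      show "Ck_on k V (\<lambda>y. E v (g y))" for v
      proof (rule Ck_on_compose[OF \<open>open V\<close> \<open>open W\<close> k])
        show "Ck_on k W (E v)" using smE[of v] by (simp add: smooth_on_def)
        show "g ` V \<subseteq> W" using gW(1) by blast
      qed
    qed
  qed
  then show thesis
    by (rule that[OF W(1,2,3,4) hom[unfolded F_def[abs_def]]]) (rule injW)
qed

section \<open>The pointwise inequality at a maximum\<close>

text \<open>Otherwise tilt \<open>M\<close> by half the mean slope between \<open>t1\<close> and
  \<open>t2\<close> and take the infimum of the times at which the tilted function is at least its
  value at \<open>t2\<close>. Upper semicontinuity shows that the infimum is attained, and the left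
  bound then produces earlier such times.\<close>

lemma nonincreasing_of_left_bound:
  fixes M :: "real \<Rightarrow> real"
  assumes usc: "\<And>t e. a < t \<Longrightarrow> t < b \<Longrightarrow> 0 < e \<Longrightarrow> eventually (\<lambda>s. M s < M t + e) (at t)"
    and left: "\<And>t e. a < t \<Longrightarrow> t < b \<Longrightarrow> 0 < e \<Longrightarrow> eventually (\<lambda>s. M t - e * (t - s) \<le> M s) (at_left t)"
    and t: "a < t1" "t1 \<le> t2" "t2 < b"
  shows "M t2 \<le> M t1"
proof (rule ccontr)
  assume "\<not> M t2 \<le> M t1"
  then have lt: "M t1 < M t2" and t12: "t1 < t2" using t by (auto simp: less_le)
  define e where "e = (M t2 - M t1) / (2 * (t2 - t1))"
  have e: "e > 0" using lt t12 by (simp add: e_def)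
  have "e * (t2 - t1) = (M t2 - M t1) / 2"
    using t12 by (simp add: e_def field_simps)
  then have gap: "M t1 - e * t1 < M t2 - e * t2"
    using lt by (simp add: algebra_simps)
  define S where "S = {t \<in> {t1..t2}. M t2 - e * t2 \<le> M t - e * t}"
  have S: "t2 \<in> S" "bdd_below S" using t12 by (auto simp: S_def intro: bdd_belowI[of _ t1])
  define s where "s = Inf S"
  have s: "t1 \<le> s" "s \<le> t2"
  proof -
    show "s \<le> t2" using cInf_lower[OF S] by (simp add: s_def)
    show "t1 \<le> s" unfolding s_def using S(1) by (intro cInf_greatest) (auto simp: S_def)
  qed
  have "s \<in> S"
  proof (rule ccontr)
    assume "s \<notin> S"
    then have d: "M t2 - e * t2 - (M s - e * s) > 0" using s by (auto simp: S_def)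
    define d where "d = M t2 - e * t2 - (M s - e * s)"
    have "eventually (\<lambda>r. M r < M s + d / 2) (at s)"
      using usc[of s "d/2"] s t d by (auto simp: d_def)
    moreover have "eventually (\<lambda>r. e * (r - s) > - d / 2) (at s)"
    proof -
      have "((\<lambda>r. e * (r - s)) \<longlongrightarrow> e * (s - s)) (at s)" by (intro tendsto_intros)
      then show ?thesis using d order_tendstoD(1)[of _ "e * (s - s)" _ "- d / 2"] by (auto simp: d_def)
    qed
    ultimately have "eventually (\<lambda>r. M r - e * r < M t2 - e * t2) (at s)"
      by eventually_elim (auto simp: d_def field_simps)
    then obtain r0 where r0: "r0 > 0" "\<And>r. r \<noteq> s \<Longrightarrow> dist r s < r0 \<Longrightarrow> M r - e * r < M t2 - e * t2"
      by (auto simp: eventually_at)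
    have "Inf S < s + r0" "S \<noteq> {}" using S(1) r0(1) by (auto simp: s_def)
    then obtain r where "r \<in> S" "r < s + r0"
      using cInf_lessD by metis
    moreover have "s \<le> r" using cInf_lower[OF \<open>r \<in> S\<close> S(2)] by (simp add: s_def)
    ultimately show False
      using r0(2)[of r] \<open>s \<notin> S\<close> by (auto simp: S_def dist_real_def)
  qed
  then have "s \<noteq> t1" using gap by (auto simp: S_def)
  then have "t1 < s" using s by simp
  have "eventually (\<lambda>r. M s - e * (s - r) \<le> M r) (at_left s)"
    using left e s t by auto
  moreover have "eventually (\<lambda>r. t1 < r \<and> r < s) (at_left s)"
    by (rule eventually_mono[OF eventually_at_left_real[OF \<open>t1 < s\<close>]]) auto
  ultimately have "eventually (\<lambda>r. r \<in> S \<and> r < s) (at_left s)"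
  proof eventually_elim
    case (elim r)
    then show ?case using \<open>s \<in> S\<close> by (auto simp: S_def algebra_simps)
  qed
  then obtain r where r: "r \<in> S" "r < s"
    using eventually_happens[of "\<lambda>r. r \<in> S \<and> r < s" "at_left s"] by auto
  then show False
    using cInf_lower[OF r(1) S(2)] by (simp add: s_def)
qed

lemma second_derivative_test:
  fixes f :: "real \<Rightarrow> real"
  assumes f: "eventually (\<lambda>s. (f has_real_derivative f' s) (at s)) (nhds x)"
    and f': "(f' has_real_derivative D) (at x)"
    and max: "eventually (\<lambda>s. f s \<le> f x) (nhds x)"
  shows "f' x = 0" "D \<le> 0"
proof -
  from eventually_conj[OF f max] obtain d where d: "d > 0"
    "\<And>s. dist s x < d \<Longrightarrow> (f has_real_derivative f' s) (at s) \<and> f s \<le> f x"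
    by (auto simp: eventually_nhds_metric)
  show 0: "f' x = 0"
    using d by (intro DERIV_local_max[of f "f' x" x d]) (auto simp: dist_real_def abs_minus_commute)
  show "D \<le> 0"
  proof (rule ccontr)
    assume "\<not> D \<le> 0"
    then obtain d' where d': "d' > 0" "\<And>h. h > 0 \<Longrightarrow> h < d' \<Longrightarrow> f' x < f' (x + h)"
      using DERIV_pos_inc_right[OF f'] by auto
    define h where "h = min d d' / 2"
    have h: "0 < h" "h < d" "h < d'" using d(1) d'(1) by (auto simp: h_def)
    have "\<exists>z>x. z < x + h \<and> f (x + h) - f x = ((x + h) - x) * f' z"
      using h d by (intro MVT2) (auto simp: dist_real_def)
    then obtain z where z: "x < z" "z < x + h" "f (x + h) - f x = h * f' z" by auto
    have "f' z > 0" using d'(2)[of "z - x"] z h 0 by simp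
    then have "f (x + h) > f x" using z h by (smt (verit) mult_pos_pos)
    then show False using d(2)[of "x + h"] h by (auto simp: dist_real_def)
  qed
qed

section \<open>Polynomial inequalities in the principal radii\<close>

lemma gradient_term_poly:
  fixes a c :: real
  assumes "a > 0" "c > 0"
  shows "- 216*a^9*c - 144*a^8*c^2 - 480*a^6*c^4 - 560*a^5*c^5 + 96*a^4*c^6 - 576*a^3*c^7 - 96*a^2*c^8
    + 72*a*c^9 - 144*c^10 \<le> 0"
proof -
  \<comment> \<open>Only the coefficients of \<open>a^4*c^6\<close> and \<open>a*c^9\<close> have
    the wrong sign; neighbouring terms complete them to multiples of \<open>(a-c)^2\<close>.\<close>
  have "- 216*a^9*c - 144*a^8*c^2 - 480*a^6*c^4 - 560*a^5*c^5 + 96*a^4*c^6 - 576*a^3*c^7 - 96*a^2*c^8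
    + 72*a*c^9 - 144*c^10 = - (216*a^9*c + 144*a^8*c^2 + 480*a^6*c^4 + 512*a^5*c^5 + 528*a^3*c^7 + 60*a^2*c^8
    + 108*c^10 + 48*a^3*c^5*(a-c)^2 + 36*c^8*(a-c)^2)"
    by (simp add: power2_eq_square algebra_simps eval_nat_numeral)
  also have "\<dots> \<le> 0"
    using assms by (simp only: neg_le_0_iff_le) (intro add_nonneg_nonneg mult_nonneg_nonneg; simp)
  finally show ?thesis .
qed

text \<open>The critical point equation \<open>g\<close> says \<open>A p = C q\<close>, after division by \<open>a - c\<close>.\<close>
lemma gradient_term_nonpos:
  fixes a c p q :: real
  assumes pos: "a > 0" "c > 0" and ne: "a \<noteq> c"
    and T: "T = a + c" and S: "S = a * c"
    and PT: "T * PT = 3*T^4 - 6*S*T^2 - 8*S^2" and PS: "PS = 16*S - 6*T^2"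
    and g: "PT * (p + q) + PS * (c*p + a*q) = 0"
  shows "PT * (2*p*q - 2*q^2) - c * ((12*T^2 - 12*S)*(p+q)^2 - 24*T*(p+q)*(c*p+a*q) + 16*(c*p+a*q)^2) \<le> 0"
    (is "?R \<le> 0")
proof -
  \<comment> \<open>\<open>PT + c*PS\<close> and \<open>PT + a*PS\<close> are the derivatives of
    \<open>phiQ\<close> in the radii \<open>a\<close> and \<open>c\<close>. Both vanish for
    \<open>a = c\<close>; after multiplication by \<open>T\<close> the cofactors of
    \<open>a - c\<close> and \<open>c - a\<close> are \<open>A\<close> and \<open>C\<close>.\<close>
  define A where "A = 3*a^3 + 3*a^2*c - a*c^2 + 3*c^3"
  define C where "C = 3*a^3 - a^2*c + 3*a*c^2 + 3*c^3"
  have Tpos: "T > 0" using pos T by simp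
  \<comment> \<open>The one negative term of \<open>A\<close> is absorbed into a square.\<close>
  have "2 * A = 6*a^3 + 5*a^2*c + 5*c^3 + c*(a-c)^2"
    by (simp add: A_def power2_eq_square algebra_simps eval_nat_numeral)
  also have "\<dots> > 0"
    using pos by (intro add_pos_nonneg add_pos_pos mult_pos_pos mult_nonneg_nonneg) auto
  finally have Apos: "A > 0" by simp
  have h1: "T * (PT + c*PS) = (a - c) * A"
    unfolding ring_distribs(1) PT unfolding PS T S A_def by (simp add: power2_eq_square algebra_simps eval_nat_numeral)
  have h2: "T * (PT + a*PS) = (c - a) * C"
    unfolding ring_distribs(1) PT unfolding PS T S C_def by (simp add: power2_eq_square algebra_simps eval_nat_numeral)
  have "(a - c) * A * p + (c - a) * C * q = T * (PT * (p + q) + PS * (c*p + a*q))"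
    unfolding h1[symmetric] h2[symmetric] by (simp add: algebra_simps)
  also have "\<dots> = 0"
    unfolding g by simp
  finally have "(a - c) * (A * p - C * q) = 0"
    by (simp add: algebra_simps)
  then have "A * p = C * q" using ne by simp
  then have p: "p = C * (q / A)" and q: "q = A * (q / A)" using Apos by (simp_all add: field_simps)
  \<comment> \<open>The solutions of the linear relation form the line spanned by
    \<open>(C, A)\<close>; the expression is quadratic in \<open>(p, q)\<close>, so
    \<open>m^2\<close> factors out.\<close>
  define m where "m = q / A"
  have pm: "p = C * m" and qm: "q = A * m" using p q by (simp_all only: m_def)
  have "T * ?R = (T*PT) * (2*p*q - 2*q^2) - c * T * ((12*T^2 - 12*S)*(p+q)^2 - 24*T*(p+q)*(c*p+a*q) + 16*(c*p+a*q)^2)"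
    by (simp add: algebra_simps)
  also have "\<dots> = m^2 * ((T*PT) * (2*C*A - 2*A^2) - c * T * ((12*T^2 - 12*S)*(C+A)^2 - 24*T*(C+A)*(c*C+a*A) + 16*(c*C+a*A)^2))"
    unfolding pm qm by (simp add: power2_eq_square algebra_simps)
  also have "\<dots> = m^2 * (- 216*a^9*c - 144*a^8*c^2 - 480*a^6*c^4 - 560*a^5*c^5 + 96*a^4*c^6 - 576*a^3*c^7 - 96*a^2*c^8
    + 72*a*c^9 - 144*c^10)"
    unfolding PT unfolding T S A_def C_def by algebra
  also have "\<dots> \<le> 0"
    by (intro mult_nonneg_nonpos gradient_term_poly pos) auto
  finally show ?thesis using Tpos by (simp add: mult_le_0_iff)
qed

text \<open>Here \<open>a\<close> and \<open>c\<close> are the principal radii, \<open>p\<close>, \<open>r\<close>, \<open>q\<close>, \<open>u\<close> the third and \<open>a4\<close>, \<open>b4\<close>, \<open>c4\<close> the fourth derivatives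
  of the support function, \<open>PT\<close> and \<open>PS\<close> the partial derivatives of \<open>phiQ\<close> (below), \<open>hx\<close> and \<open>hy\<close> the second derivative
  conditions in the two principal directions, and \<open>ta\<close> and \<open>tc\<close> the time derivatives of \<open>a\<close> and \<open>c\<close>.\<close>
lemma reaction_nonpos:
  fixes a c :: real
  assumes pos: "a > 0" "c > 0"
    and T: "T = a + c" and S: "S = a * c" and Q0: "Q0 = (T^2 - 2*S) * (T^2 - 4*S) / (8*T)"
    and PT: "PT = 4*T^3 - 12*S*T - 8*Q0" and PS: "PS = 16*S - 6*T^2"
    and gx: "PT * (p + q) + PS * (c*p + a*q) = 0"
    and gy: "PT * (r + u) + PS * (c*r + a*u) = 0"
    and hx: "(12*T^2 - 12*S)*(p+q)^2 - 24*T*(p+q)*(c*p+a*q) + 16*(c*p+a*q)^2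
       + PT * (a4 + b4 + 3*a + c) + PS * (c*a4 + 2*p*q + a*b4 - 2*r^2 + 4*a*c) \<le> 0"
    and hy: "(12*T^2 - 12*S)*(r+u)^2 - 24*T*(r+u)*(c*r+a*u) + 16*(c*r+a*u)^2
       + PT * (b4 + c4 + a + 3*c) + PS * (c*b4 + 2*r*u + a*c4 - 2*q^2 + 4*a*c) \<le> 0"
    and ta: "ta = c*a4 + 2*p*q + a*b4 - 2*r^2 + 5*a*c"
    and tc: "tc = c*b4 + 2*r*u + a*c4 - 2*q^2 + 5*a*c"
  shows "PT * (ta + tc) + PS * (c*ta + a*tc) \<le> 0"
proof -
  have Tpos: "T > 0" using pos T by simp
  have TPT: "T * PT = 3*T^4 - 6*S*T^2 - 8*S^2"
    unfolding PT Q0 using Tpos by (simp add: field_simps power2_eq_square eval_nat_numeral)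
  show ?thesis
  proof (cases "a = c")
    \<comment> \<open>At an umbilic point both derivatives of \<open>phiQ\<close> in the radii
      vanish, so the expression is zero whatever \<open>ta\<close> and \<open>tc\<close>
      are.\<close>
    case True
    then have T2: "T = 2 * a" and S2: "S = a^2" using T S by (auto simp: power2_eq_square)
    have "T * (PT + a * PS) = 0"
      unfolding ring_distribs(1) TPT PS unfolding T2 S2 by (simp add: power2_eq_square algebra_simps eval_nat_numeral)
    then have "PT + a * PS = 0" using Tpos by simp
    moreover have "PT * (ta + tc) + PS * (c*ta + a*tc) = (PT + a * PS) * (ta + tc)"
      using True by (simp add: algebra_simps)
    ultimately show ?thesis by simp
  next
    case False
    let ?X = "(12*T^2 - 12*S)*(p+q)^2 - 24*T*(p+q)*(c*p+a*q) + 16*(c*p+a*q)^2"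
    let ?Y = "(12*T^2 - 12*S)*(r+u)^2 - 24*T*(r+u)*(c*r+a*u) + 16*(c*r+a*u)^2"
    \<comment> \<open>The zero-order remainder after subtracting \<open>c\<close> times
      \<open>hx\<close> and \<open>a\<close> times \<open>hy\<close>. These weights are the
      coefficients of the linearised flow in the two principal directions, so the fourth derivatives
      cancel.\<close>
    define R0 where "R0 = PT * (4*S - (T^2 - 2*S)) + PS * S * T"
    have X: "PT * (2*p*q - 2*q^2) - c * ?X \<le> 0"
      by (rule gradient_term_nonpos[OF pos False T S TPT PS gx])
    \<comment> \<open>The principal directions are exchanged: \<open>a\<close> with
      \<open>c\<close>, and \<open>(p, q)\<close> with \<open>(u, r)\<close>.\<close>
    have Y: "PT * (2*u*r - 2*r^2) - a * ?Y \<le> 0"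
    proof -
      have comm: "u + r = r + u" "a*u + c*r = c*r + a*u" by simp_all
      have T': "T = c + a" unfolding T by (rule add.commute)
      have S': "S = c * a" unfolding S by (rule mult.commute)
      have "PT * (u + r) + PS * (a*u + c*r) = 0" unfolding comm by (rule gy)
      from gradient_term_nonpos[OF pos(2) pos(1) False[symmetric] T' S' TPT PS this]
      show ?thesis unfolding comm .
    qed
    have R0: "R0 \<le> 0"
    proof -
      have "T * R0 = (T^2 - 4*S) * (- 3*(T^2)^2 + 6*S*T^2 + 12*S^2)"
      proof -
        have "T * R0 = (T * PT) * (4*S - (T^2 - 2*S)) + PS * S * T^2"
          by (simp add: R0_def power2_eq_square algebra_simps)
        then show ?thesis unfolding TPT PS by (simp add: power2_eq_square algebra_simps eval_nat_numeral)
      qed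
      also have "\<dots> \<le> 0"
      proof (rule mult_nonneg_nonpos)
        have "T^2 - 4*S = (a-c)^2" unfolding T S by (simp add: power2_eq_square algebra_simps)
        then show *: "0 \<le> T^2 - 4*S" by simp
        have "S > 0" using pos S by simp
        \<comment> \<open>In terms of \<open>S\<close> and of \<open>x\<close>, the square of
          \<open>a - c\<close>, all coefficients have the same sign.\<close>
        define x where "x = T^2 - 4*S"
        have "T^2 = x + 4*S" by (simp add: x_def)
        then have "- 3*(T^2)^2 + 6*S*T^2 + 12*S^2 = - (3*x^2 + 18*(x*S) + 12*S^2)"
          by (simp add: power2_eq_square algebra_simps)
        moreover have "0 \<le> x * S" using * \<open>S > 0\<close> by (simp add: x_def)
        ultimately show "- 3*(T^2)^2 + 6*S*T^2 + 12*S^2 \<le> 0"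
        proof -
          assume eq: "- 3*(T^2)^2 + 6*S*T^2 + 12*S^2 = - (3*x^2 + 18*(x*S) + 12*S^2)" and "0 \<le> x * S"
          then have "0 \<le> 3*x^2 + 18*(x*S) + 12*S^2" by simp
          then show ?thesis unfolding eq by simp
        qed
      qed
      finally show ?thesis using Tpos by (simp add: mult_le_0_iff)
    qed
    have "PT * (ta + tc) + PS * (c*ta + a*tc)
      = c * (?X + PT * (a4 + b4 + 3*a + c) + PS * (c*a4 + 2*p*q + a*b4 - 2*r^2 + 4*a*c))
      + a * (?Y + PT * (b4 + c4 + a + 3*c) + PS * (c*b4 + 2*r*u + a*c4 - 2*q^2 + 4*a*c))
      + R0 + (PT * (2*p*q - 2*q^2) - c * ?X) + (PT * (2*u*r - 2*r^2) - a * ?Y)"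
    proof -
      \<comment> \<open>The two quadratic forms cancel in this identity; as free variables they are
        not expanded.\<close>
      have gen: "PT * (ta + tc) + PS * (c*ta + a*tc)
      = c * (X + PT * (a4 + b4 + 3*a + c) + PS * (c*a4 + 2*p*q + a*b4 - 2*r^2 + 4*a*c))
      + a * (Y + PT * (b4 + c4 + a + 3*c) + PS * (c*b4 + 2*r*u + a*c4 - 2*q^2 + 4*a*c))
      + R0 + (PT * (2*p*q - 2*q^2) - c * X) + (PT * (2*u*r - 2*r^2) - a * Y)" for X Y
        unfolding R0_def T S ta tc by (simp add: power2_eq_square algebra_simps)
      show ?thesis by (rule gen)
    qed
    also have "\<dots> \<le> 0"
    proof -
      have "c * (?X + PT * (a4 + b4 + 3*a + c) + PS * (c*a4 + 2*p*q + a*b4 - 2*r^2 + 4*a*c)) \<le> 0"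
        using hx pos by (intro mult_nonneg_nonpos) auto
      moreover have "a * (?Y + PT * (b4 + c4 + a + 3*c) + PS * (c*b4 + 2*r*u + a*c4 - 2*q^2 + 4*a*c)) \<le> 0"
        using hy pos by (intro mult_nonneg_nonpos) auto
      ultimately show ?thesis using R0 X Y by linarith
    qed
    finally show ?thesis .
  qed
qed

section \<open>Derivatives along great circles\<close>

lemma second_derivative_unique:
  fixes f g :: "real \<Rightarrow> real"
  assumes eq: "eventually (\<lambda>s. f s = g s) (nhds x)"
    and f: "eventually (\<lambda>s. (f has_real_derivative f' s) (at s)) (nhds x)"
    and g: "eventually (\<lambda>s. (g has_real_derivative g' s) (at s)) (nhds x)"
    and f': "(f' has_real_derivative f2) (at x)" and g': "(g' has_real_derivative g2) (at x)"
  shows "f2 = g2"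
proof -
  have "eventually (\<lambda>s. eventually (\<lambda>r. f r = g r) (nhds s)) (nhds x)"
    using eq by (simp add: eventually_eventually)
  then have "eventually (\<lambda>s. f' s = g' s) (nhds x)"
    using f g
  proof eventually_elim
    case (elim s)
    then have "(f has_real_derivative g' s) (at s)"
      using DERIV_cong_ev[OF refl, of f g s "g' s" "g' s"] by simp
    then show ?case using elim DERIV_unique by blast
  qed
  then have "(f' has_real_derivative g2) (at x)"
    using DERIV_cong_ev[OF refl, of f' g' x g2 g2] g' by simp
  then show ?thesis using f' DERIV_unique by blast
qed

lemma DERIV_sqrt_one_plus_square:
  "((\<lambda>s. sqrt (1 + s^2)) has_real_derivative s / sqrt (1 + s^2)) (at s)"
proof -
  have "1 + s^2 > 0" by (smt (verit) zero_le_power2)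
  then show ?thesis
    by (auto intro!: derivative_eq_intros simp: field_simps)
qed

lemma DERIV_div_sqrt_one_plus_square:
  "((\<lambda>s. s / sqrt (1 + s^2)) has_real_derivative 1) (at 0)"
  by (auto intro!: derivative_eq_intros DERIV_sqrt_one_plus_square)

text \<open>The weights belong to the point \<open>g + s e\<close> of norm
  \<open>sqrt (1 + s^2)\<close>. There homogeneity makes the trace of the Hessian
  \<open>(1 + s^2) * a + c\<close> and its second symmetric function
  \<open>(1 + s^2) * (a*c - b^2)\<close>, see \<open>axis_point\<close>; the remaining factors
  compensate for the degree -1 of the Hessian.\<close>

definition profT where
  "profT a c = (\<lambda>s::real. sqrt (1 + s^2) * ((1 + s^2) * a s + c s))"
definition profT' where
  "profT' a a' c c' = (\<lambda>s::real. s / sqrt (1 + s^2) * ((1 + s^2) * a s + c s)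
     + sqrt (1 + s^2) * (2 * s * a s + (1 + s^2) * a' s + c' s))"
definition profS where
  "profS a b c = (\<lambda>s::real. (1 + s^2)^2 * (a s * c s - b s ^ 2))"
definition profS' where
  "profS' a a' b b' c c' = (\<lambda>s::real. 4 * s * (1 + s^2) * (a s * c s - b s ^ 2)
     + (1 + s^2)^2 * (a' s * c s + a s * c' s - 2 * b s * b' s))"

lemma DERIV_profT:
  assumes "(a has_real_derivative a' s) (at s)" "(c has_real_derivative c' s) (at s)"
  shows "(profT a c has_real_derivative profT' a a' c c' s) (at s)"
proof -
  have "((\<lambda>s. (1 + s^2) * a s + c s) has_real_derivative 2 * s * a s + (1 + s^2) * a' s + c' s) (at s)"
    by (auto intro!: derivative_eq_intros assms)
  from DERIV_mult[OF DERIV_sqrt_one_plus_square this] show ?thesis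
    unfolding profT_def profT'_def by (simp add: mult.commute)
qed

lemma DERIV_profT':
  assumes "(a has_real_derivative a' 0) (at 0)" "(c has_real_derivative c' 0) (at 0)"
    "(a' has_real_derivative a2) (at 0)" "(c' has_real_derivative c2) (at 0)"
  shows "(profT' a a' c c' has_real_derivative a2 + c2 + 3 * a 0 + c 0) (at 0)"
  unfolding profT'_def
  by (auto intro!: derivative_eq_intros DERIV_sqrt_one_plus_square DERIV_div_sqrt_one_plus_square assms)

lemma DERIV_profS:
  assumes "(a has_real_derivative a' s) (at s)" "(b has_real_derivative b' s) (at s)" "(c has_real_derivative c' s) (at s)"
  shows "(profS a b c has_real_derivative profS' a a' b b' c c' s) (at s)"
  unfolding profS_def profS'_def
  by (auto intro!: derivative_eq_intros assms simp: algebra_simps power2_eq_square)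

lemma DERIV_profS':
  assumes "(a has_real_derivative a' 0) (at 0)" "(b has_real_derivative b' 0) (at 0)" "(c has_real_derivative c' 0) (at 0)"
    "(a' has_real_derivative a2) (at 0)" "(b' has_real_derivative b2) (at 0)" "(c' has_real_derivative c2) (at 0)"
    and "b 0 = 0"
  shows "(profS' a a' b b' c c' has_real_derivative
     c 0 * a2 + 2 * a' 0 * c' 0 + a 0 * c2 - 2 * b' 0 ^ 2 + 4 * a 0 * c 0) (at 0)"
  unfolding profS'_def using assms(7)
  by (auto intro!: derivative_eq_intros assms simp: algebra_simps power2_eq_square)

text \<open>The excess of \<open>curvQ\<close> (below) over \<open>Q0\<close>, cleared of its denominator \<open>8 T\<close>.\<close>
definition phiQ :: "real \<Rightarrow> real \<Rightarrow> real \<Rightarrow> real" where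
  "phiQ Q0 T S = (T^2 - 2*S) * (T^2 - 4*S) - 8 * Q0 * T"

lemma DERIV_phiQ:
  assumes "(T has_real_derivative T' s) (at s)" "(S has_real_derivative S' s) (at s)"
  shows "((\<lambda>s. phiQ Q0 (T s) (S s)) has_real_derivative
     (4 * T s^3 - 12 * S s * T s - 8 * Q0) * T' s + (16 * S s - 6 * T s^2) * S' s) (at s)"
  unfolding phiQ_def
  by (auto intro!: derivative_eq_intros assms simp: algebra_simps power2_eq_square power3_eq_cube)

lemma DERIV_phiQ':
  assumes "(T has_real_derivative T' 0) (at 0)" "(S has_real_derivative S' 0) (at 0)"
    "(T' has_real_derivative T2) (at 0)" "(S' has_real_derivative Sd) (at 0)"
  shows "((\<lambda>s. (4 * T s^3 - 12 * S s * T s - 8 * Q0) * T' s + (16 * S s - 6 * T s^2) * S' s) has_real_derivative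
     (12 * T 0^2 - 12 * S 0) * T' 0^2 - 24 * T 0 * T' 0 * S' 0 + 16 * S' 0^2
      + (4 * T 0^3 - 12 * S 0 * T 0 - 8 * Q0) * T2 + (16 * S 0 - 6 * T 0^2) * Sd) (at 0)"
  by (auto intro!: derivative_eq_intros assms simp: algebra_simps power2_eq_square power3_eq_cube)

lemma phiQ_nonpos:
  assumes "T > 0" "(T^2 - 2*S) * (T^2 - 4*S) / (8*T) \<le> Q0"
  shows "phiQ Q0 T S \<le> 0"
  using assms by (simp add: phiQ_def divide_le_eq mult_ac)

lemma phiQ_zero:
  assumes "T > 0" "(T^2 - 2*S) * (T^2 - 4*S) / (8*T) = Q0"
  shows "phiQ Q0 T S = 0"
  using assms by (simp add: phiQ_def divide_eq_eq mult_ac)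

text \<open>The curves \<open>profT\<close> and \<open>profS\<close> are the trace and the determinant of the inverse Weingarten map along a
  great circle, written in the gnomonic chart. This is the one-dimensional maximum condition along that curve.\<close>
lemma profile_max_conditions:
  fixes a b c :: "real \<Rightarrow> real"
  assumes d: "eventually (\<lambda>s. (a has_real_derivative a' s) (at s) \<and> (b has_real_derivative b' s) (at s)
       \<and> (c has_real_derivative c' s) (at s)) (nhds 0)"
    and d2: "(a' has_real_derivative a2) (at 0)" "(b' has_real_derivative b2) (at 0)" "(c' has_real_derivative c2) (at 0)"
    and b0: "b 0 = 0"
    and T: "T = a 0 + c 0" and S: "S = a 0 * c 0"
    and PT: "PT = 4*T^3 - 12*S*T - 8*Q0" and PS: "PS = 16*S - 6*T^2"
    and max: "eventually (\<lambda>s. phiQ Q0 (profT a c s) (profS a b c s) \<le> phiQ Q0 (profT a c 0) (profS a b c 0)) (nhds 0)"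
  shows "PT * (a' 0 + c' 0) + PS * (c 0 * a' 0 + a 0 * c' 0) = 0"
    "(12*T^2 - 12*S)*(a' 0 + c' 0)^2 - 24*T*(a' 0 + c' 0)*(c 0 * a' 0 + a 0 * c' 0) + 16*(c 0 * a' 0 + a 0 * c' 0)^2
       + PT * (a2 + c2 + 3 * a 0 + c 0) + PS * (c 0 * a2 + 2 * a' 0 * c' 0 + a 0 * c2 - 2 * b' 0^2 + 4 * a 0 * c 0) \<le> 0"
proof -
  from d have d0: "(a has_real_derivative a' 0) (at 0)" "(b has_real_derivative b' 0) (at 0)" "(c has_real_derivative c' 0) (at 0)"
    using eventually_nhds_x_imp_x by fastforce+
  let ?T = "profT a c" and ?S = "profS a b c" and ?T' = "profT' a a' c c'" and ?S' = "profS' a a' b b' c c'"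
  have v: "?T 0 = T" "?S 0 = S" "?T' 0 = a' 0 + c' 0" "?S' 0 = c 0 * a' 0 + a 0 * c' 0"
    using b0 by (auto simp: profT_def profS_def profT'_def profS'_def T S)
  have 1: "eventually (\<lambda>s. ((\<lambda>s. phiQ Q0 (?T s) (?S s)) has_real_derivative
     (4 * ?T s^3 - 12 * ?S s * ?T s - 8 * Q0) * ?T' s + (16 * ?S s - 6 * ?T s^2) * ?S' s) (at s)) (nhds 0)"
    using d by eventually_elim (intro DERIV_phiQ DERIV_profT DERIV_profS; simp)
  note 2 = DERIV_phiQ'[OF DERIV_profT DERIV_profS DERIV_profT' DERIV_profS', OF d0(1,3) d0 d0(1,3) d2(1,3) d0 d2 b0, of Q0]
  from second_derivative_test[OF 1 2 max]
  show "PT * (a' 0 + c' 0) + PS * (c 0 * a' 0 + a 0 * c' 0) = 0"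
    "(12*T^2 - 12*S)*(a' 0 + c' 0)^2 - 24*T*(a' 0 + c' 0)*(c 0 * a' 0 + a 0 * c' 0) + 16*(c 0 * a' 0 + a 0 * c' 0)^2
       + PT * (a2 + c2 + 3 * a 0 + c 0) + PS * (c 0 * a2 + 2 * a' 0 * c' 0 + a 0 * c2 - 2 * b' 0^2 + 4 * a 0 * c 0) \<le> 0"
    unfolding v PT PS by auto
qed

text \<open>Yields the evolution of one Hessian entry when \<open>f\<close> is the time derivative
  of the support function. The factor \<open>sqrt (1 + s^2)\<close> has second derivative one at
  zero, which raises the \<open>4 * a 0 * c 0\<close> of \<open>DERIV_profS'\<close> to
  \<open>5 * a 0 * c 0\<close>.\<close>

lemma profile_flow_second_derivative:
  fixes a b c :: "real \<Rightarrow> real"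
  assumes d: "eventually (\<lambda>s. (a has_real_derivative a' s) (at s) \<and> (b has_real_derivative b' s) (at s)
       \<and> (c has_real_derivative c' s) (at s)) (nhds 0)"
    and d2: "(a' has_real_derivative a2) (at 0)" "(b' has_real_derivative b2) (at 0)" "(c' has_real_derivative c2) (at 0)"
    and b0: "b 0 = 0"
    and f: "eventually (\<lambda>s. f s = sqrt (1 + s^2) * profS a b c s) (nhds 0)"
    and f': "eventually (\<lambda>s. (f has_real_derivative f' s) (at s)) (nhds 0)"
    and f2: "(f' has_real_derivative f2) (at 0)"
  shows "f2 = c 0 * a2 + 2 * a' 0 * c' 0 + a 0 * c2 - 2 * b' 0^2 + 5 * a 0 * c 0"
proof (rule second_derivative_unique[OF f f' _ f2])
  from d have d0: "(a has_real_derivative a' 0) (at 0)" "(b has_real_derivative b' 0) (at 0)" "(c has_real_derivative c' 0) (at 0)"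
    using eventually_nhds_x_imp_x by fastforce+
  show "eventually (\<lambda>s. ((\<lambda>s. sqrt (1 + s^2) * profS a b c s) has_real_derivative
     s / sqrt (1 + s^2) * profS a b c s + profS' a a' b b' c c' s * sqrt (1 + s^2)) (at s)) (nhds 0)"
    using d by eventually_elim (intro DERIV_mult DERIV_sqrt_one_plus_square DERIV_profS; simp)
  show "((\<lambda>s. s / sqrt (1 + s^2) * profS a b c s + profS' a a' b b' c c' s * sqrt (1 + s^2)) has_real_derivative
    c 0 * a2 + 2 * a' 0 * c' 0 + a 0 * c2 - 2 * b' 0^2 + 5 * a 0 * c 0) (at 0)"
    by (rule DERIV_cong[OF DERIV_add[OF
          DERIV_mult[OF DERIV_div_sqrt_one_plus_square DERIV_profS[of a a' 0 b b' c c', OF d0]]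
          DERIV_mult[OF DERIV_profS'[of a a' b b' c c', OF d0 d2 b0] DERIV_sqrt_one_plus_square]]])
      (simp add: b0 profS_def profS'_def)
qed

lemma DERIV_transfer:
  assumes "(f has_real_derivative D) (at x)" "eventually (\<lambda>s. f s = g s) (nhds x)"
  shows "(g has_real_derivative D) (at x)"
  using DERIV_cong_ev[OF refl assms(2) refl] assms(1) by simp

section \<open>Second derivatives of the support function\<close>

abbreviation hs :: "((real^3) \<times> real \<Rightarrow> real) \<Rightarrow> real^3 \<Rightarrow> real^3 \<Rightarrow> (real^3) \<times> real \<Rightarrow> real" where
  "hs H v w \<equiv> pd (pd H (v, 0)) (w, 0)"

text \<open>The frame is an argument because it is adapted to the maximum point and then kept fixed
  nearby. The Hessian of a function homogeneous of degree one annihilates the position vector, so in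
  any orthonormal frame \<open>hess_e2\<close> is the product of the two tangential
  eigenvalues.\<close>

definition hess_tr where
  "hess_tr H f1 f2 f3 x = hs H f1 f1 x + hs H f2 f2 x + hs H f3 f3 x"
definition hess_e2 where
  "hess_e2 H f1 f2 f3 x = hs H f1 f1 x * hs H f2 f2 x - (hs H f1 f2 x)^2 + hs H f1 f1 x * hs H f3 f3 x - (hs H f1 f3 x)^2
     + hs H f2 f2 x * hs H f3 f3 x - (hs H f2 f3 x)^2"
text \<open>\<open>Qfun\<close> in terms of the sum \<open>T\<close> and the product \<open>S\<close> of the principal radii of curvature.\<close>
definition curvQ :: "real \<Rightarrow> real \<Rightarrow> real" where
  "curvQ T S = (T^2 - 2*S) * (T^2 - 4*S) / (8*T)"

text \<open>By homogeneity, the radial second derivatives at \<open>g + s e\<close> are determined by those in the directions \<open>e\<close> and \<open>e'\<close>.\<close>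
lemma axis_point:
  assumes "open V" "smooth_on V H" and V: "(g + s *\<^sub>R e, t) \<in> V"
    and hom: "\<And>x v. x \<in> V \<Longrightarrow> pd (pd H (v, 0)) (fst x, 0) x = 0"
  shows "hs H e g (g + s *\<^sub>R e, t) = - s * hs H e e (g + s *\<^sub>R e, t)"
    "hs H e' g (g + s *\<^sub>R e, t) = - s * hs H e e' (g + s *\<^sub>R e, t)"
    "hs H g g (g + s *\<^sub>R e, t) = s^2 * hs H e e (g + s *\<^sub>R e, t)"
proof -
  let ?x = "(g + s *\<^sub>R e, t)"
  have comm: "hs H v w ?x = hs H w v ?x" for v w
    by (rule pd_commute[OF assms(1,2) V])
  have *: "hs H v g ?x = - s * hs H v e ?x" for v
  proof -
    have lin: "linear (\<lambda>w. pd (pd H (v, 0)) w ?x)"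
      by (rule pd_linear[OF smooth_on_pd[OF assms(2)] V])
    have "0 = pd (pd H (v, 0)) ((g, 0) + s *\<^sub>R (e, 0)) ?x"
      using hom[OF V, of v] by simp
    also have "\<dots> = hs H v g ?x + s * hs H v e ?x"
      using linear_add[OF lin, of "(g, 0)" "s *\<^sub>R (e, 0)"] linear_scale[OF lin, of s "(e, 0)"] by simp
    finally show ?thesis by simp
  qed
  show "hs H e g ?x = - s * hs H e e ?x" by (rule *)
  show "hs H e' g ?x = - s * hs H e e' ?x" using * comm by metis
  show "hs H g g ?x = s^2 * hs H e e ?x"
    using *[of g] *[of e] comm[of g e] by (simp add: power2_eq_square)
qed

lemma norm_axis:
  fixes e g :: "'a::real_inner"
  assumes "norm e = 1" "norm g = 1" "e \<bullet> g = 0"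
  shows "norm (g + s *\<^sub>R e) = sqrt (1 + s^2)"
  using assms by (simp add: norm_eq_sqrt_inner inner_add_left inner_add_right inner_commute power2_eq_square)

lemma eventually_line_mem:
  fixes g e :: "'a::real_normed_vector" and t :: "'b::topological_space"
  assumes "open V" "(g, t) \<in> V"
  shows "eventually (\<lambda>s::real. (g + s *\<^sub>R e, t) \<in> V) (nhds 0)"
proof -
  have "open ((\<lambda>s::real. (g + s *\<^sub>R e, t)) -` V)"
    by (intro open_vimage assms continuous_intros)
  from eventually_nhds_in_open[OF this, of 0] show ?thesis
    using assms by simp
qed

lemma DERIV_line:
  assumes "smooth_on V F" "(g + s *\<^sub>R e, t) \<in> V"
  shows "((\<lambda>s. F (g + s *\<^sub>R e, t)) has_real_derivative pd F (e, 0) (g + s *\<^sub>R e, t)) (at s)"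
  using pd_DERIV_line[OF assms(1), of "(g, t)" s "(e, 0)"] assms(2) by simp

text \<open>With \<open>w\<close> the time direction, the time derivative of the Hessian becomes the
  Hessian of the time derivative, to which the flow equation applies.\<close>

lemma pd_swap:
  assumes "open V" "smooth_on V F" "x \<in> V"
  shows "pd (pd (pd F u) v) w x = pd (pd (pd F w) u) v x"
proof -
  have "pd (pd (pd F u) v) w x = pd (pd (pd F u) w) v x"
    by (rule pd_commute[OF assms(1) smooth_on_pd[OF assms(2)] assms(3)])
  also have "\<dots> = pd (pd (pd F w) u) v x"
    by (rule pd_cong[OF assms(1,3)]) (auto intro!: pd_commute assms smooth_on_pd)
  finally show ?thesis .
qed

text \<open>Supplies, for one principal direction, the gradient relation, the second derivative
  condition and the evolution equation that \<open>reaction_nonpos\<close> consumes. A second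
  application with \<open>e\<close> and \<open>e'\<close> exchanged covers the other
  direction.\<close>

lemma axis_conditions:
  assumes V: "open V" "smooth_on V H" "(g, t0) \<in> V"
    and on: "norm e = 1" "norm g = 1" "e \<bullet> g = 0"
    and hom: "\<And>x v. x \<in> V \<Longrightarrow> pd (pd H (v, 0)) (fst x, 0) x = 0"
    and flow: "\<And>x. x \<in> V \<Longrightarrow> pd H (0, 1) x = norm (fst x)^3 * hess_e2 H e e' g x"
    and x0: "x0 = (g, t0)"
    and diag: "hs H e e' x0 = 0"
    and pos: "hs H e e x0 > 0" "hs H e' e' x0 > 0"
    and T: "T = hs H e e x0 + hs H e' e' x0" and S: "S = hs H e e x0 * hs H e' e' x0"
    and Q0: "Q0 = curvQ T S"
    and PT: "PT = 4*T^3 - 12*S*T - 8*Q0" and PS: "PS = 16*S - 6*T^2"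
    and max: "eventually (\<lambda>z. curvQ (norm z * hess_tr H e e' g (z, t0)) (norm z^2 * hess_e2 H e e' g (z, t0)) \<le> Q0) (nhds g)"
    and a: "a = hs H e e x0" and c: "c = hs H e' e' x0"
    and p: "p = pd (hs H e e) (e, 0) x0" and q: "q = pd (hs H e' e') (e, 0) x0" and r: "r = pd (hs H e e') (e, 0) x0"
    and a4: "a4 = pd (pd (hs H e e) (e, 0)) (e, 0) x0" and b4: "b4 = pd (pd (hs H e' e') (e, 0)) (e, 0) x0"
  shows "PT * (p + q) + PS * (c * p + a * q) = 0"
    "(12*T^2 - 12*S)*(p + q)^2 - 24*T*(p + q)*(c*p + a*q) + 16*(c*p + a*q)^2
       + PT * (a4 + b4 + 3*a + c) + PS * (c*a4 + 2*p*q + a*b4 - 2*r^2 + 4*a*c) \<le> 0"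
    "pd (hs H e e) (0, 1) x0 = c*a4 + 2*p*q + a*b4 - 2*r^2 + 5*a*c"
proof -
  define A where "A s = hs H e e (g + s *\<^sub>R e, t0)" for s
  define B where "B s = hs H e e' (g + s *\<^sub>R e, t0)" for s
  define C where "C s = hs H e' e' (g + s *\<^sub>R e, t0)" for s
  define A' where "A' s = pd (hs H e e) (e, 0) (g + s *\<^sub>R e, t0)" for s
  define B' where "B' s = pd (hs H e e') (e, 0) (g + s *\<^sub>R e, t0)" for s
  define C' where "C' s = pd (hs H e' e') (e, 0) (g + s *\<^sub>R e, t0)" for s
  note sm = V(2) smooth_on_pd
  have ev: "eventually (\<lambda>s. (g + s *\<^sub>R e, t0) \<in> V) (nhds 0)"
    by (rule eventually_line_mem[OF V(1,3)])
  have d: "eventually (\<lambda>s. (A has_real_derivative A' s) (at s) \<and> (B has_real_derivative B' s) (at s)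
       \<and> (C has_real_derivative C' s) (at s)) (nhds 0)"
    using ev unfolding A_def[abs_def] B_def[abs_def] C_def[abs_def] A'_def B'_def C'_def
    by eventually_elim (intro conjI DERIV_line[of V] sm)
  have x0': "(g + 0 *\<^sub>R e, t0) \<in> V" using V by simp
  have d2: "(A' has_real_derivative a4) (at 0)" "(C' has_real_derivative b4) (at 0)"
    "(B' has_real_derivative pd (pd (hs H e e') (e, 0)) (e, 0) (g, t0)) (at 0)"
    using DERIV_line[OF smooth_on_pd[OF smooth_on_pd[OF smooth_on_pd[OF V(2)]]] x0']
    unfolding A'_def[abs_def] B'_def[abs_def] C'_def[abs_def] a4 b4 x0 by simp_all
  have v: "A 0 = a" "B 0 = 0" "C 0 = c" "A' 0 = p" "B' 0 = r" "C' 0 = q"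
    using diag by (simp_all add: A_def B_def C_def A'_def B'_def C'_def x0 a c p q r)
  have prof: "sqrt (1 + s^2) * hess_tr H e e' g (g + s *\<^sub>R e, t0) = profT A C s"
    "(1 + s^2) * hess_e2 H e e' g (g + s *\<^sub>R e, t0) = profS A B C s"
    if "(g + s *\<^sub>R e, t0) \<in> V" for s
    using axis_point(1,3)[OF V(1,2) that hom] axis_point(2)[OF V(1,2) that hom, where e' = e']
    by (simp_all add: hess_tr_def hess_e2_def profT_def profS_def A_def B_def C_def algebra_simps power2_eq_square)
  have nrm: "norm (g + s *\<^sub>R e) = sqrt (1 + s^2)" "norm (g + s *\<^sub>R e)^2 = 1 + s^2" for s
    using norm_axis[OF on] by (simp_all add: add_nonneg_nonneg)
  have T0: "profT A C 0 = T" "profS A B C 0 = S"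
    using v by (simp_all add: profT_def profS_def T S a c)
  have Tpos: "T > 0" using pos T by simp
  have contT: "isCont (profT A C) 0"
    using DERIV_isCont[OF DERIV_profT] eventually_nhds_x_imp_x[OF d] by blast
  have evT: "eventually (\<lambda>s. profT A C s > 0) (nhds 0)"
    using order_tendstoD(1)[OF contT[unfolded isCont_def]] Tpos T0 
    by (simp add: eventually_at_filter eventually_nhds_metric) (metis T0(1) Tpos)
  have "isCont (\<lambda>s. g + s *\<^sub>R e) 0"
    by (intro continuous_intros)
  then have "((\<lambda>s. g + s *\<^sub>R e) \<longlongrightarrow> g + 0 *\<^sub>R e) (nhds 0)"
    unfolding isCont_def by (subst (asm) tendsto_at_iff_tendsto_nhds)
  then have lim: "filterlim (\<lambda>s. g + s *\<^sub>R e) (nhds g) (nhds 0)" by simp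
  \<comment> \<open>Clearing the denominator requires a positive trace, which \<open>evT\<close>
    provides near zero.\<close>
  have "eventually (\<lambda>s. phiQ Q0 (profT A C s) (profS A B C s) \<le> 0) (nhds 0)"
    using filterlim_iff[THEN iffD1, OF lim, rule_format, OF max] ev evT
  proof eventually_elim
    case (elim s)
    then show ?case
      using prof[OF elim(2)] by (intro phiQ_nonpos) (simp_all add: nrm curvQ_def)
  qed
  moreover have "phiQ Q0 (profT A C 0) (profS A B C 0) = 0"
    unfolding T0 using Q0 Tpos by (intro phiQ_zero) (simp_all add: curvQ_def)
  ultimately have max': "eventually (\<lambda>s. phiQ Q0 (profT A C s) (profS A B C s) \<le> phiQ Q0 (profT A C 0) (profS A B C 0)) (nhds 0)"
    by simp
  have TS: "T = A 0 + C 0" "S = A 0 * C 0" by (simp_all add: v T S a c)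
  from profile_max_conditions[OF d d2(1,3,2) v(2) TS PT PS max', unfolded v]
  show "PT * (p + q) + PS * (c * p + a * q) = 0"
    "(12*T^2 - 12*S)*(p + q)^2 - 24*T*(p + q)*(c*p + a*q) + 16*(c*p + a*q)^2
       + PT * (a4 + b4 + 3*a + c) + PS * (c*a4 + 2*p*q + a*b4 - 2*r^2 + 4*a*c) \<le> 0"
    by auto
  define f where "f s = pd H (0, 1) (g + s *\<^sub>R e, t0)" for s
  define f' where "f' s = pd (pd H (0, 1)) (e, 0) (g + s *\<^sub>R e, t0)" for s
  have f: "eventually (\<lambda>s. f s = sqrt (1 + s^2) * profS A B C s) (nhds 0)"
    using ev
  proof eventually_elim
    case (elim s)
    \<comment> \<open>One of the three factors stays as a square root; the other two make up the
      weight in \<open>profS\<close>.\<close>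
    have "norm (g + s *\<^sub>R e)^3 = sqrt (1 + s^2) * (1 + s^2)"
      using nrm[of s] by (simp add: power3_eq_cube power2_eq_square)
    then show ?case
      unfolding f_def using flow[OF elim] prof(2)[OF elim, symmetric] by simp
  qed
  have f': "eventually (\<lambda>s. (f has_real_derivative f' s) (at s)) (nhds 0)"
    using ev unfolding f_def[abs_def] f'_def by eventually_elim (intro DERIV_line[of V] sm)
  have f2: "(f' has_real_derivative pd (pd (pd H (0, 1)) (e, 0)) (e, 0) (g, t0)) (at 0)"
    using DERIV_line[OF smooth_on_pd[OF smooth_on_pd[OF V(2)]] x0'] unfolding f'_def[abs_def] by simp
  have "pd (hs H e e) (0, 1) x0 = pd (pd (pd H (0, 1)) (e, 0)) (e, 0) (g, t0)"
    unfolding x0 by (rule pd_swap[OF V])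
  then show "pd (hs H e e) (0, 1) x0 = c*a4 + 2*p*q + a*b4 - 2*r^2 + 5*a*c"
    using profile_flow_second_derivative[OF d d2(1,3,2) v(2) f f' f2] unfolding v by simp
qed

lemma hess_swap:
  assumes "open V" "smooth_on V H" "x \<in> V"
  shows "hess_tr H e' e g x = hess_tr H e e' g x" "hess_e2 H e' e g x = hess_e2 H e e' g x"
  using pd_commute[OF assms, of "(e,0)" "(e',0)"] by (simp_all add: hess_tr_def hess_e2_def algebra_simps)

text \<open>The two applications of \<open>axis_conditions\<close> share the mixed derivatives
  \<open>r\<close>, \<open>q\<close> and \<open>b4\<close>, identified by commuting derivatives. The
  sign is obtained for the derivative of \<open>phiQ\<close>; since \<open>phiQ\<close> vanishes at
  the maximum, division by the varying \<open>8 T\<close> contributes no further term.\<close>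

lemma max_speed_nonpos:
  assumes V: "open V" "smooth_on V H" "(g, t0) \<in> V"
    and on: "norm e = 1" "norm e' = 1" "norm g = 1" "e \<bullet> g = 0" "e' \<bullet> g = 0"
    and hom: "\<And>x v. x \<in> V \<Longrightarrow> pd (pd H (v, 0)) (fst x, 0) x = 0"
    and flow: "\<And>x. x \<in> V \<Longrightarrow> pd H (0, 1) x = norm (fst x)^3 * hess_e2 H e e' g x"
    and diag: "hs H e e' (g, t0) = 0"
    and pos: "hs H e e (g, t0) > 0" "hs H e' e' (g, t0) > 0"
    and max: "eventually (\<lambda>z. curvQ (norm z * hess_tr H e e' g (z, t0)) (norm z^2 * hess_e2 H e e' g (z, t0))
        \<le> curvQ (hess_tr H e e' g (g, t0)) (hess_e2 H e e' g (g, t0))) (nhds g)"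
  obtains D where "D \<le> 0"
    "((\<lambda>t. curvQ (hess_tr H e e' g (g, t)) (hess_e2 H e e' g (g, t))) has_real_derivative D) (at t0)"
proof -
  let ?x = "(g, t0)"
  define a where "a = hs H e e ?x"
  define c where "c = hs H e' e' ?x"
  define T where "T = a + c"
  define S where "S = a * c"
  define Q0 where "Q0 = curvQ T S"
  define PT where "PT = 4*T^3 - 12*S*T - 8*Q0"
  define PS where "PS = 16*S - 6*T^2"
  note sm = V(2) smooth_on_pd
  have point: "hess_tr H e e' g (g, t) = hs H e e (g, t) + hs H e' e' (g, t)"
    "hess_e2 H e e' g (g, t) = hs H e e (g, t) * hs H e' e' (g, t) - hs H e e' (g, t)^2" if "(g, t) \<in> V" for t
    using axis_point(1,3)[OF V(1,2) _ hom, where g = g and s = 0 and e = e and t = t]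
      axis_point(2)[OF V(1,2) _ hom, where g = g and s = 0 and e = e and t = t and e' = e']
      axis_point(2)[OF V(1,2) _ hom, where g = g and s = 0 and e = e' and t = t and e' = e'] that by (simp_all add: hess_tr_def hess_e2_def)
  have TS0: "hess_tr H e e' g ?x = T" "hess_e2 H e e' g ?x = S"
    using point[OF V(3)] diag by (simp_all add: T_def S_def a_def c_def)
  have apos: "a > 0" "c > 0" using pos by (simp_all add: a_def c_def)
  have Tpos: "T > 0" using apos by (simp add: T_def)
  have diag': "hs H e' e ?x = 0" using diag pd_commute[OF V(1,2,3)] by metis
  have flow': "pd H (0, 1) x = norm (fst x)^3 * hess_e2 H e' e g x" if "x \<in> V" for x
    using flow[OF that] hess_swap[OF V(1,2) that] by simp
  define r where "r = pd (hs H e e) (e', 0) ?x"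
  define q where "q = pd (hs H e' e') (e, 0) ?x"
  define b4 where "b4 = pd (pd (hs H e' e') (e, 0)) (e, 0) ?x"
  have r': "pd (hs H e e') (e, 0) ?x = r"
    unfolding r_def by (rule pd_commute[OF V(1) smooth_on_pd[OF V(2)] V(3)])
  have q': "pd (hs H e' e) (e', 0) ?x = q"
    unfolding q_def by (rule pd_commute[OF V(1) smooth_on_pd[OF V(2)] V(3)])
  have b4': "pd (pd (hs H e e) (e', 0)) (e', 0) ?x = b4"
  proof -
    have "pd (pd (hs H e e) (e', 0)) (e', 0) ?x = pd (pd (pd (pd H (e', 0)) (e, 0)) (e, 0)) (e', 0) ?x"
      by (rule pd_cong[OF V(1,3)]) (auto intro!: pd_swap V sm)
    also have "\<dots> = pd (pd (pd (pd H (e', 0)) (e', 0)) (e, 0)) (e, 0) ?x"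
      by (rule pd_swap[OF V(1) smooth_on_pd[OF V(2)] V(3)])
    finally show ?thesis by (simp add: b4_def)
  qed
  have Vev: "eventually (\<lambda>z. (z, t0) \<in> V) (nhds g)"
  proof -
    have "open ((\<lambda>z. (z, t0)) -` V)"
      by (intro open_vimage V continuous_intros)
    from eventually_nhds_in_open[OF this, of g] show ?thesis using V by simp
  qed
  have max1: "eventually (\<lambda>z. curvQ (norm z * hess_tr H e e' g (z, t0)) (norm z^2 * hess_e2 H e e' g (z, t0)) \<le> Q0) (nhds g)"
    using max unfolding TS0 Q0_def .
  have max2: "eventually (\<lambda>z. curvQ (norm z * hess_tr H e' e g (z, t0)) (norm z^2 * hess_e2 H e' e g (z, t0)) \<le> Q0) (nhds g)"
    using max1 Vev by eventually_elim (simp add: hess_swap[OF V(1,2)])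
  note 1 = axis_conditions[OF V on(1,3,4) hom flow refl diag pos T_def[unfolded a_def c_def] S_def[unfolded a_def c_def]
      Q0_def PT_def PS_def max1 a_def c_def refl q_def r'[symmetric] refl b4_def]
  have T': "T = hs H e' e' ?x + hs H e e ?x" "S = hs H e' e' ?x * hs H e e ?x"
    by (simp_all add: T_def S_def a_def c_def)
  note 2 = axis_conditions[OF V on(2,3,5) hom flow' refl diag' pos(2,1) T'
      Q0_def PT_def PS_def max2 c_def a_def refl r_def q'[symmetric] refl b4'[symmetric]]
  define ta where "ta = pd (hs H e e) (0, 1) ?x"
  define tc where "tc = pd (hs H e' e') (0, 1) ?x"
  define p where "p = pd (hs H e e) (e, 0) ?x"
  define u where "u = pd (hs H e' e') (e', 0) ?x"
  define a4 where "a4 = pd (pd (hs H e e) (e, 0)) (e, 0) ?x"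
  define c4 where "c4 = pd (pd (hs H e' e') (e', 0)) (e', 0) ?x"
  have R: "PT * (ta + tc) + PS * (c*ta + a*tc) \<le> 0"
  proof (rule reaction_nonpos[OF apos T_def S_def Q0_def[unfolded curvQ_def] PT_def PS_def])
    show "PT * (p + q) + PS * (c*p + a*q) = 0" using 1(1) by (simp add: p_def)
    show "PT * (r + u) + PS * (c*r + a*u) = 0" using 2(1) by (simp add: u_def algebra_simps)
    show "(12*T^2 - 12*S)*(p+q)^2 - 24*T*(p+q)*(c*p+a*q) + 16*(c*p+a*q)^2
       + PT * (a4 + b4 + 3*a + c) + PS * (c*a4 + 2*p*q + a*b4 - 2*r^2 + 4*a*c) \<le> 0"
      using 1(2) by (simp add: p_def a4_def)
    have comm: "r + u = u + r" "c*r + a*u = a*u + c*r" by simp_all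
    show "(12*T^2 - 12*S)*(r+u)^2 - 24*T*(r+u)*(c*r+a*u) + 16*(c*r+a*u)^2
       + PT * (b4 + c4 + a + 3*c) + PS * (c*b4 + 2*r*u + a*c4 - 2*q^2 + 4*a*c) \<le> 0"
      using 2(2)[folded u_def c4_def] unfolding comm by (simp add: ac_simps)
    show "ta = c*a4 + 2*p*q + a*b4 - 2*r^2 + 5*a*c" using 1(3) by (simp add: ta_def p_def a4_def)
    show "tc = c*b4 + 2*r*u + a*c4 - 2*q^2 + 5*a*c" using 2(3) by (simp add: tc_def u_def c4_def ac_simps)
  qed
  have dt: "((\<lambda>t. F (g, t)) has_real_derivative pd F (0, 1) ?x) (at t0)" if "smooth_on V F" for F :: "(real^3) \<times> real \<Rightarrow> real"
    using pd_DERIV_line[OF that, of "(g, 0)" t0 "(0, 1)"] V by simp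
  let ?D = "((PT * (ta + tc) + PS * (c*ta + a*tc)) / (8 * T))"
  have "((\<lambda>t. curvQ (hs H e e (g, t) + hs H e' e' (g, t)) (hs H e e (g, t) * hs H e' e' (g, t) - hs H e e' (g, t)^2))
      has_real_derivative ?D) (at t0)"
  proof -
    define Tt where "Tt t = hs H e e (g, t) + hs H e' e' (g, t)" for t
    define St where "St t = hs H e e (g, t) * hs H e' e' (g, t) - hs H e e' (g, t)^2" for t
    have Tt: "(Tt has_real_derivative ta + tc) (at t0)"
      unfolding Tt_def[abs_def] ta_def tc_def by (intro DERIV_add dt sm)
    have St: "(St has_real_derivative c*ta + a*tc) (at t0)"
      unfolding St_def[abs_def] ta_def tc_def
      by (auto intro!: derivative_eq_intros dt sm simp: diag a_def c_def)
    have v: "Tt t0 = T" "St t0 = S" using diag by (simp_all add: Tt_def St_def T_def S_def a_def c_def)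
    have "((\<lambda>t. phiQ Q0 (Tt t) (St t)) has_real_derivative PT * (ta + tc) + PS * (c*ta + a*tc)) (at t0)"
      using DERIV_phiQ[OF Tt St, of Q0] unfolding v PT_def PS_def .
    then have "((\<lambda>t. phiQ Q0 (Tt t) (St t) / (8 * Tt t)) has_real_derivative
        ((PT * (ta + tc) + PS * (c*ta + a*tc)) * (8 * Tt t0) - phiQ Q0 (Tt t0) (St t0) * (8 * (ta + tc)))
          / (8 * Tt t0 * (8 * Tt t0))) (at t0)"
      using Tpos v by (intro DERIV_divide DERIV_cmult Tt) auto
    moreover have "((PT * (ta + tc) + PS * (c*ta + a*tc)) * (8 * Tt t0) - phiQ Q0 (Tt t0) (St t0) * (8 * (ta + tc)))
          / (8 * Tt t0 * (8 * Tt t0)) = ?D"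
    proof -
      have "phiQ Q0 T S = 0" using phiQ_zero[OF Tpos, of S Q0] by (simp add: Q0_def curvQ_def)
      then show ?thesis unfolding v using Tpos by (simp add: divide_simps)
    qed
    ultimately have "((\<lambda>t. phiQ Q0 (Tt t) (St t) / (8 * Tt t)) has_real_derivative ?D) (at t0)"
      by metis
    from DERIV_add[OF DERIV_const this]
    have "((\<lambda>t. Q0 + phiQ Q0 (Tt t) (St t) / (8 * Tt t)) has_real_derivative ?D) (at t0)"
      by simp
    moreover have "eventually (\<lambda>t. Q0 + phiQ Q0 (Tt t) (St t) / (8 * Tt t) = curvQ (Tt t) (St t)) (nhds t0)"
    proof -
      have "eventually (\<lambda>t. Tt t > 0) (at t0)"
        using order_tendstoD(1)[OF DERIV_isCont[OF Tt, unfolded isCont_def], of 0] Tpos v by simp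
      then have "eventually (\<lambda>t. Tt t > 0) (nhds t0)"
        using Tpos v by (auto simp: eventually_at_filter elim!: eventually_mono)
      then show ?thesis by eventually_elim (simp add: phiQ_def curvQ_def field_simps)
    qed
    ultimately show ?thesis
      unfolding Tt_def St_def by (rule DERIV_transfer)
  qed
  moreover
  have "eventually (\<lambda>t. (g, t) \<in> V) (nhds t0)"
  proof -
    have "open ((\<lambda>t. (g, t)) -` V)"
      by (intro open_vimage V continuous_intros)
    from eventually_nhds_in_open[OF this, of t0] show ?thesis using V by simp
  qed
  then have "eventually (\<lambda>t. curvQ (hs H e e (g, t) + hs H e' e' (g, t)) (hs H e e (g, t) * hs H e' e' (g, t) - hs H e e' (g, t)^2)
     = curvQ (hess_tr H e e' g (g, t)) (hess_e2 H e e' g (g, t))) (nhds t0)"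
    by eventually_elim (simp add: point)
  ultimately have "((\<lambda>t. curvQ (hess_tr H e e' g (g, t)) (hess_e2 H e e' g (g, t))) has_real_derivative ?D) (at t0)"
    by (rule DERIV_transfer)
  moreover have "?D \<le> 0" using R Tpos by (simp add: divide_nonpos_pos)
  ultimately show thesis using that by blast
qed

section \<open>Linear algebra of the Weingarten map\<close>

lemma normal_line:
  fixes A B n w :: "real^3"
  assumes "A \<times> B \<noteq> 0" "norm n = 1" "n \<bullet> A = 0" "n \<bullet> B = 0" "w \<bullet> A = 0" "w \<bullet> B = 0"
  shows "w = (w \<bullet> n) *\<^sub>R n"
proof -
  define d where "d = A \<times> B"
  define w' where "w' = w - (w \<bullet> n) *\<^sub>R n"
  have nn: "n \<bullet> n = 1" using assms(2) by (simp add: dot_square_norm)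
  have w': "w' \<bullet> A = 0" "w' \<bullet> B = 0" "w' \<bullet> n = 0"
    using assms nn by (simp_all add: w'_def inner_diff_left)
  have "n \<times> d = 0" "w' \<times> d = 0"
    using assms w' by (simp_all add: d_def Lagrange)
  have "d = (n \<bullet> d) *\<^sub>R n"
    using \<open>n \<times> d = 0\<close> Lagrange[of n n d] nn by simp
  then have "w' \<bullet> d = 0"
    using w'(3) by (metis inner_scaleR_right mult_zero_right)
  then have "w' = 0"
    using \<open>w' \<times> d = 0\<close> norm_and_cross_eq_0 assms(1) d_def by blast
  then show ?thesis by (simp add: w'_def)
qed

definition onf :: "real^3 \<Rightarrow> real^3 \<Rightarrow> real^3 \<Rightarrow> bool" where
  "onf f1 f2 f3 \<longleftrightarrow> norm f1 = 1 \<and> norm f2 = 1 \<and> norm f3 = 1 \<and> f1 \<bullet> f2 = 0 \<and> f1 \<bullet> f3 = 0 \<and> f2 \<bullet> f3 = 0"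

lemma onf_inner:
  assumes "onf f1 f2 f3"
  shows "f1 \<bullet> f1 = 1" "f2 \<bullet> f2 = 1" "f3 \<bullet> f3 = 1" "f1 \<bullet> f2 = 0" "f1 \<bullet> f3 = 0" "f2 \<bullet> f3 = 0"
    "f2 \<bullet> f1 = 0" "f3 \<bullet> f1 = 0" "f3 \<bullet> f2 = 0"
  using assms by (auto simp: onf_def dot_square_norm inner_commute)

lemma onf_expand:
  assumes "onf f1 f2 f3"
  shows "u = (u \<bullet> f1) *\<^sub>R f1 + (u \<bullet> f2) *\<^sub>R f2 + (u \<bullet> f3) *\<^sub>R f3"
proof -
  note o = onf_inner[OF assms]
  define w where "w = u - (u \<bullet> f1) *\<^sub>R f1 - (u \<bullet> f2) *\<^sub>R f2"
  have "(norm (f1 \<times> f2))^2 = 1"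
    using assms by (simp add: norm_cross onf_def)
  then have "f1 \<times> f2 \<noteq> 0" by auto
  then have "w = (w \<bullet> f3) *\<^sub>R f3"
    using assms o by (intro normal_line[of f1 f2]) (auto simp: w_def inner_diff_left onf_def)
  moreover have "w \<bullet> f3 = u \<bullet> f3" using o by (simp add: w_def inner_diff_left)
  ultimately have "w = (u \<bullet> f3) *\<^sub>R f3" by simp
  then show ?thesis unfolding w_def by (simp add: algebra_simps)
qed

lemma onf_parseval:
  assumes "onf f1 f2 f3"
  shows "u \<bullet> v = (u \<bullet> f1) * (v \<bullet> f1) + (u \<bullet> f2) * (v \<bullet> f2) + (u \<bullet> f3) * (v \<bullet> f3)"
  by (subst onf_expand[OF assms, of u]) (simp add: inner_add_left inner_commute[of v])

text \<open>Invariance under change of frame allows one fixed frame for a whole neighbourhood, while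
  at each point the values are read off in a frame of eigenvectors.\<close>

definition tr3 :: "(real^3 \<Rightarrow> real^3) \<Rightarrow> real^3 \<Rightarrow> real^3 \<Rightarrow> real^3 \<Rightarrow> real" where
  "tr3 M f1 f2 f3 = M f1 \<bullet> f1 + M f2 \<bullet> f2 + M f3 \<bullet> f3"
definition e23 :: "(real^3 \<Rightarrow> real^3) \<Rightarrow> real^3 \<Rightarrow> real^3 \<Rightarrow> real^3 \<Rightarrow> real" where
  "e23 M f1 f2 f3 = (M f1 \<bullet> f1) * (M f2 \<bullet> f2) - (M f1 \<bullet> f2)^2 + (M f1 \<bullet> f1) * (M f3 \<bullet> f3) - (M f1 \<bullet> f3)^2
     + (M f2 \<bullet> f2) * (M f3 \<bullet> f3) - (M f2 \<bullet> f3)^2"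

lemma tr3_invariant:
  assumes "onf f1 f2 f3" "onf g1 g2 g3" and sym: "\<And>u v. M u \<bullet> v = u \<bullet> M v"
  shows "tr3 M f1 f2 f3 = tr3 M g1 g2 g3"
proof -
  have "tr3 M f1 f2 f3 = (\<Sum>f\<leftarrow>[f1,f2,f3]. \<Sum>g\<leftarrow>[g1,g2,g3]. (M f \<bullet> g) * (f \<bullet> g))"
    using onf_parseval[OF assms(2), of "M f1" f1] onf_parseval[OF assms(2), of "M f2" f2]
      onf_parseval[OF assms(2), of "M f3" f3] by (simp add: tr3_def)
  moreover have "tr3 M g1 g2 g3 = (\<Sum>g\<leftarrow>[g1,g2,g3]. \<Sum>f\<leftarrow>[f1,f2,f3]. (M g \<bullet> f) * (g \<bullet> f))"
    using onf_parseval[OF assms(1), of "M g1" g1] onf_parseval[OF assms(1), of "M g2" g2]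
      onf_parseval[OF assms(1), of "M g3" g3] by (simp add: tr3_def)
  moreover have "(M g \<bullet> f) * (g \<bullet> f) = (M f \<bullet> g) * (f \<bullet> g)" for f g
    using sym[of f g] by (simp add: inner_commute)
  ultimately show ?thesis by simp
qed

text \<open>Newton's identity. It reduces the frame invariance of \<open>e23\<close> to that of the
  traces of \<open>M\<close> and of its square.\<close>

lemma e23_eq:
  assumes "onf f1 f2 f3" and sym: "\<And>u v. M u \<bullet> v = u \<bullet> M v"
  shows "2 * e23 M f1 f2 f3 = (tr3 M f1 f2 f3)^2 - tr3 (\<lambda>u. M (M u)) f1 f2 f3"
proof -
  have "M (M u) \<bullet> u = (M u \<bullet> f1)^2 + (M u \<bullet> f2)^2 + (M u \<bullet> f3)^2" for u
    using onf_parseval[OF assms(1), of "M u" "M u"] sym[of "M u" u] by (simp add: power2_eq_square)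
  moreover have "M f2 \<bullet> f1 = M f1 \<bullet> f2" "M f3 \<bullet> f1 = M f1 \<bullet> f3" "M f3 \<bullet> f2 = M f2 \<bullet> f3"
    using sym by (simp_all add: inner_commute)
  ultimately show ?thesis
    unfolding tr3_def e23_def by (simp add: power2_eq_square algebra_simps)
qed

lemma e23_invariant:
  assumes "onf f1 f2 f3" "onf g1 g2 g3" and sym: "\<And>u v. M u \<bullet> v = u \<bullet> M v"
  shows "e23 M f1 f2 f3 = e23 M g1 g2 g3"
proof -
  have "M (M u) \<bullet> v = u \<bullet> M (M v)" for u v using sym by simp
  then show ?thesis
    using e23_eq[OF assms(1) sym] e23_eq[OF assms(2) sym] tr3_invariant[OF assms(1,2), of M]
      tr3_invariant[OF assms(1,2), of "\<lambda>u. M (M u)"] sym by simp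
qed

lemma ex_unit_orthogonal:
  fixes z :: "real^3"
  obtains g where "norm g = 1" "g \<bullet> z = 0"
proof -
  have "2 \<le> DIM(real^3)" by simp
  then obtain x :: "real^3" where x: "x \<noteq> 0" "orthogonal z x"
    using orthogonal_to_vector_exists by blast
  show thesis
    using x by (intro that[of "x /\<^sub>R norm x"]) (auto simp: orthogonal_def inner_commute)
qed

lemma onf_cross:
  assumes "norm g = 1" "norm z = 1" "g \<bullet> z = 0"
  shows "onf g (z \<times> g) z"
proof -
  have "(norm (z \<times> g))^2 = 1" using assms by (simp add: norm_cross inner_commute)
  then have "norm (z \<times> g) = 1" using norm_ge_zero[of "z \<times> g"] by (simp add: power2_eq_1_iff)
  then show ?thesis using assms dot_cross_self by (auto simp: onf_def)
qed

text \<open>Being symmetric and zero on \<open>z\<close>, the map preserves the plane orthogonal to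
  \<open>z\<close>, so only a symmetric two by two matrix has to be diagonalised.\<close>

lemma eigenframe:
  assumes lin: "linear M" and sym: "\<And>u v. M u \<bullet> v = u \<bullet> M v" and z: "norm z = 1" "M z = 0"
  obtains e e' r1 r2 where "onf e e' z" "M e = r1 *\<^sub>R e" "M e' = r2 *\<^sub>R e'"
proof -
  obtain g1 where g1: "norm g1 = 1" "g1 \<bullet> z = 0" by (rule ex_unit_orthogonal)
  define g2 where "g2 = z \<times> g1"
  have on: "onf g1 g2 z" unfolding g2_def by (rule onf_cross[OF g1(1) z(1) g1(2)])
  note o = onf_inner[OF on]
  define a b c where "a = M g1 \<bullet> g1" and "b = M g1 \<bullet> g2" and "c = M g2 \<bullet> g2"
  have Mz: "M u \<bullet> z = 0" for u using sym[of u z] z by simp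
  have "M g2 \<bullet> g1 = b" using sym[of g2 g1] by (simp add: b_def inner_commute)
  then have M: "M g1 = a *\<^sub>R g1 + b *\<^sub>R g2" "M g2 = b *\<^sub>R g1 + c *\<^sub>R g2"
    using onf_expand[OF on, of "M g1"] onf_expand[OF on, of "M g2"] Mz by (simp_all add: a_def b_def c_def)
  have "\<exists>v r. v \<noteq> 0 \<and> v \<bullet> z = 0 \<and> M v = r *\<^sub>R v"
  proof (cases "b = 0")
    case True
    then show ?thesis using M o g1 by (intro exI[of _ g1] exI[of _ a]) auto
  next
    case False
    \<comment> \<open>\<open>r\<close> is the larger root of the characteristic polynomial of the
      matrix with rows \<open>(a, b)\<close> and \<open>(b, c)\<close>; the vector
      \<open>(b, r - a)\<close> solves the eigenvector equation and is nonzero because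
      \<open>b\<close> is.\<close>
    define s where "s = sqrt ((a - c)^2 + 4 * b^2)"
    define r where "r = (a + c + s) / 2"
    have "s^2 = (a - c)^2 + 4 * b^2" by (simp add: s_def)
    moreover have s: "s = 2 * r - a - c" by (simp add: r_def field_simps)
    ultimately have "(2 * r - a - c)^2 = (a - c)^2 + 4 * b^2" by simp
    then have root: "b * b + (r - a) * c = r * (r - a)"
      by (simp add: power2_eq_square algebra_simps)
    define v where "v = b *\<^sub>R g1 + (r - a) *\<^sub>R g2"
    have "M v = b *\<^sub>R (a *\<^sub>R g1 + b *\<^sub>R g2) + (r - a) *\<^sub>R (b *\<^sub>R g1 + c *\<^sub>R g2)"
      by (simp add: v_def linear_add[OF lin] linear_scale[OF lin] M)
    also have "\<dots> = (r * b) *\<^sub>R g1 + (b * b + (r - a) * c) *\<^sub>R g2"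
      by (simp add: algebra_simps)
    also have "\<dots> = r *\<^sub>R v"
      unfolding root by (simp add: v_def algebra_simps)
    finally have "M v = r *\<^sub>R v" .
    moreover have "v \<bullet> g1 = b" "v \<bullet> z = 0" using o by (simp_all add: v_def inner_add_left)
    ultimately show ?thesis using False by (intro exI[of _ v] exI[of _ r]) auto
  qed
  then obtain v r where v: "v \<noteq> 0" "v \<bullet> z = 0" "M v = r *\<^sub>R v" by blast
  define e where "e = v /\<^sub>R norm v"
  define e' where "e' = z \<times> e"
  have e: "norm e = 1" "e \<bullet> z = 0" using v by (simp_all add: e_def)
  have Me: "M e = r *\<^sub>R e" using v(3) by (simp add: e_def linear_scale[OF lin])
  have on': "onf e e' z" unfolding e'_def by (rule onf_cross[OF e(1) z(1) e(2)])
  have "M e' \<bullet> e = 0" using sym[of e' e] Me onf_inner[OF on'] by simp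
  then have "M e' = (M e' \<bullet> e') *\<^sub>R e'"
    using onf_expand[OF on', of "M e'"] Mz by simp
  then show thesis using that[OF on' Me] by blast
qed

text \<open>The elements of \<open>KK\<close> are the reciprocals of the eigenvalues of
  \<open>M\<close> on the plane orthogonal to \<open>z\<close>. The eigenframe shows that there are
  at most two, so \<open>Max\<close> and \<open>Min\<close> are genuine, and positivity of
  \<open>KK\<close> passes to the eigenvalues.\<close>

lemma curvature_values:
  fixes M :: "real^3 \<Rightarrow> real^3"
  assumes lin: "linear M" and sym: "\<And>u v. M u \<bullet> v = u \<bullet> M v" and z: "norm z = 1" "M z = 0"
    and ker: "\<And>v. v \<bullet> z = 0 \<Longrightarrow> M v = 0 \<Longrightarrow> v = 0"
    and pos: "\<And>k. k \<in> KK \<Longrightarrow> k > 0" and KK: "KK = {k. \<exists>v. v \<bullet> z = 0 \<and> v \<noteq> 0 \<and> v = k *\<^sub>R M v}"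
    and on: "onf f1 f2 f3"
  shows "Max KK * Min KK = 1 / e23 M f1 f2 f3" "e23 M f1 f2 f3 > 0"
    "((Max KK)^2 + (Min KK)^2) * (Max KK - Min KK)^2 / (8 * (Max KK + Min KK) * (Max KK)^3 * (Min KK)^3)
       = curvQ (tr3 M f1 f2 f3) (e23 M f1 f2 f3)"
    "\<And>v. v \<bullet> z = 0 \<Longrightarrow> v \<noteq> 0 \<Longrightarrow> M v \<bullet> v > 0"
proof -
  obtain e e' r1 r2 where e: "onf e e' z" "M e = r1 *\<^sub>R e" "M e' = r2 *\<^sub>R e'"
    using eigenframe[OF lin sym z] by blast
  note o = onf_inner[OF e(1)]
  have ne: "e \<noteq> 0" "e' \<noteq> 0" using o by auto
  have r: "r1 \<noteq> 0" "r2 \<noteq> 0" using ker[of e] ker[of e'] e ne o by auto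
  have in1: "1 / r1 \<in> KK" "1 / r2 \<in> KK"
  proof -
    show "1 / r1 \<in> KK" unfolding KK using e(2) ne o r by (intro CollectI exI[of _ e]) simp
    show "1 / r2 \<in> KK" unfolding KK using e(3) ne o r by (intro CollectI exI[of _ e']) simp
  qed
  then have rpos: "r1 > 0" "r2 > 0" using pos by fastforce+
  \<comment> \<open>A nonzero vector orthogonal to \<open>z\<close> has a nonzero component along
    \<open>e\<close> or \<open>e'\<close>, and comparing that component determines
    \<open>k\<close>.\<close>
  have "k = 1 / r1 \<or> k = 1 / r2" if "k \<in> KK" for k
  proof -
    obtain v where v: "v \<bullet> z = 0" "v \<noteq> 0" "v = k *\<^sub>R M v" using \<open>k \<in> KK\<close> by (auto simp: KK)
    have "v \<bullet> e = k * (M v \<bullet> e)" "v \<bullet> e' = k * (M v \<bullet> e')"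
      using v(3) by (metis inner_scaleR_left)+
    then have "v \<bullet> e = k * r1 * (v \<bullet> e)" "v \<bullet> e' = k * r2 * (v \<bullet> e')"
      using sym e by simp_all
    moreover have "v \<bullet> e \<noteq> 0 \<or> v \<bullet> e' \<noteq> 0"
      using onf_expand[OF e(1), of v] v by auto
    ultimately have "k * r1 = 1 \<or> k * r2 = 1" by auto
    then show ?thesis using r by (auto simp: field_simps)
  qed
  then have K: "KK = {1 / r1, 1 / r2}" using in1 by auto
  have M0: "M e' \<bullet> e = 0" "M e \<bullet> e' = 0" using e o by simp_all
  have tr: "tr3 M f1 f2 f3 = r1 + r2" "e23 M f1 f2 f3 = r1 * r2"
    unfolding tr3_invariant[OF on e(1) sym] e23_invariant[OF on e(1) sym]
    using e o z by (simp_all add: tr3_def e23_def)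
  show "e23 M f1 f2 f3 > 0" using tr rpos by simp
  have gen: "((1/r)^2 + (1/s)^2) * (1/r - 1/s)^2 / (8 * (1/r + 1/s) * (1/r)^3 * (1/s)^3) = curvQ (r + s) (r * s)"
    if "r > 0" "s > 0" for r s :: real
  proof -
    have 1: "(1/r)^2 + (1/s)^2 = (r^2 + s^2) / (r * s)^2" "1/r - 1/s = (s - r) / (r * s)" "1/r + 1/s = (r + s) / (r * s)"
      "8 * (1/r + 1/s) * (1/r)^3 * (1/s)^3 = 8 * (r + s) / (r * s)^4"
      using that by (simp_all add: field_simps power2_eq_square eval_nat_numeral)
    have "((1/r)^2 + (1/s)^2) * (1/r - 1/s)^2 / (8 * (1/r + 1/s) * (1/r)^3 * (1/s)^3)
      = (r^2 + s^2) * (s - r)^2 / (8 * (r + s))"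
    proof -
      \<comment> \<open>Kept as one symbol, the product of the radii cancels: two factors
        \<open>m^2\<close> against \<open>m^4\<close>.\<close>
      define m where "m = r * s"
      have m: "m \<noteq> 0" using that by (simp add: m_def)
      have "A / m^2 * (d / m)^2 = A * d^2 / m^4" for A d :: real
        by (simp add: power_divide power_add[symmetric])
      then show ?thesis
        unfolding 1(4) unfolding 1(1,2) m_def[symmetric] using m by simp
    qed
    also have "\<dots> = curvQ (r + s) (r * s)"
      unfolding curvQ_def by (simp add: power2_eq_square algebra_simps)
    finally show ?thesis .
  qed
  have "Max KK = 1/r1 \<and> Min KK = 1/r2 \<or> Max KK = 1/r2 \<and> Min KK = 1/r1"
    unfolding K by (auto simp: max_def min_def)
  then show "Max KK * Min KK = 1 / e23 M f1 f2 f3"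
    "((Max KK)^2 + (Min KK)^2) * (Max KK - Min KK)^2 / (8 * (Max KK + Min KK) * (Max KK)^3 * (Min KK)^3)
       = curvQ (tr3 M f1 f2 f3) (e23 M f1 f2 f3)"
    using gen[of r1 r2] gen[of r2 r1] rpos unfolding tr by (auto simp: mult.commute add.commute)
  show "M v \<bullet> v > 0" if "v \<bullet> z = 0" "v \<noteq> 0" for v
  proof -
    have v: "v = (v \<bullet> e) *\<^sub>R e + (v \<bullet> e') *\<^sub>R e'" using onf_expand[OF e(1), of v] that by simp
    have "M v \<bullet> v = r1 * (v \<bullet> e)^2 + r2 * (v \<bullet> e')^2"
      using onf_parseval[OF e(1), of "M v" v] sym[of v e] sym[of v e'] e that by (simp add: power2_eq_square)
    moreover have "v \<bullet> e \<noteq> 0 \<or> v \<bullet> e' \<noteq> 0" using v that by auto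
    ultimately show ?thesis
      using rpos by (auto intro: add_pos_nonneg add_nonneg_pos)
  qed
qed

section \<open>The outer normal of an embedded sphere\<close>

text \<open>Maps on the sphere become maps on an open set, to which the ordinary calculus applies.\<close>
definition hext :: "((real^3) \<times> real \<Rightarrow> 'b) \<Rightarrow> (real^3) \<times> real \<Rightarrow> 'b" where
  "hext F x = F (fst x /\<^sub>R norm (fst x), snd x)"

lemma has_derivative_normalize:
  fixes p :: "'a::real_inner"
  assumes "norm p = 1"
  shows "((\<lambda>q. q /\<^sub>R norm q) has_derivative (\<lambda>u. u - (u \<bullet> p) *\<^sub>R p)) (at p)"
proof -
  have ne: "p \<noteq> 0" using assms by auto
  have n: "(norm has_derivative (\<lambda>v. v \<bullet> p)) (at p)"
    using has_derivative_norm[OF ne] assms by (simp add: sgn_div_norm inner_commute)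
  have "((\<lambda>q. inverse (norm q)) has_derivative (\<lambda>v. - (v \<bullet> p))) (at p)"
    using Deriv.has_derivative_inverse[OF _ n] assms by simp
  from has_derivative_scaleR[OF this has_derivative_ident]
  show ?thesis using assms by simp
qed

text \<open>\<open>dsl\<close> chooses a derivative within the sphere, and such a derivative is not
  unique: its value in the radial direction is arbitrary. Composing with the radial projection
  removes that direction and shows that all candidates agree on tangent vectors. The factor
  \<open>norm p\<close> appears because the derivative of a map of degree zero has degree
  -1.\<close>

lemma dsl_hext:
  assumes D: "((\<lambda>q. hext F (q, t)) has_derivative D) (at p)" and p: "p \<noteq> 0" and u: "u \<bullet> p = 0"
  shows "dsl F t (p /\<^sub>R norm p) u = norm p *\<^sub>R D u"
proof -
  define \<rho> where "\<rho> = norm p"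
  define \<sigma> where "\<sigma> = p /\<^sub>R norm p"
  have \<rho>: "\<rho> > 0" "\<rho> *\<^sub>R \<sigma> = p" "norm \<sigma> = 1" using p by (simp_all add: \<rho>_def \<sigma>_def)
  define f where "f q = F (q, t)" for q
  define E where "E u = D (\<rho> *\<^sub>R u)" for u
  have "((\<lambda>q. \<rho> *\<^sub>R q) has_derivative (\<lambda>u. \<rho> *\<^sub>R u)) (at \<sigma>)"
    by (auto intro!: derivative_eq_intros)
  then have "((\<lambda>q. hext F (\<rho> *\<^sub>R q, t)) has_derivative E) (at \<sigma>)"
    unfolding E_def by (rule has_derivative_compose[of _ _ _ _ "\<lambda>q. hext F (q, t)"]) (simp add: \<rho> D)
  then have "((\<lambda>q. hext F (\<rho> *\<^sub>R q, t)) has_derivative E) (at \<sigma> within S2)"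
    by (rule has_derivative_at_withinI)
  then have fE: "(f has_derivative E) (at \<sigma> within S2)"
    by (rule has_derivative_transform[rotated 2]) (use \<rho> in \<open>auto simp: hext_def f_def\<close>)
  define D' where "D' = frechet_derivative f (at \<sigma> within S2)"
  have fD': "(f has_derivative D') (at \<sigma> within S2)"
    using fE frechet_derivative_works unfolding D'_def differentiable_def by blast
  have comp: "((\<lambda>q. f (q /\<^sub>R norm q)) has_derivative (\<lambda>u. G (u - (u \<bullet> \<sigma>) *\<^sub>R \<sigma>))) (at \<sigma>)"
    if "(f has_derivative G) (at \<sigma> within S2)" for G
  proof -
    have "((\<lambda>q. q /\<^sub>R norm q) has_derivative (\<lambda>u. u - (u \<bullet> \<sigma>) *\<^sub>R \<sigma>)) (at \<sigma> within - {0})"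
      by (rule has_derivative_at_withinI[OF has_derivative_normalize[OF \<rho>(3)]])
    moreover have "(f has_derivative G) (at (\<sigma> /\<^sub>R norm \<sigma>) within (\<lambda>q. q /\<^sub>R norm q) ` (- {0}))"
    proof (rule has_derivative_subset[of _ _ _ S2])
      show "(f has_derivative G) (at (\<sigma> /\<^sub>R norm \<sigma>) within S2)" using that \<rho> by simp
      have "norm (q /\<^sub>R norm q) = 1" if "q \<noteq> 0" for q :: "real^3" using that by simp
      then show "(\<lambda>q. q /\<^sub>R norm q) ` (- {0}) \<subseteq> S2" by fastforce
    qed
    ultimately have "((\<lambda>q. f (q /\<^sub>R norm q)) has_derivative (\<lambda>u. G (u - (u \<bullet> \<sigma>) *\<^sub>R \<sigma>))) (at \<sigma> within - {0})"
      by (rule has_derivative_in_compose)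
    moreover have "at \<sigma> within - {0} = at \<sigma>"
      by (rule at_within_open) (use \<rho> in auto)
    ultimately show ?thesis by (simp only:)
  qed
  have "(\<lambda>u. E (u - (u \<bullet> \<sigma>) *\<^sub>R \<sigma>)) = (\<lambda>u. D' (u - (u \<bullet> \<sigma>) *\<^sub>R \<sigma>))"
    by (rule has_derivative_unique[OF comp[OF fE] comp[OF fD']])
  then have "E (u - (u \<bullet> \<sigma>) *\<^sub>R \<sigma>) = D' (u - (u \<bullet> \<sigma>) *\<^sub>R \<sigma>)" by (rule fun_cong)
  moreover have "u \<bullet> \<sigma> = 0" using u by (simp add: \<sigma>_def)
  ultimately have "D' u = D (\<rho> *\<^sub>R u)" by (simp add: E_def)
  then show ?thesis
    using linear_scale[OF has_derivative_linear[OF D]] by (simp add: dsl_def D'_def f_def[abs_def] \<sigma>_def \<rho>_def)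
qed

text \<open>The cofactor matrix, the linear map that takes \<open>u \<times> v\<close> to
  \<open>L u \<times> L v\<close>. Applied to the position on the sphere it gives a normal of the
  image without a tangent frame, which cannot be chosen continuously on the whole sphere.\<close>

definition crossmap :: "(real^3 \<Rightarrow> real^3) \<Rightarrow> real^3 \<Rightarrow> real^3" where
  "crossmap L w = (w$1) *\<^sub>R (L (ax 2) \<times> L (ax 3)) + (w$2) *\<^sub>R (L (ax 3) \<times> L (ax 1)) + (w$3) *\<^sub>R (L (ax 1) \<times> L (ax 2))"

lemma crossmap_cross:
  assumes "linear L"
  shows "crossmap L (u \<times> v) = L u \<times> L v"
proof -
  obtain a b c where abc: "L (ax 1) = a" "L (ax 2) = b" "L (ax 3) = c" by simp
  show ?thesis
    unfolding crossmap_def linear_vec3[OF assms, of u] linear_vec3[OF assms, of v] abc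
    by (simp add: vec_eq_iff forall_3 cross3_simps)
qed

lemma crossmap_scale: "crossmap L (c *\<^sub>R w) = c *\<^sub>R crossmap L w"
  by (simp only: crossmap_def vector_scaleR_component scaleR_add_right scaleR_scaleR real_scaleR_def)

lemma crossmap_normal:
  assumes lin: "linear L" and p: "p \<noteq> 0" "L p = 0" and inj: "\<And>u. u \<bullet> p = 0 \<Longrightarrow> L u = 0 \<Longrightarrow> u = 0"
  shows "crossmap L p \<noteq> 0" "crossmap L p \<bullet> L u = 0"
    "norm n = 1 \<Longrightarrow> (\<And>u. n \<bullet> L u = 0) \<Longrightarrow> (\<And>u. w \<bullet> L u = 0) \<Longrightarrow> w = (w \<bullet> n) *\<^sub>R n"
proof -
  define \<sigma> where "\<sigma> = p /\<^sub>R norm p"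
  have \<sigma>: "norm \<sigma> = 1" "norm p *\<^sub>R \<sigma> = p" using p by (simp_all add: \<sigma>_def)
  obtain g1 where g1: "norm g1 = 1" "g1 \<bullet> \<sigma> = 0" by (rule ex_unit_orthogonal)
  define g2 where "g2 = \<sigma> \<times> g1"
  have on: "onf g1 g2 \<sigma>" unfolding g2_def by (rule onf_cross[OF g1(1) \<sigma>(1) g1(2)])
  note o = onf_inner[OF on]
  have "g1 \<times> g2 = \<sigma>" unfolding g2_def Lagrange using o by simp
  then have c: "crossmap L p = norm p *\<^sub>R (L g1 \<times> L g2)"
    using crossmap_cross[OF lin, of g1 g2] crossmap_scale[of L "norm p" \<sigma>] \<sigma> by simp
  have Ls: "L \<sigma> = 0" using p by (simp add: \<sigma>_def linear_scale[OF lin])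
  have L: "L u = (u \<bullet> g1) *\<^sub>R L g1 + (u \<bullet> g2) *\<^sub>R L g2" for u
    using arg_cong[OF onf_expand[OF on, of u], of L] Ls by (simp add: linear_add[OF lin] linear_scale[OF lin])
  have ne: "L g1 \<times> L g2 \<noteq> 0"
  proof
    assume 0: "L g1 \<times> L g2 = 0"
    have tang: "(\<alpha> *\<^sub>R g1 + \<beta> *\<^sub>R g2) \<bullet> p = 0" for \<alpha> \<beta>
      using o \<sigma>(2) by (metis (no_types, lifting) add.right_neutral inner_add_left inner_scaleR_left inner_scaleR_right mult_zero_right)
    \<comment> \<open>Chosen so that \<open>L v\<close> is a double cross product containing the
      vanishing \<open>L g1 \<times> L g2\<close>: dependent images put a tangent vector into the
      kernel.\<close>
    define v where "v = (L g2 \<bullet> L g2) *\<^sub>R g1 + (- (L g1 \<bullet> L g2)) *\<^sub>R g2"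
    have "L v = (L g2 \<bullet> L g2) *\<^sub>R L g1 - (L g1 \<bullet> L g2) *\<^sub>R L g2"
      unfolding v_def by (simp add: linear_diff[OF lin] linear_scale[OF lin])
    also have "\<dots> = L g2 \<times> (L g1 \<times> L g2)"
      unfolding Lagrange by (simp add: inner_commute)
    finally have "L v = 0" using 0 by simp
    then have "v = 0" using inj tang v_def by metis
    then have "v \<bullet> g1 = 0" by simp
    then have "L g2 = 0" using o by (simp add: v_def inner_diff_left)
    moreover have "g2 \<bullet> p = 0" using tang[of 0 1] by simp
    ultimately have "g2 = 0" using inj by blast
    then show False using o by simp
  qed
  show "crossmap L p \<noteq> 0" using ne p by (simp add: c)
  show "crossmap L p \<bullet> L u = 0"
    unfolding c L[of u] by (simp add: inner_add_right dot_cross_self inner_commute[of "L g1 \<times> L g2"])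
  show "w = (w \<bullet> n) *\<^sub>R n" if "norm n = 1" "\<And>u. n \<bullet> L u = 0" "\<And>u. w \<bullet> L u = 0"
    by (rule normal_line[OF ne]) (use that in auto)
qed

text \<open>Needed for secants both of whose ends move towards \<open>p\<close>. Continuity of the
  differential in each direction bounds its variation in operator norm, and the mean value
  inequality on a ball does the rest.\<close>

lemma strict_differentiability:
  fixes y :: "'a::euclidean_space \<Rightarrow> 'b::euclidean_space"
  assumes U: "open U" "p \<in> U"
    and d: "\<And>x. x \<in> U \<Longrightarrow> (y has_derivative L x) (at x)"
    and c: "\<And>u. continuous_on U (\<lambda>x. L x u)"
    and e: "e > 0"
  obtains r where "r > 0" "\<And>a b. a \<in> ball p r \<Longrightarrow> b \<in> ball p r \<Longrightarrow> norm (y b - y a - L p (b - a)) \<le> e * norm (b - a)"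
proof -
  have "continuous_on U (\<lambda>x. \<Sum>i\<in>Basis. norm (L x i - L p i))"
    by (intro continuous_intros c)
  then have "isCont (\<lambda>x. \<Sum>i\<in>Basis. norm (L x i - L p i)) p"
    using U by (simp add: continuous_on_eq_continuous_at)
  then obtain r1 where r1: "r1 > 0" "\<And>x. dist x p < r1 \<Longrightarrow> (\<Sum>i\<in>Basis. norm (L x i - L p i)) < e"
    using e unfolding continuous_at_eps_delta by (fastforce simp: dist_real_def)
  obtain r2 where r2: "r2 > 0" "ball p r2 \<subseteq> U" using U openE by blast
  define r where "r = min r1 r2"
  show thesis
  proof (rule that[of r])
    show "r > 0" using r1 r2 by (simp add: r_def)
    fix a b assume ab: "a \<in> ball p r" "b \<in> ball p r"
    have "norm (y b - y a - L p (b - a)) \<le> norm (b - a) * e"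
    proof (rule differentiable_bound_linearization[where S = "ball p r" and f' = L and f = y])
      show "a + t *\<^sub>R (b - a) \<in> ball p r" if "t \<in> {0..1}" for t :: real
      proof -
        have "a + t *\<^sub>R (b - a) = (1 - t) *\<^sub>R a + t *\<^sub>R b" by (simp add: algebra_simps)
        then show ?thesis using convexD_alt[OF convex_ball ab, of t] that by simp
      qed
      show "(y has_derivative L x) (at x within ball p r)" if "x \<in> ball p r" for x
        by (rule has_derivative_at_withinI, rule d) (use that r2 in \<open>auto simp: r_def\<close>)
      show "onorm (L x - L p) \<le> e" if "x \<in> ball p r" for x
      proof -
        have "x \<in> U" using that r2 by (auto simp: r_def)
        have "bounded_linear (\<lambda>u. L x u - L p u)"
          using d[OF \<open>x \<in> U\<close>] d[OF U(2)] by (intro bounded_linear_sub has_derivative_bounded_linear)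
        then have "onorm (\<lambda>u. L x u - L p u) \<le> (\<Sum>i\<in>Basis. norm (L x i - L p i))"
          by (rule onorm_componentwise)
        also have "\<dots> \<le> e" using r1(2)[of x] that by (simp add: r_def dist_commute)
        finally show ?thesis by (simp add: fun_diff_def)
      qed
      show "p \<in> ball p r" using r1 r2 by (simp add: r_def)
    qed
    then show "norm (y b - y a - L p (b - a)) \<le> e * norm (b - a)" by (simp add: mult.commute)
  qed
qed

text \<open>Otherwise normals meet the surface again arbitrarily close to their foot points. By
  compactness and injectivity both points converge to the same \<open>p\<close>, and the chord
  direction to a tangent vector \<open>e\<close>; its image is both parallel and orthogonal to the
  normal, against immersion.\<close>

lemma embedded_tube:
  fixes y :: "real^3 \<Rightarrow> real^3"
  assumes d: "\<And>p. p \<noteq> 0 \<Longrightarrow> (y has_derivative L p) (at p)"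
    and c: "\<And>u. continuous_on (- {0}) (\<lambda>p. L p u)"
    and inj: "\<And>p u. p \<noteq> 0 \<Longrightarrow> u \<bullet> p = 0 \<Longrightarrow> L p u = 0 \<Longrightarrow> u = 0"
    and n: "continuous_on (- {0}) n" "\<And>p. p \<noteq> 0 \<Longrightarrow> norm (n p) = 1" "\<And>p u. p \<noteq> 0 \<Longrightarrow> n p \<bullet> L p u = 0"
    and emb: "inj_on y S2"
  obtains \<delta> where "\<delta> > 0" "\<And>p s. p \<in> S2 \<Longrightarrow> s \<noteq> 0 \<Longrightarrow> \<bar>s\<bar> < \<delta> \<Longrightarrow> y p + s *\<^sub>R n p \<notin> y ` S2"
proof (rule ccontr)
  assume "\<not> thesis"
  with that have no: "\<not> (\<forall>p\<in>S2. \<forall>s. s \<noteq> 0 \<longrightarrow> \<bar>s\<bar> < \<delta> \<longrightarrow> y p + s *\<^sub>R n p \<notin> y ` S2)" if "\<delta> > 0" for \<delta>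
    using that by blast
  have "\<exists>p q s. p \<in> S2 \<and> q \<in> S2 \<and> s \<noteq> 0 \<and> \<bar>s\<bar> < inverse (real (Suc k)) \<and> y q = y p + s *\<^sub>R n p" for k
    using no[of "inverse (real (Suc k))"] by fastforce
  then obtain P R s where PR: "\<And>k. P k \<in> S2" "\<And>k. R k \<in> S2" and s: "\<And>k. s k \<noteq> 0"
    "\<And>k. \<bar>s k\<bar> < inverse (real (Suc k))" and yR: "\<And>k. y (R k) = y (P k) + s k *\<^sub>R n (P k)"
    by metis
  have ne: "p \<noteq> 0" if "p \<in> S2" for p :: "real^3" using that by auto
  define h where "h k = norm (R k - P k)" for k
  have h: "h k > 0" for k
  proof -
    have "n (P k) \<noteq> 0" using n(2)[of "P k"] ne[OF PR(1)] by (metis norm_zero zero_neq_one)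
    then have "R k \<noteq> P k" using yR[of k] s(1)[of k] by auto
    then show ?thesis by (simp add: h_def)
  qed
  define E where "E k = (R k - P k) /\<^sub>R h k" for k
  have E: "E k \<in> S2" for k using h[of k] by (simp add: E_def h_def)
  have "compact (Sigma S2 (\<lambda>_. Sigma S2 (\<lambda>_. S2)))"
    by (rule compact_Times[OF compact_sphere compact_Times[OF compact_sphere compact_sphere]])
  then have sc: "seq_compact (Sigma S2 (\<lambda>_. Sigma S2 (\<lambda>_. S2)))"
    by (rule compact_imp_seq_compact)
  have mem: "\<forall>k. (P k, R k, E k) \<in> Sigma S2 (\<lambda>_. Sigma S2 (\<lambda>_. S2))"
    using PR E by blast
  obtain l r where l: "l \<in> Sigma S2 (\<lambda>_. Sigma S2 (\<lambda>_. S2))" "strict_mono (r :: nat \<Rightarrow> nat)" "((\<lambda>k. (P k, R k, E k)) \<circ> r) \<longlonglongrightarrow> l"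
    by (rule seq_compactE[OF sc mem])
  obtain p q e where pqe: "l = (p, q, e)" "p \<in> S2" "q \<in> S2" "e \<in> S2" using l(1) by (cases l) auto
  have lim: "(\<lambda>k. P (r k)) \<longlonglongrightarrow> p" "(\<lambda>k. R (r k)) \<longlonglongrightarrow> q" "(\<lambda>k. E (r k)) \<longlonglongrightarrow> e"
    using tendsto_fst[OF l(3)] tendsto_fst[OF tendsto_snd[OF l(3)]] tendsto_snd[OF tendsto_snd[OF l(3)]]
    by (simp_all add: pqe o_def)
  have yc: "isCont y x" if "x \<in> S2" for x
    using has_derivative_continuous[OF d] ne[OF that] by auto
  have np: "(\<lambda>k. n (P (r k))) \<longlonglongrightarrow> n p"
  proof (rule isCont_tendsto_compose[OF _ lim(1)])
    have "open (- {0::real^3})" by (intro open_Compl closed_singleton)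
    from iffD1[OF continuous_on_eq_continuous_at[OF this] n(1)] show "isCont n p"
      by (rule bspec) (use ne[OF pqe(2)] in simp)
  qed
  have s0: "(\<lambda>k. s (r k)) \<longlonglongrightarrow> 0"
  proof -
    have "s \<longlonglongrightarrow> 0"
      by (rule Lim_null_comparison[OF _ LIMSEQ_inverse_real_of_nat]) (use s(2) in \<open>auto intro!: always_eventually less_imp_le\<close>)
    from LIMSEQ_subseq_LIMSEQ[OF this l(2)] show ?thesis by (simp add: o_def)
  qed
  have "(\<lambda>k. y (R (r k))) \<longlonglongrightarrow> y p + 0 *\<^sub>R n p"
    unfolding yR by (intro tendsto_intros s0 np isCont_tendsto_compose[OF yc[OF pqe(2)] lim(1)])
  then have "y q = y p"
    using LIMSEQ_unique isCont_tendsto_compose[OF yc[OF pqe(3)] lim(2)] by fastforce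
  then have qp: "q = p" using emb pqe by (simp add: inj_on_eq_iff)
  have "(\<lambda>k. E (r k) \<bullet> (R (r k) + P (r k))) \<longlonglongrightarrow> e \<bullet> (p + p)"
    using lim unfolding qp by (intro tendsto_intros)
  \<comment> \<open>Both points have norm one, so the chord is orthogonal to the sum of its ends; in
    the limit \<open>e\<close> is tangent at \<open>p\<close>.\<close>
  moreover have "E k \<bullet> (R k + P k) = 0" for k
  proof -
    have "(R k - P k) \<bullet> (R k + P k) = R k \<bullet> R k - P k \<bullet> P k"
      by (simp add: inner_diff_left inner_add_right inner_commute[of "P k" "R k"])
    also have "\<dots> = 0" using PR[of k] by (simp add: dot_square_norm)
    finally show ?thesis by (simp only: E_def inner_scaleR_left mult_zero_right)
  qed
  ultimately have "e \<bullet> (p + p) = 0" by (simp add: LIMSEQ_const_iff)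
  then have "e \<bullet> p + e \<bullet> p = 0" by (simp only: inner_add_right)
  then have ep: "e \<bullet> p = 0" by simp
  have Lp: "bounded_linear (L p)" using d[OF ne[OF pqe(2)]] by (rule has_derivative_bounded_linear)
  \<comment> \<open>The difference of the two image points is \<open>s\<close> times the normal;
    divided by the chord length it approaches the differential of the chord direction.\<close>
  have "(\<lambda>k. (s (r k) / h (r k)) *\<^sub>R n (P (r k)) - L p (E (r k))) \<longlonglongrightarrow> 0"
  proof (rule LIMSEQ_I)
    fix \<epsilon> :: real assume \<epsilon>: "\<epsilon> > 0"
    obtain d0 where d0: "d0 > 0"
      "\<And>a b. a \<in> ball p d0 \<Longrightarrow> b \<in> ball p d0 \<Longrightarrow> norm (y b - y a - L p (b - a)) \<le> (\<epsilon>/2) * norm (b - a)"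
      by (rule strict_differentiability[of "- {0}" p y L "\<epsilon>/2"]) (use d c ne[OF pqe(2)] \<epsilon> in auto)
    have "eventually (\<lambda>k. P (r k) \<in> ball p d0) sequentially" "eventually (\<lambda>k. R (r k) \<in> ball p d0) sequentially"
      using topological_tendstoD[OF lim(1), of "ball p d0"] topological_tendstoD[OF lim(2), of "ball p d0"] d0(1) qp by auto
    then have "eventually (\<lambda>k. norm ((s (r k) / h (r k)) *\<^sub>R n (P (r k)) - L p (E (r k)) - 0) < \<epsilon>) sequentially"
    proof eventually_elim
      case (elim k)
      let ?k = "r k"
      have "(s ?k / h ?k) *\<^sub>R n (P ?k) - L p (E ?k) = (y (R ?k) - y (P ?k) - L p (R ?k - P ?k)) /\<^sub>R h ?k"
      proof -
        have "L p (E ?k) = L p (R ?k - P ?k) /\<^sub>R h ?k"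
          unfolding E_def by (rule linear_scale[OF bounded_linear.linear[OF Lp]])
        then show ?thesis
          using yR[of ?k] by (simp add: scaleR_diff_right divide_inverse mult.commute)
      qed
      then have "norm ((s ?k / h ?k) *\<^sub>R n (P ?k) - L p (E ?k)) = norm (y (R ?k) - y (P ?k) - L p (R ?k - P ?k)) / h ?k"
        using h[of ?k] by (simp add: divide_inverse mult.commute)
      also have "\<dots> \<le> ((\<epsilon>/2) * h ?k) / h ?k"
        using d0(2)[OF elim] h[of ?k] by (intro divide_right_mono) (auto simp: h_def)
      also have "\<dots> < \<epsilon>" using h[of ?k] \<epsilon> by simp
      finally show ?case by simp
    qed
    then show "\<exists>N. \<forall>k\<ge>N. norm ((s (r k) / h (r k)) *\<^sub>R n (P (r k)) - L p (E (r k)) - 0) < \<epsilon>"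
      by (simp add: eventually_sequentially)
  qed
  moreover have Le: "(\<lambda>k. L p (E (r k))) \<longlonglongrightarrow> L p e"
    using bounded_linear.tendsto[OF Lp lim(3)] .
  ultimately have sn: "(\<lambda>k. (s (r k) / h (r k)) *\<^sub>R n (P (r k))) \<longlonglongrightarrow> L p e"
    using tendsto_add by fastforce
  \<comment> \<open>The cross product with the normal eliminates the unknown ratio of
    \<open>s\<close> to \<open>h\<close>.\<close>
  have "(\<lambda>k. ((s (r k) / h (r k)) *\<^sub>R n (P (r k))) \<times> n (P (r k))) \<longlonglongrightarrow> L p e \<times> n p"
    by (rule bounded_bilinear.tendsto[OF bounded_bilinear_cross3 sn np])
  then have "L p e \<times> n p = 0"
    by (simp add: cross_mult_left LIMSEQ_const_iff)
  moreover have "L p e \<bullet> n p = 0" using n(3)[OF ne[OF pqe(2)], of e] by (simp add: inner_commute)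
  moreover have "n p \<noteq> 0" using n(2)[OF ne[OF pqe(2)]] by auto
  ultimately have "L p e = 0" using norm_and_cross_eq_0[of "L p e" "n p"] by simp
  then have "e = 0" by (rule inj[OF ne[OF pqe(2)] ep])
  then show False using ne[OF pqe(4)] by contradiction
qed

text \<open>By the tube property the two sides of the surface are connected and disjoint from it, and by the
  nearest-point projection they cover a neighbourhood. If both met the outside, there would be no room for
  the bounded component that the Jordan-Brouwer theorem provides.\<close>
lemma outer_side_constant:
  fixes y :: "real^3 \<Rightarrow> real^3"
  assumes d: "\<And>p. p \<noteq> 0 \<Longrightarrow> (y has_derivative L p) (at p)"
    and c: "\<And>u. continuous_on (- {0}) (\<lambda>p. L p u)"
    and inj: "\<And>p u. p \<noteq> 0 \<Longrightarrow> u \<bullet> p = 0 \<Longrightarrow> L p u = 0 \<Longrightarrow> u = 0"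
    and n: "continuous_on (- {0}) n" "\<And>p. p \<noteq> 0 \<Longrightarrow> norm (n p) = 1" "\<And>p u. p \<noteq> 0 \<Longrightarrow> n p \<bullet> L p u = 0"
    and normal: "\<And>p w. p \<noteq> 0 \<Longrightarrow> (\<And>u. w \<bullet> L p u = 0) \<Longrightarrow> w = (w \<bullet> n p) *\<^sub>R n p"
    and hom: "\<And>p. p \<noteq> 0 \<Longrightarrow> y (p /\<^sub>R norm p) = y p"
    and emb: "inj_on y S2"
    and p1: "p1 \<in> S2" "eventually (\<lambda>s. y p1 + s *\<^sub>R n p1 \<in> outside (y ` S2)) (at_right 0)"
    and p2: "p2 \<in> S2" "eventually (\<lambda>s. y p2 - s *\<^sub>R n p2 \<in> outside (y ` S2)) (at_right 0)"
  shows False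
proof -
  let ?M = "y ` S2"
  have ne: "p \<noteq> 0" if "p \<in> S2" for p :: "real^3" using that by auto
  have "\<exists>\<delta>>0. \<forall>p\<in>S2. \<forall>s. s \<noteq> 0 \<longrightarrow> \<bar>s\<bar> < \<delta> \<longrightarrow> y p + s *\<^sub>R n p \<notin> ?M"
    by (rule embedded_tube[of y L n]) (assumption | rule d c inj n emb | blast)+
  then obtain \<delta> where \<delta>: "\<delta> > 0" "\<And>p s. p \<in> S2 \<Longrightarrow> s \<noteq> 0 \<Longrightarrow> \<bar>s\<bar> < \<delta> \<Longrightarrow> y p + s *\<^sub>R n p \<notin> ?M"
    by blast
  have yc: "continuous_on S2 y"
    using has_derivative_continuous[OF d] ne by (intro continuous_at_imp_continuous_on) auto
  have nc: "continuous_on S2 n" using n(1) by (rule continuous_on_subset) auto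
  have M: "compact ?M" using yc compact_sphere compact_continuous_image by blast
  \<comment> \<open>One half of the tube is the image of the sphere times an interval avoiding zero,
    so it is connected and lies in a single component of the complement.\<close>
  have side: "y p + s *\<^sub>R n p \<in> outside ?M"
    if I: "I \<subseteq> {s. s \<noteq> 0 \<and> \<bar>s\<bar> < \<delta>}" "connected I" and q0: "p0 \<in> S2" "s0 \<in> I" "y p0 + s0 *\<^sub>R n p0 \<in> outside ?M"
      and q: "p \<in> S2" "s \<in> I" for I p0 s0 p s
  proof -
    define F where "F x = y (fst x) + snd x *\<^sub>R n (fst x)" for x :: "(real^3) \<times> real"
    define A where "A = F ` Sigma S2 (\<lambda>_. I)"
    have "connected (S2 :: (real^3) set)" by (rule connected_sphere) simp
    then have "connected (Sigma S2 (\<lambda>_. I))" using I(2) by (rule connected_Times)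
    moreover have "continuous_on (Sigma S2 (\<lambda>_. I)) F"
    proof -
      have "continuous_on (Sigma S2 (\<lambda>_. I)) (\<lambda>x. y (fst x))" "continuous_on (Sigma S2 (\<lambda>_. I)) (\<lambda>x. n (fst x))"
        by (rule continuous_on_compose2[OF yc] continuous_on_compose2[OF nc]; auto intro: continuous_on_fst continuous_on_id)+
      then show ?thesis
        unfolding F_def[abs_def] by (intro continuous_on_add continuous_on_scaleR continuous_on_snd continuous_on_id)
    qed
    ultimately have conn: "connected A"
      unfolding A_def by (metis connected_continuous_image)
    have disj: "A \<subseteq> - ?M"
    proof
      fix x assume "x \<in> A"
      then obtain p' s' where x: "x = y p' + s' *\<^sub>R n p'" "p' \<in> S2" "s' \<in> I" by (auto simp: A_def F_def)
      then have "s' \<noteq> 0" "\<bar>s'\<bar> < \<delta>" using I(1) by auto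
      then show "x \<in> - ?M" using \<delta>(2)[OF x(2)] unfolding x(1) by blast
    qed
    have "F (p0, s0) \<in> A" "F (p, s) \<in> A"
      unfolding A_def using q0 q by blast+
    then have "y p0 + s0 *\<^sub>R n p0 \<in> A" "y p + s *\<^sub>R n p \<in> A"
      by (simp_all add: F_def)
    then have "connected_component (- ?M) (y p0 + s0 *\<^sub>R n p0) (y p + s *\<^sub>R n p)"
      unfolding connected_component_def using conn disj by blast
    then show ?thesis using outside_same_component q0(3) by metis
  qed
  have ev: "eventually (\<lambda>s::real. 0 < s \<and> s < \<delta>) (at_right 0)"
    using eventually_at_right_real[OF \<delta>(1)] by (rule eventually_mono) auto
  obtain s1 where s1: "0 < s1" "s1 < \<delta>" "y p1 + s1 *\<^sub>R n p1 \<in> outside ?M"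
    using eventually_happens'[OF _ eventually_conj[OF ev p1(2)]] by auto
  obtain s2 where s2: "0 < s2" "s2 < \<delta>" "y p2 - s2 *\<^sub>R n p2 \<in> outside ?M"
    using eventually_happens'[OF _ eventually_conj[OF ev p2(2)]] by auto
  have plus: "y p + s *\<^sub>R n p \<in> outside ?M" if "p \<in> S2" "0 < s" "s < \<delta>" for p s
    by (rule side[of "{0<..<\<delta>}" p1 s1]) (use that s1 p1 in auto)
  have minus: "y p + s *\<^sub>R n p \<in> outside ?M" if "p \<in> S2" "- \<delta> < s" "s < 0" for p s
    by (rule side[of "{-\<delta><..<0}" p2 "- s2"]) (use that s2 p2 in auto)
  have "?M homeomorphic S2"
    using homeomorphic_compact[OF compact_sphere yc refl emb] homeomorphic_sym by blast
  \<comment> \<open>The outside of a bounded set is connected here, so separation by the surface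
    forces a nonempty inside.\<close>
  then have "\<not> connected (- ?M)"
    by (rule Jordan_Brouwer_separation) simp
  moreover have "bounded ?M" using M by (rule compact_imp_bounded)
  moreover have "closed ?M" using M by (rule compact_imp_closed)
  moreover have "connected (outside ?M)"
    using \<open>bounded ?M\<close> by (rule connected_outside) simp
  moreover have "outside ?M = - ?M" if "inside ?M = {}"
    using inside_Un_outside[of ?M] that by simp
  ultimately have "inside ?M \<noteq> {}" by metis
  have "bounded (inside ?M)" using bounded_inside \<open>bounded ?M\<close> by blast
  then have "frontier (inside ?M) \<noteq> {}"
    using \<open>inside ?M \<noteq> {}\<close> frontier_eq_empty not_bounded_UNIV by metis
  then obtain m where m: "m \<in> frontier (inside ?M)" by blast
  then have mM: "m \<in> ?M" using frontier_inside_subset[OF \<open>closed ?M\<close>] by blast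
  have "m \<in> closure (inside ?M)" using m by (simp add: frontier_def)
  \<comment> \<open>A point of the inside that is closer to the surface than the tube
    radius.\<close>
  then obtain w where w: "w \<in> inside ?M" "dist w m < \<delta>"
    using \<delta>(1) closure_approachable by blast
  have wM: "w \<notin> ?M" "w \<notin> outside ?M"
    using w(1) inside_no_overlap[of ?M] inside_Int_outside[of ?M] by blast+
  obtain x where x: "x \<in> ?M" "\<And>z. z \<in> ?M \<Longrightarrow> dist w x \<le> dist w z"
    using distance_attains_inf[OF \<open>closed ?M\<close>] mM by blast
  then obtain p where p: "p \<in> S2" "x = y p" by blast
  \<comment> \<open>At the nearest point the first-order condition makes \<open>w - y p\<close>
    normal, so \<open>w\<close> lies in the tube. The minimum extends to the punctured space because
    \<open>y\<close> is constant on rays.\<close>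
  have "(\<lambda>u. - 2 * ((w - y p) \<bullet> L p u)) = (\<lambda>u. 0)"
  proof (rule differential_zero_maxmin[of p "- {0}" "\<lambda>q. (w - y q) \<bullet> (w - y q)"])
    show "((\<lambda>q. (w - y q) \<bullet> (w - y q)) has_derivative (\<lambda>u. - 2 * ((w - y p) \<bullet> L p u))) (at p)"
      using has_derivative_inner[OF has_derivative_diff[OF has_derivative_const d[OF ne[OF p(1)]]]
          has_derivative_diff[OF has_derivative_const d[OF ne[OF p(1)]]], of w w]
      by (simp add: inner_commute)
    have "(w - y p) \<bullet> (w - y p) \<le> (w - y q) \<bullet> (w - y q)" if "q \<in> - {0}" for q
    proof -
      have "y q \<in> ?M" using that hom[of q] by (intro image_eqI[of _ _ "q /\<^sub>R norm q"]) auto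
      then show ?thesis
        using x(2) p(2) by (simp add: dist_norm norm_eq_sqrt_inner)
    qed
    then show "(\<forall>q\<in>- {0}. (w - y q) \<bullet> (w - y q) \<le> (w - y p) \<bullet> (w - y p)) \<or>
      (\<forall>q\<in>- {0}. (w - y p) \<bullet> (w - y p) \<le> (w - y q) \<bullet> (w - y q))" by blast
  qed (use ne[OF p(1)] in auto)
  then have "(w - y p) \<bullet> L p u = 0" for u by (auto dest: fun_cong)
  then have "w - y p = ((w - y p) \<bullet> n p) *\<^sub>R n p" using normal ne[OF p(1)] by blast
  define t where "t = (w - y p) \<bullet> n p"
  have wt: "w = y p + t *\<^sub>R n p" using \<open>w - y p = _\<close> by (simp add: t_def algebra_simps)
  have "\<bar>t\<bar> = norm (t *\<^sub>R n p)" using n(2)[OF ne[OF p(1)]] by simp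
  also have "t *\<^sub>R n p = w - x" using wt p(2) by simp
  also have "norm (w - x) < \<delta>" using x(2)[OF mM] w(2) by (simp add: dist_norm)
  finally have "\<bar>t\<bar> < \<delta>" .
  moreover have "t \<noteq> 0" using wt wM(1) p by auto
  ultimately have "0 < t \<and> t < \<delta> \<or> - \<delta> < t \<and> t < 0" by linarith
  then have "y p + t *\<^sub>R n p \<in> outside ?M"
    using plus[OF p(1), of t] minus[OF p(1), of t] by blast
  then have "w \<in> outside ?M" by (simp only: wt[symmetric])
  then show False using wM by blast
qed

section \<open>Spatial derivatives of extensions of degree zero\<close>

lemma has_derivative_space:
  assumes "smooth_on V F" "(p, t) \<in> V"
  shows "((\<lambda>q. F (q, t)) has_derivative (\<lambda>u. pd F (u, 0) (p, t))) (at p)"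
proof -
  have "((\<lambda>q. (q, t)) has_derivative (\<lambda>u. (u, 0))) (at p)"
    by (intro has_derivative_Pair has_derivative_ident has_derivative_const)
  then show ?thesis
    by (rule has_derivative_compose[of _ _ _ _ F]) (rule pd_has_derivative[OF assms])
qed

lemma linear_space:
  assumes "smooth_on V F" "x \<in> V"
  shows "linear (\<lambda>u. pd F (u, 0) x)"
proof -
  have "((\<lambda>q. F (q, snd x)) has_derivative (\<lambda>u. pd F (u, 0) x)) (at (fst x))"
    using has_derivative_space[OF assms(1), of "fst x" "snd x"] assms(2) by simp
  then show ?thesis by (rule has_derivative_linear)
qed

lemma hext_scale:
  assumes "c > 0"
  shows "hext F (c *\<^sub>R p, t) = hext F (p, t)"
proof -
  have "inverse (norm (c *\<^sub>R p)) * c = inverse (norm p)"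
    using assms by simp
  then show ?thesis by (simp only: hext_def fst_conv snd_conv scaleR_scaleR)
qed

lemma hext_sphere: "norm p = 1 \<Longrightarrow> hext F (p, t) = F (p, t)"
  by (simp add: hext_def)

lemma pd_hext_scale:
  assumes "smooth_on V (hext F)" "(p, t) \<in> V" "(c *\<^sub>R p, t) \<in> V" "c > 0"
  shows "pd (hext F) (u, 0) (p, t) = c *\<^sub>R pd (hext F) (u, 0) (c *\<^sub>R p, t)"
proof -
  have "((\<lambda>q. c *\<^sub>R q) has_derivative (\<lambda>u. c *\<^sub>R u)) (at p)"
    by (auto intro!: derivative_eq_intros)
  then have "((\<lambda>q. hext F (c *\<^sub>R q, t)) has_derivative (\<lambda>u. pd (hext F) (c *\<^sub>R u, 0) (c *\<^sub>R p, t))) (at p)"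
    by (rule has_derivative_compose[of _ _ _ _ "\<lambda>q. hext F (q, t)"]) (rule has_derivative_space[OF assms(1,3)])
  then have "((\<lambda>q. hext F (q, t)) has_derivative (\<lambda>u. pd (hext F) (c *\<^sub>R u, 0) (c *\<^sub>R p, t))) (at p)"
    by (simp only: hext_scale[OF assms(4)])
  from fun_cong[OF has_derivative_unique[OF has_derivative_space[OF assms(1,2)] this], of u]
  show ?thesis
    using linear_scale[OF linear_space[OF assms(1,3)]] by simp
qed

lemma pd_hext_radial:
  assumes "smooth_on V (hext F)" "(p, t) \<in> V"
  shows "pd (hext F) (p, 0) (p, t) = 0"
proof -
  have "((\<lambda>s::real. p + s *\<^sub>R p) has_derivative (\<lambda>h. h *\<^sub>R p)) (at 0)"
    by (auto intro!: derivative_eq_intros)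
  then have 1: "((\<lambda>s. hext F (p + s *\<^sub>R p, t)) has_derivative (\<lambda>h. pd (hext F) (h *\<^sub>R p, 0) (p, t))) (at 0)"
    by (rule has_derivative_compose[of _ _ _ _ "\<lambda>q. hext F (q, t)"]) (use has_derivative_space[OF assms] in simp)
  have 2: "((\<lambda>s. hext F (p + s *\<^sub>R p, t)) has_derivative (\<lambda>h. 0)) (at 0)"
  proof (rule has_derivative_transform_within_open[of "\<lambda>s. hext F (p, t)" _ _ _ "{- 1<..<1::real}"])
    show "hext F (p, t) = hext F (p + s *\<^sub>R p, t)" if "s \<in> {- 1<..<1}" for s
    proof -
      have "p + s *\<^sub>R p = (1 + s) *\<^sub>R p" by (simp add: scaleR_add_left)
      then show ?thesis using hext_scale[of "1 + s" F p t] that by simp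
    qed
  qed auto
  from fun_cong[OF has_derivative_unique[OF 1 2], of 1] show ?thesis by simp
qed

section \<open>Convex surfaces moving by the inverse Gauss curvature\<close>

locale convex_flow =
  fixes X \<nu> :: "(real^3) \<times> real \<Rightarrow> real^3" and a b :: real and U :: "((real^3) \<times> real) set"
  assumes ab: "a < b"
    and U: "open U" "\<And>p t. p \<in> S2 \<Longrightarrow> a < t \<Longrightarrow> t < b \<Longrightarrow> (p, t) \<in> U" "smooth_on U X"
    and embedded: "\<forall>t\<in>{a<..<b}. inj_on (\<lambda>p. X (p, t)) S2"
    and immersed: "\<forall>t\<in>{a<..<b}. \<forall>p\<in>S2. \<forall>u. u \<bullet> p = 0 \<and> u \<noteq> 0 \<longrightarrow> dsl X t p u \<noteq> 0"
    and unit_normal: "\<forall>t\<in>{a<..<b}. \<forall>p\<in>S2. norm (\<nu> (p, t)) = 1 \<and>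
                        (\<forall>u. u \<bullet> p = 0 \<longrightarrow> \<nu> (p, t) \<bullet> dsl X t p u = 0)"
    and outer: "\<forall>t\<in>{a<..<b}. \<forall>p\<in>S2.
                  eventually (\<lambda>s. X (p, t) + s *\<^sub>R \<nu> (p, t) \<in> outside ((\<lambda>q. X (q, t)) ` S2)) (at_right 0)"
    and strictly_convex: "\<forall>t\<in>{a<..<b}. \<forall>p\<in>S2. \<forall>k. principal_curvature X \<nu> t p k \<longrightarrow> k > 0"
    and flow: "\<forall>t\<in>{a<..<b}. \<forall>p\<in>S2.
                 ((\<lambda>s. X (p, s)) has_vector_derivative (1 / gauss_curv X \<nu> t p) *\<^sub>R \<nu> (p, t)) (at t)"
begin

section \<open>The extended flow and a smooth unit normal\<close>

definition Om :: "((real^3) \<times> real) set" where "Om = {x. fst x \<noteq> 0 \<and> a < snd x \<and> snd x < b}"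

lemma mem_Om: "(p, t) \<in> Om \<longleftrightarrow> p \<noteq> 0 \<and> a < t \<and> t < b"
  by (simp add: Om_def)

lemma open_Om: "open Om"
  unfolding Om_def by (intro open_Collect_conj open_Collect_less open_Collect_neq continuous_intros)

lemma smooth_fst: "smooth_on Om fst" and smooth_snd: "smooth_on Om snd"
  by (intro smooth_on_linear open_Om bounded_linear_fst bounded_linear_snd)+

lemma smooth_norm_fst: "smooth_on Om (\<lambda>x. norm (fst x))"
  by (rule smooth_on_norm_comp[OF open_Om smooth_fst]) (simp add: Om_def)

lemma smooth_hext:
  assumes "open V" "smooth_on V F" "\<And>p t. p \<in> S2 \<Longrightarrow> a < t \<Longrightarrow> t < b \<Longrightarrow> (p, t) \<in> V"
  shows "smooth_on Om (hext F)"
  unfolding hext_def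
proof (rule smooth_on_compose[OF open_Om assms(1) _ assms(2)])
  show "smooth_on Om (\<lambda>x. (fst x /\<^sub>R norm (fst x), snd x))"
    by (intro smooth_on_Pair open_Om smooth_on_scaleR smooth_on_inverse_comp smooth_norm_fst smooth_fst smooth_snd)
      (simp add: Om_def)
  show "(\<lambda>x. (fst x /\<^sub>R norm (fst x), snd x)) ` Om \<subseteq> V"
    using assms(3) by (auto simp: Om_def)
qed

definition Y where "Y = hext X"
definition cr where "cr x = crossmap (\<lambda>u. pd Y (u, 0) x) (fst x)"
text \<open>A unit normal built from \<open>X\<close> alone, hence smooth in space and time jointly.
  The given normal is recovered as a constant sign times this one and inherits its
  derivatives.\<close>

definition nt where "nt = hext (\<lambda>x. cr x /\<^sub>R norm (cr x))"

lemma smooth_Y: "smooth_on Om Y"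
  unfolding Y_def by (rule smooth_hext[OF U(1,3,2)])

lemma Y_radial: "(p, t) \<in> Om \<Longrightarrow> pd Y (p, 0) (p, t) = 0"
  using pd_hext_radial smooth_Y unfolding Y_def by blast

lemma Y_dsl:
  assumes "(p, t) \<in> Om" "u \<bullet> p = 0"
  shows "dsl X t (p /\<^sub>R norm p) u = norm p *\<^sub>R pd Y (u, 0) (p, t)"
  by (rule dsl_hext) (use has_derivative_space[OF smooth_Y assms(1)] assms in \<open>auto simp: Y_def mem_Om\<close>)

lemma Y_inj:
  assumes "(p, t) \<in> Om" "u \<bullet> p = 0" "pd Y (u, 0) (p, t) = 0"
  shows "u = 0"
proof (rule ccontr)
  assume "u \<noteq> 0"
  have "p /\<^sub>R norm p \<in> S2" "u \<bullet> (p /\<^sub>R norm p) = 0" "t \<in> {a<..<b}" using assms by (auto simp: mem_Om)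
  then have "dsl X t (p /\<^sub>R norm p) u \<noteq> 0"
    using immersed \<open>u \<noteq> 0\<close> by blast
  then show False using Y_dsl[OF assms(1,2)] assms(3) by simp
qed

lemma cr_facts:
  assumes "(p, t) \<in> Om"
  shows "cr (p, t) \<noteq> 0" "cr (p, t) \<bullet> pd Y (u, 0) (p, t) = 0"
    "norm n = 1 \<Longrightarrow> (\<And>u. n \<bullet> pd Y (u, 0) (p, t) = 0) \<Longrightarrow> (\<And>u. w \<bullet> pd Y (u, 0) (p, t) = 0) \<Longrightarrow> w = (w \<bullet> n) *\<^sub>R n"
proof -
  note C = crossmap_normal[OF linear_space[OF smooth_Y assms] _ Y_radial[OF assms] Y_inj[OF assms]]
  have "p \<noteq> 0" using assms by (simp add: mem_Om)
  from C(1)[OF this] C(2)[OF this] show "cr (p, t) \<noteq> 0" "cr (p, t) \<bullet> pd Y (u, 0) (p, t) = 0"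
    by (simp_all add: cr_def)
  from C(3)[OF \<open>p \<noteq> 0\<close>] show "norm n = 1 \<Longrightarrow> (\<And>u. n \<bullet> pd Y (u, 0) (p, t) = 0) \<Longrightarrow>
      (\<And>u. w \<bullet> pd Y (u, 0) (p, t) = 0) \<Longrightarrow> w = (w \<bullet> n) *\<^sub>R n" by blast
qed

lemma smooth_cr: "smooth_on Om cr"
proof -
  have "smooth_on Om (\<lambda>x. fst x $ i)" for i
    by (rule smooth_on_linear[OF open_Om])
      (rule bounded_linear_compose[OF bounded_linear_vec_nth bounded_linear_fst])
  then show ?thesis
    unfolding cr_def[abs_def] crossmap_def
    by (intro smooth_on_add smooth_on_scaleR smooth_on_cross3 open_Om smooth_on_pd smooth_Y)
qed

lemma smooth_nt: "smooth_on Om nt"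
  unfolding nt_def
proof (rule smooth_hext[OF open_Om])
  have ne: "cr x \<noteq> 0" if "x \<in> Om" for x using cr_facts(1)[of "fst x" "snd x"] that by simp
  show "smooth_on Om (\<lambda>x. cr x /\<^sub>R norm (cr x))"
    by (intro smooth_on_scaleR smooth_on_inverse_comp smooth_on_norm_comp open_Om smooth_cr) (use ne in auto)
  show "(p, t) \<in> Om" if "p \<in> S2" "a < t" "t < b" for p t using that by (auto simp: mem_Om)
qed

lemma nt_facts:
  assumes "(p, t) \<in> Om"
  shows "norm (nt (p, t)) = 1" "nt (p, t) \<bullet> pd Y (u, 0) (p, t) = 0"
    "(\<And>u. w \<bullet> pd Y (u, 0) (p, t) = 0) \<Longrightarrow> w = (w \<bullet> nt (p, t)) *\<^sub>R nt (p, t)"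
proof -
  have p: "p \<noteq> 0" using assms by (simp add: mem_Om)
  let ?q = "p /\<^sub>R norm p"
  have q: "(?q, t) \<in> Om" using assms by (simp add: mem_Om)
  have nt: "nt (p, t) = cr (?q, t) /\<^sub>R norm (cr (?q, t))" by (simp add: nt_def hext_def)
  show 1: "norm (nt (p, t)) = 1" using cr_facts(1)[OF q] by (simp add: nt)
  have Yq: "pd Y (u, 0) (p, t) = inverse (norm p) *\<^sub>R pd Y (u, 0) (?q, t)" for u
    using pd_hext_scale[OF smooth_Y[unfolded Y_def] assms q] p by (simp add: Y_def)
  show 2: "nt (p, t) \<bullet> pd Y (u, 0) (p, t) = 0" for u
    using cr_facts(2)[OF q] by (simp add: nt Yq)
  show "w = (w \<bullet> nt (p, t)) *\<^sub>R nt (p, t)" if "\<And>u. w \<bullet> pd Y (u, 0) (p, t) = 0"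
    by (rule cr_facts(3)[OF assms 1 2 that])
qed

lemma nt_scale: "c > 0 \<Longrightarrow> nt (c *\<^sub>R p, t) = nt (p, t)"
  unfolding nt_def by (rule hext_scale)

lemma nu_parallel:
  assumes "p \<in> S2" "a < t" "t < b"
  obtains e where "e = 1 \<or> e = -1" "\<nu> (p, t) = e *\<^sub>R nt (p, t)"
proof -
  have O: "(p, t) \<in> Om" using assms by (auto simp: mem_Om)
  have p: "norm p = 1" "p \<bullet> p = 1" using assms by (auto simp: dot_square_norm)
  have "t \<in> {a<..<b}" using assms by simp
  then have \<nu>: "norm (\<nu> (p, t)) = 1" "\<And>u. u \<bullet> p = 0 \<Longrightarrow> \<nu> (p, t) \<bullet> dsl X t p u = 0"
    using unit_normal assms(1) by blast+
  have "\<nu> (p, t) \<bullet> pd Y (u, 0) (p, t) = 0" for u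
  proof -
    define v where "v = u - (u \<bullet> p) *\<^sub>R p"
    have vp: "v \<bullet> p = 0" using p by (simp add: v_def inner_diff_left)
    have "u = v + (u \<bullet> p) *\<^sub>R p" by (simp add: v_def)
    then have "pd Y (u, 0) (p, t) = pd Y (v, 0) (p, t) + (u \<bullet> p) *\<^sub>R pd Y (p, 0) (p, t)"
      using linear_add[OF linear_space[OF smooth_Y O]] linear_scale[OF linear_space[OF smooth_Y O]] by metis
    then show ?thesis using Y_radial[OF O] Y_dsl[OF O vp] \<nu>(2)[OF vp] p by simp
  qed
  from nt_facts(3)[OF O this] have *: "\<nu> (p, t) = (\<nu> (p, t) \<bullet> nt (p, t)) *\<^sub>R nt (p, t)" .
  then have "\<bar>\<nu> (p, t) \<bullet> nt (p, t)\<bar> = 1"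
    using \<nu>(1) nt_facts(1)[OF O] by (metis norm_scaleR mult.right_neutral)
  then show thesis using that[OF _ *] by linarith
qed

text \<open>Opposite signs at two points would make both sides of the surface outer sides, which
  \<open>outer_side_constant\<close> excludes.\<close>

lemma nu_sign_fixed_time:
  assumes t: "a < t" "t < b"
  obtains e where "e = 1 \<or> e = -1" "\<And>p. p \<in> S2 \<Longrightarrow> \<nu> (p, t) = e *\<^sub>R nt (p, t)"
proof -
  have O: "(p, t) \<in> Om" if "p \<noteq> 0" for p using that t by (simp add: mem_Om)
  have Xt: "Y (p, t) = X (p, t)" if "p \<in> S2" for p using that by (simp add: Y_def hext_sphere)
  then have img: "(\<lambda>p. Y (p, t)) ` S2 = (\<lambda>p. X (p, t)) ` S2" by auto
  have slice: "continuous_on (- {0}) (\<lambda>p. F (p, t))" if "smooth_on Om F" for F :: "(real^3) \<times> real \<Rightarrow> real^3"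
    by (rule continuous_on_compose2[OF smooth_on_continuous_on[OF that]])
      (use t in \<open>auto simp: mem_Om intro!: continuous_intros\<close>)
  have no: False if "p1 \<in> S2" "p2 \<in> S2" "\<nu> (p1, t) = nt (p1, t)" "\<nu> (p2, t) = - nt (p2, t)" for p1 p2
  proof (rule outer_side_constant[of "\<lambda>p. Y (p, t)" "\<lambda>p u. pd Y (u, 0) (p, t)" "\<lambda>p. nt (p, t)" p1 p2])
    show "((\<lambda>p. Y (p, t)) has_derivative (\<lambda>u. pd Y (u, 0) (p, t))) (at p)" if "p \<noteq> 0" for p
      by (rule has_derivative_space[OF smooth_Y O[OF that]])
    show "continuous_on (- {0}) (\<lambda>p. pd Y (u, 0) (p, t))" for u
      by (rule slice[OF smooth_on_pd[OF smooth_Y]])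
    show "u = 0" if "p \<noteq> 0" "u \<bullet> p = 0" "pd Y (u, 0) (p, t) = 0" for p u
      by (rule Y_inj[OF O[OF that(1)] that(2,3)])
    show "continuous_on (- {0}) (\<lambda>p. nt (p, t))" by (rule slice[OF smooth_nt])
    show "norm (nt (p, t)) = 1" if "p \<noteq> 0" for p by (rule nt_facts(1)[OF O[OF that]])
    show "nt (p, t) \<bullet> pd Y (u, 0) (p, t) = 0" if "p \<noteq> 0" for p u by (rule nt_facts(2)[OF O[OF that]])
    show "w = (w \<bullet> nt (p, t)) *\<^sub>R nt (p, t)" if "p \<noteq> 0" "\<And>u. w \<bullet> pd Y (u, 0) (p, t) = 0" for p w
      by (rule nt_facts(3)[OF O[OF that(1)] that(2)])
    show "Y (p /\<^sub>R norm p, t) = Y (p, t)" if "p \<noteq> 0" for p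
      using that by (simp add: Y_def hext_scale)
    show "inj_on (\<lambda>p. Y (p, t)) S2"
      using embedded t Xt unfolding inj_on_def by auto
    show "p1 \<in> S2" "p2 \<in> S2" by fact+
    have out: "eventually (\<lambda>s. X (p, t) + s *\<^sub>R \<nu> (p, t) \<in> outside ((\<lambda>q. X (q, t)) ` S2)) (at_right 0)" if "p \<in> S2" for p
    proof -
      have "t \<in> {a<..<b}" using t by simp
      then show ?thesis using outer that by blast
    qed
    show "\<forall>\<^sub>F s in at_right 0. Y (p1, t) + s *\<^sub>R nt (p1, t) \<in> outside ((\<lambda>p. Y (p, t)) ` S2)"
      using out[OF that(1)] unfolding img Xt[OF that(1)] that(3) .
    show "\<forall>\<^sub>F s in at_right 0. Y (p2, t) - s *\<^sub>R nt (p2, t) \<in> outside ((\<lambda>p. Y (p, t)) ` S2)"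
      using out[OF that(2)] unfolding img Xt[OF that(2)] that(4) by simp
  qed
  have "\<nu> (p, t) = nt (p, t) \<or> \<nu> (p, t) = - nt (p, t)" if "p \<in> S2" for p
    using nu_parallel[OF that t] by (metis scaleR_minus1_left scaleR_one)
  then consider "\<forall>p\<in>S2. \<nu> (p, t) = nt (p, t)" | "\<forall>p\<in>S2. \<nu> (p, t) = - nt (p, t)"
    using no by blast
  then show thesis
    using that[of 1] that[of "-1"] by cases auto
qed


text \<open>The factor \<open>norm (fst x)\<close> makes the differential of the Gauss map invertible in the radial direction too.\<close>
definition N :: "real \<Rightarrow> (real^3) \<times> real \<Rightarrow> real^3" where
  "N e x = (e * norm (fst x)) *\<^sub>R nt x"

lemma smooth_N: "smooth_on Om (N e)"
  unfolding N_def[abs_def]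
  by (intro smooth_on_scaleR smooth_on_mult smooth_on_const smooth_norm_fst smooth_nt open_Om)

lemma norm_N: "e = 1 \<or> e = -1 \<Longrightarrow> (p, t) \<in> Om \<Longrightarrow> norm (N e (p, t)) = norm p"
  using nt_facts(1) by (auto simp: N_def)

lemma pd_N:
  assumes "(p, t) \<in> Om"
  shows "pd (N e) (u, 0) (p, t) = (e * norm p) *\<^sub>R pd nt (u, 0) (p, t) + (e * ((u \<bullet> p) / norm p)) *\<^sub>R nt (p, t)"
proof -
  have p: "p \<noteq> 0" using assms by (simp add: mem_Om)
  have n: "(norm has_derivative (\<lambda>u. sgn p \<bullet> u)) (at p)"
    using has_derivative_norm[OF p] by (simp add: inner_commute)
  have "((\<lambda>q. (e * norm q) *\<^sub>R nt (q, t)) has_derivative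
      (\<lambda>u. (e * norm p) *\<^sub>R pd nt (u, 0) (p, t) + (e * (sgn p \<bullet> u)) *\<^sub>R nt (p, t))) (at p)"
    by (intro has_derivative_scaleR has_derivative_mult_right n has_derivative_space[OF smooth_nt assms])
  moreover have "(\<lambda>q. N e (q, t)) = (\<lambda>q. (e * norm q) *\<^sub>R nt (q, t))" by (simp add: N_def)
  then have "((\<lambda>q. (e * norm q) *\<^sub>R nt (q, t)) has_derivative (\<lambda>u. pd (N e) (u, 0) (p, t))) (at p)"
    using has_derivative_space[OF smooth_N assms, of e] by simp
  ultimately have "(\<lambda>u. pd (N e) (u, 0) (p, t)) =
      (\<lambda>u. (e * norm p) *\<^sub>R pd nt (u, 0) (p, t) + (e * (sgn p \<bullet> u)) *\<^sub>R nt (p, t))"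
    using has_derivative_unique by blast
  from fun_cong[OF this, of u]
  show ?thesis by (simp add: sgn_div_norm inner_commute divide_inverse mult_ac)
qed

lemma N_radial:
  assumes "(p, t) \<in> Om"
  shows "pd (N e) (p, 0) (p, t) = N e (p, t)"
  using pd_hext_radial[OF smooth_nt[unfolded nt_def] assms] assms
  by (simp add: pd_N[OF assms] nt_def[symmetric] N_def mem_Om dot_square_norm power2_eq_square)

lemma N_tangent: "(p, t) \<in> Om \<Longrightarrow> u \<bullet> p = 0 \<Longrightarrow> pd (N e) (u, 0) (p, t) = (e * norm p) *\<^sub>R pd nt (u, 0) (p, t)"
  by (simp add: pd_N)

lemma N_normal: "(p, t) \<in> Om \<Longrightarrow> N e (p, t) \<bullet> pd Y (u, 0) (p, t) = 0"
  using nt_facts(2) by (simp add: N_def)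

text \<open>Differentiate the squared form of \<open>norm_N\<close>. In consequence the differential
  of \<open>N\<close> carries tangent vectors at \<open>p\<close> to vectors orthogonal to the
  normal.\<close>

lemma pd_N_inner_N:
  assumes "e = 1 \<or> e = -1" "(p, t) \<in> Om"
  shows "pd (N e) (u, 0) (p, t) \<bullet> N e (p, t) = u \<bullet> p"
proof -
  have O: "(q, t) \<in> Om" if "q \<in> - {0}" for q using that assms(2) by (simp add: mem_Om)
  have p: "p \<in> - {0}" using assms(2) by (simp add: mem_Om)
  have 1: "((\<lambda>q. N e (q, t) \<bullet> N e (q, t)) has_derivative
     (\<lambda>u. N e (p, t) \<bullet> pd (N e) (u, 0) (p, t) + pd (N e) (u, 0) (p, t) \<bullet> N e (p, t))) (at p)"
    by (intro has_derivative_inner has_derivative_space[OF smooth_N assms(2)])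
  have 2: "((\<lambda>q. N e (q, t) \<bullet> N e (q, t)) has_derivative (\<lambda>u. p \<bullet> u + u \<bullet> p)) (at p)"
  proof (rule has_derivative_transform_within_open[OF has_derivative_inner[OF has_derivative_ident has_derivative_ident] _ p])
    show "q \<bullet> q = N e (q, t) \<bullet> N e (q, t)" if "q \<in> - {0}" for q
      using norm_N[OF assms(1) O[OF that]] by (metis norm_eq)
  qed auto
  from fun_cong[OF has_derivative_unique[OF 1 2], of u] show ?thesis
    by (simp add: inner_commute)
qed

text \<open>Differentiate the orthogonality of \<open>N\<close> to the tangent plane; the second
  derivatives of \<open>Y\<close> commute. This is the self-adjointness of the Weingarten
  map.\<close>

lemma second_form_symmetric:
  assumes "(p, t) \<in> Om"
  shows "pd (N e) (u, 0) (p, t) \<bullet> pd Y (v, 0) (p, t) = pd (N e) (v, 0) (p, t) \<bullet> pd Y (u, 0) (p, t)"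
proof -
  have *: "N e (p, t) \<bullet> pd (pd Y (v, 0)) (u, 0) (p, t) + pd (N e) (u, 0) (p, t) \<bullet> pd Y (v, 0) (p, t) = 0" for u v
  proof -
    have p: "p \<in> - {0}" using assms by (simp add: mem_Om)
    have 1: "((\<lambda>q. N e (q, t) \<bullet> pd Y (v, 0) (q, t)) has_derivative
       (\<lambda>u. N e (p, t) \<bullet> pd (pd Y (v, 0)) (u, 0) (p, t) + pd (N e) (u, 0) (p, t) \<bullet> pd Y (v, 0) (p, t))) (at p)"
      by (intro has_derivative_inner has_derivative_space[OF smooth_N assms]
          has_derivative_space[OF smooth_on_pd[OF smooth_Y] assms])
    have 2: "((\<lambda>q. N e (q, t) \<bullet> pd Y (v, 0) (q, t)) has_derivative (\<lambda>u. 0)) (at p)"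
    proof (rule has_derivative_transform_within_open[OF has_derivative_const[of 0] _ p])
      show "0 = N e (q, t) \<bullet> pd Y (v, 0) (q, t)" if "q \<in> - {0}" for q
        using N_normal[of q t e v] that assms by (simp add: mem_Om)
    qed auto
    from fun_cong[OF has_derivative_unique[OF 1 2], of u] show ?thesis .
  qed
  have "pd (pd Y (v, 0)) (u, 0) (p, t) = pd (pd Y (u, 0)) (v, 0) (p, t)"
    by (rule pd_commute[OF open_Om smooth_Y assms])
  then show ?thesis using *[of v u] *[of u v] by simp
qed

text \<open>Agreement with a multiple of \<open>nt\<close> on the whole slice, not at one point, is
  what makes \<nu> differentiable. The factor \<open>norm p\<close> from \<open>dsl_hext\<close> is
  the one contained in \<open>N\<close>.\<close>

lemma dsl_nu:
  assumes "(p, t) \<in> Om" "\<And>q. q \<in> S2 \<Longrightarrow> \<nu> (q, t) = e *\<^sub>R nt (q, t)" "u \<bullet> p = 0"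
  shows "dsl \<nu> t (p /\<^sub>R norm p) u = pd (N e) (u, 0) (p, t)"
proof -
  have p: "p \<in> - {0}" using assms(1) by (simp add: mem_Om)
  have "((\<lambda>q. hext \<nu> (q, t)) has_derivative (\<lambda>u. e *\<^sub>R pd nt (u, 0) (p, t))) (at p)"
  proof (rule has_derivative_transform_within_open[OF has_derivative_scaleR_right[OF has_derivative_space[OF smooth_nt assms(1)]] _ p])
    show "e *\<^sub>R nt (q, t) = hext \<nu> (q, t)" if "q \<in> - {0}" for q
    proof -
      have "q /\<^sub>R norm q \<in> S2" "inverse (norm q) > 0" using that by auto
      then show ?thesis using assms(2) nt_scale by (simp add: hext_def)
    qed
  qed auto
  from dsl_hext[OF this _ assms(3)] p show ?thesis
    by (simp add: N_tangent[OF assms(1,3)] mult.commute)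
qed

text \<open>\<open>N\<close> has degree one and \<open>Y\<close> degree zero, so their spatial
  differentials differ by one degree; the factor \<open>norm p\<close> makes up for it.\<close>

lemma principal_curvature_iff:
  assumes O: "(p, t) \<in> Om" and e: "\<And>q. q \<in> S2 \<Longrightarrow> \<nu> (q, t) = e *\<^sub>R nt (q, t)"
  shows "principal_curvature X \<nu> t (p /\<^sub>R norm p) k \<longleftrightarrow>
    (\<exists>u. u \<bullet> p = 0 \<and> u \<noteq> 0 \<and> pd (N e) (u, 0) (p, t) = k *\<^sub>R (norm p *\<^sub>R pd Y (u, 0) (p, t)))"
proof -
  have "u \<bullet> (p /\<^sub>R norm p) = 0 \<longleftrightarrow> u \<bullet> p = 0" for u using O by (simp add: mem_Om)
  then show ?thesis
    unfolding principal_curvature_def using dsl_nu[OF O e] Y_dsl[OF O] by metis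
qed

text \<open>A kernel vector is tangent by \<open>pd_N_inner_N\<close>, hence a principal direction
  of curvature zero, against strict convexity. This is the condition for inverting the Gauss map
  locally.\<close>

lemma N_injective:
  assumes O: "(p, t) \<in> Om" and e: "e = 1 \<or> e = -1" "\<And>q. q \<in> S2 \<Longrightarrow> \<nu> (q, t) = e *\<^sub>R nt (q, t)"
    and u: "pd (N e) (u, 0) (p, t) = 0"
  shows "u = 0"
proof (rule ccontr)
  assume "u \<noteq> 0"
  moreover have "u \<bullet> p = 0" using pd_N_inner_N[OF e(1) O, of u] u by simp
  ultimately have "principal_curvature X \<nu> t (p /\<^sub>R norm p) 0"
    using principal_curvature_iff[OF O, of e 0] e(2) u by auto
  moreover have "p /\<^sub>R norm p \<in> S2" "t \<in> {a<..<b}" using O by (auto simp: mem_Om)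
  ultimately show False using strictly_convex by blast
qed

text \<open>The operator \<open>M\<close> is the inverse of the Weingarten map, extended by zero in the normal direction.\<close>
lemma inverse_weingarten:
  assumes O: "(p, t) \<in> Om" and e: "e = 1 \<or> e = -1" "\<And>q. q \<in> S2 \<Longrightarrow> \<nu> (q, t) = e *\<^sub>R nt (q, t)"
  obtains M where "linear M" "\<And>u v. M u \<bullet> v = u \<bullet> M v" "M (N e (p, t)) = 0"
    "\<And>u. M (pd (N e) (u, 0) (p, t)) = norm p *\<^sub>R pd Y (u, 0) (p, t)"
    "\<And>f1 f2 f3. onf f1 f2 f3 \<Longrightarrow> gauss_curv X \<nu> t (p /\<^sub>R norm p) = 1 / e23 M f1 f2 f3 \<and> e23 M f1 f2 f3 > 0 \<and>
       Qfun X \<nu> t (p /\<^sub>R norm p) = curvQ (tr3 M f1 f2 f3) (e23 M f1 f2 f3)"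
    "\<And>v. v \<bullet> N e (p, t) = 0 \<Longrightarrow> v \<noteq> 0 \<Longrightarrow> M v \<bullet> v > 0"
proof -
  define A where "A u = pd (N e) (u, 0) (p, t)" for u
  define B where "B u = pd Y (u, 0) (p, t)" for u
  define \<rho> where "\<rho> = norm p"
  have \<rho>: "\<rho> > 0" using O by (simp add: \<rho>_def mem_Om)
  define z where "z = N e (p, t)"
  have linA: "linear A" unfolding A_def by (rule linear_space[OF smooth_N O])
  have linB: "linear B" unfolding B_def by (rule linear_space[OF smooth_Y O])
  have injA: "inj A"
    unfolding linear_injective_0[OF linA] using N_injective[OF O e] by (simp add: A_def)
  then have surjA: "surj A" using linA linear_injective_imp_surjective by blast
  define iA where "iA = inv A"
  have iA: "iA (A u) = u" "A (iA v) = v" for u v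
    using injA surjA by (simp_all add: iA_def surj_f_inv_f)
  have lini: "linear iA"
    unfolding linear_iff by (metis iA linear_add[OF linA] linear_scale[OF linA])
  \<comment> \<open>The differential of the position after the inverse of the differential of the
    extended Gauss map; \<rho> compensates for the lower degree of \<open>Y\<close>.\<close>
  define M where "M v = \<rho> *\<^sub>R B (iA v)" for v
  have linM: "linear M"
    unfolding linear_iff M_def
    by (simp add: linear_add[OF lini] linear_scale[OF lini] linear_add[OF linB] linear_scale[OF linB] scaleR_add_right)
  have MA: "M (A u) = \<rho> *\<^sub>R B u" for u by (simp add: M_def iA)
  have sym: "M u \<bullet> v = u \<bullet> M v" for u v
  proof -
    have "M (A u') \<bullet> A v' = A u' \<bullet> M (A v')" for u' v'
      using second_form_symmetric[OF O, of e u' v'] by (simp add: MA) (simp add: A_def B_def inner_commute)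
    from this[of "iA u" "iA v"] show ?thesis by (simp add: iA)
  qed
  have Ap: "A p = z" unfolding A_def z_def by (rule N_radial[OF O])
  have Bp: "B p = 0" unfolding B_def by (rule Y_radial[OF O])
  have Mz: "M z = 0" using MA[of p] Ap Bp by simp
  have Az: "A u \<bullet> z = u \<bullet> p" for u unfolding A_def z_def by (rule pd_N_inner_N[OF e(1) O])
  define \<zeta> where "\<zeta> = z /\<^sub>R \<rho>"
  have \<zeta>: "norm \<zeta> = 1" "M \<zeta> = 0"
    using norm_N[OF e(1) O] \<rho> Mz by (simp_all add: \<zeta>_def z_def \<rho>_def linear_scale[OF linM])
  have orth: "v \<bullet> \<zeta> = 0 \<longleftrightarrow> v \<bullet> z = 0" for v using \<rho> by (simp add: \<zeta>_def)
  have ker: "v = 0" if "v \<bullet> \<zeta> = 0" "M v = 0" for v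
  proof -
    have "B (iA v) = 0" using that(2) \<rho> by (simp add: M_def)
    moreover have "iA v \<bullet> p = 0" using Az[of "iA v"] iA that(1) orth by simp
    ultimately have "iA v = 0" using Y_inj[OF O] by (simp add: B_def)
    then show ?thesis using iA(2)[of v] linear_0[OF linA] by simp
  qed
  define KK where "KK = {k. principal_curvature X \<nu> t (p /\<^sub>R norm p) k}"
  have KK: "KK = {k. \<exists>v. v \<bullet> \<zeta> = 0 \<and> v \<noteq> 0 \<and> v = k *\<^sub>R M v}"
  proof -
    have "(\<exists>u. u \<bullet> p = 0 \<and> u \<noteq> 0 \<and> A u = k *\<^sub>R (\<rho> *\<^sub>R B u)) \<longleftrightarrow> (\<exists>v. v \<bullet> \<zeta> = 0 \<and> v \<noteq> 0 \<and> v = k *\<^sub>R M v)" for k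
    proof
      assume "\<exists>u. u \<bullet> p = 0 \<and> u \<noteq> 0 \<and> A u = k *\<^sub>R (\<rho> *\<^sub>R B u)"
      then obtain u where u: "u \<bullet> p = 0" "u \<noteq> 0" "A u = k *\<^sub>R (\<rho> *\<^sub>R B u)" by blast
      have "A u \<noteq> 0" using u(2) iA(1)[of u] linear_0[OF lini] by metis
      then show "\<exists>v. v \<bullet> \<zeta> = 0 \<and> v \<noteq> 0 \<and> v = k *\<^sub>R M v"
        using u Az[of u] orth MA[of u] by (intro exI[of _ "A u"]) simp
    next
      assume "\<exists>v. v \<bullet> \<zeta> = 0 \<and> v \<noteq> 0 \<and> v = k *\<^sub>R M v"
      then obtain v where v: "v \<bullet> \<zeta> = 0" "v \<noteq> 0" "v = k *\<^sub>R M v" by blast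
      have "iA v \<noteq> 0" using v(2) iA(2)[of v] linear_0[OF linA] by metis
      moreover have "iA v \<bullet> p = 0" using Az[of "iA v"] iA v(1) orth by simp
      moreover have "A (iA v) = k *\<^sub>R (\<rho> *\<^sub>R B (iA v))" using v(3) unfolding iA(2) by (simp only: M_def)
      ultimately show "\<exists>u. u \<bullet> p = 0 \<and> u \<noteq> 0 \<and> A u = k *\<^sub>R (\<rho> *\<^sub>R B u)" by blast
    qed
    then show ?thesis
      unfolding KK_def A_def B_def \<rho>_def using principal_curvature_iff[OF O, of e] e(2)
      by (intro Collect_cong) blast
  qed
  have S: "p /\<^sub>R norm p \<in> S2" "t \<in> {a<..<b}" using O by (auto simp: mem_Om)
  have pos: "k > 0" if "k \<in> KK" for k using strictly_convex S that unfolding KK_def by blast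
  have C: "Max KK * Min KK = 1 / e23 M f1 f2 f3" "e23 M f1 f2 f3 > 0"
    "((Max KK)^2 + (Min KK)^2) * (Max KK - Min KK)^2 / (8 * (Max KK + Min KK) * (Max KK)^3 * (Min KK)^3)
       = curvQ (tr3 M f1 f2 f3) (e23 M f1 f2 f3)" if "onf f1 f2 f3" for f1 f2 f3
    by ((rule curvature_values(1)[OF linM sym \<zeta> ker pos KK that]; assumption),
        (rule curvature_values(2)[OF linM sym \<zeta> ker pos KK that]; assumption),
        (rule curvature_values(3)[OF linM sym \<zeta> ker pos KK that]; assumption))
  have C4: "M v \<bullet> v > 0" if "onf f1 f2 f3" "v \<bullet> \<zeta> = 0" "v \<noteq> 0" for f1 f2 f3 v
    by (rule curvature_values(4)[OF linM sym \<zeta> ker pos KK that])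
  have L: "lambda1 X \<nu> t (p /\<^sub>R norm p) = Max KK" "lambda2 X \<nu> t (p /\<^sub>R norm p) = Min KK"
    by (simp_all add: lambda1_def lambda2_def KK_def)
  show thesis
  proof (rule that[OF linM sym])
    show "M (N e (p, t)) = 0" using Mz by (simp add: z_def)
    show "M (pd (N e) (u, 0) (p, t)) = norm p *\<^sub>R pd Y (u, 0) (p, t)" for u
      using MA[of u] by (simp add: A_def B_def \<rho>_def)
    show "gauss_curv X \<nu> t (p /\<^sub>R norm p) = 1 / e23 M f1 f2 f3 \<and> e23 M f1 f2 f3 > 0 \<and>
       Qfun X \<nu> t (p /\<^sub>R norm p) = curvQ (tr3 M f1 f2 f3) (e23 M f1 f2 f3)" if "onf f1 f2 f3" for f1 f2 f3
      using C[OF that] by (simp add: gauss_curv_def Qfun_def Let_def L)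
    obtain f where f: "norm f = 1" "f \<bullet> \<zeta> = 0" by (rule ex_unit_orthogonal)
    show "M v \<bullet> v > 0" if "v \<bullet> N e (p, t) = 0" "v \<noteq> 0" for v
      using C4[OF onf_cross[OF f(1) \<zeta>(1) f(2)], of v] that orth[of v] by (simp add: z_def)
  qed
qed


section \<open>Normal speed and the sign of the normal\<close>

lemma speed:
  assumes O: "(p, t) \<in> Om"
  shows "pd Y (0, 1) (p, t) = (1 / gauss_curv X \<nu> t (p /\<^sub>R norm p)) *\<^sub>R \<nu> (p /\<^sub>R norm p, t)"
proof -
  have S: "p /\<^sub>R norm p \<in> S2" "t \<in> {a<..<b}" using O by (auto simp: mem_Om)
  then have 1: "((\<lambda>s. X (p /\<^sub>R norm p, s)) has_derivative
      (\<lambda>h. h *\<^sub>R ((1 / gauss_curv X \<nu> t (p /\<^sub>R norm p)) *\<^sub>R \<nu> (p /\<^sub>R norm p, t)))) (at t)"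
    using flow unfolding has_vector_derivative_def by blast
  have "((\<lambda>s::real. (p, s)) has_derivative (\<lambda>h. (0, h))) (at t)"
    by (intro has_derivative_Pair has_derivative_ident has_derivative_const)
  then have "((\<lambda>s. Y (p, s)) has_derivative (\<lambda>h. pd Y (0, h) (p, t))) (at t)"
    by (rule has_derivative_compose[of _ _ _ _ Y]) (rule pd_has_derivative[OF smooth_Y O])
  moreover have "(\<lambda>s. Y (p, s)) = (\<lambda>s. X (p /\<^sub>R norm p, s))" by (simp add: Y_def hext_def)
  ultimately have 2: "((\<lambda>s. X (p /\<^sub>R norm p, s)) has_derivative (\<lambda>h. pd Y (0, h) (p, t))) (at t)" by simp
  from fun_cong[OF has_derivative_unique[OF 2 1], of 1] show ?thesis by simp
qed

lemma gauss_curv_pos: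
  assumes O: "(p, t) \<in> Om"
  shows "gauss_curv X \<nu> t (p /\<^sub>R norm p) > 0"
proof -
  have t: "a < t" "t < b" using O by (auto simp: mem_Om)
  obtain e where e: "e = 1 \<or> e = -1" "\<And>p. p \<in> S2 \<Longrightarrow> \<nu> (p, t) = e *\<^sub>R nt (p, t)"
    by (rule nu_sign_fixed_time[OF t]) blast
  obtain f where f: "norm f = 1" "f \<bullet> ax 1 = 0" by (rule ex_unit_orthogonal)
  have on: "onf f (ax 1 \<times> f) (ax 1)" by (rule onf_cross[OF f(1) _ f(2)]) (simp add: norm_axis_1)
  show ?thesis
  proof (rule inverse_weingarten[OF O e(1)])
    show "\<nu> (q, t) = e *\<^sub>R nt (q, t)" if "q \<in> S2" for q by (rule e(2)[OF that])
  next
    fix M :: "real^3 \<Rightarrow> real^3"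
    assume "\<And>f1 f2 f3. onf f1 f2 f3 \<Longrightarrow> gauss_curv X \<nu> t (p /\<^sub>R norm p) = 1 / e23 M f1 f2 f3 \<and> e23 M f1 f2 f3 > 0 \<and>
       Qfun X \<nu> t (p /\<^sub>R norm p) = curvQ (tr3 M f1 f2 f3) (e23 M f1 f2 f3)"
    from this[OF on] show ?thesis by simp
  qed
qed

text \<open>Along a fixed particle the sign is that of the normal speed with respect to the continuous field \<open>nt\<close>,
  which never vanishes.\<close>
lemma nu_sign:
  obtains e where "e = 1 \<or> e = -1" "\<And>p t. p \<in> S2 \<Longrightarrow> a < t \<Longrightarrow> t < b \<Longrightarrow> \<nu> (p, t) = e *\<^sub>R nt (p, t)"
proof -
  define p0 :: "real^3" where "p0 = ax 1"
  have p0: "norm p0 = 1" "p0 \<in> S2" by (simp_all add: p0_def norm_axis_1)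
  have O: "(p0, t) \<in> Om" if "a < t" "t < b" for t using that p0 by (auto simp: mem_Om)
  define \<phi> where "\<phi> t = pd Y (0, 1) (p0, t) \<bullet> nt (p0, t)" for t
  have cont: "continuous_on {a<..<b} \<phi>"
  proof -
    have "continuous_on Om (\<lambda>x. pd Y (0, 1) x \<bullet> nt x)"
      by (intro continuous_on_inner smooth_on_continuous_on smooth_on_pd smooth_Y smooth_nt)
    then show ?thesis
      unfolding \<phi>_def[abs_def]
      by (rule continuous_on_compose2) (use O in \<open>auto intro!: continuous_intros\<close>)
  qed
  have sgn: "\<phi> t * e > 0" if "a < t" "t < b" "e = 1 \<or> e = -1" "\<nu> (p0, t) = e *\<^sub>R nt (p0, t)" for t e
  proof -
    have K: "gauss_curv X \<nu> t p0 > 0" using gauss_curv_pos[OF O[OF that(1,2)]] p0 by simp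
    have "nt (p0, t) \<bullet> nt (p0, t) = 1"
      using nt_facts(1)[OF O[OF that(1,2)]] by (simp add: dot_square_norm)
    then have "\<phi> t = e / gauss_curv X \<nu> t p0"
      using speed[OF O[OF that(1,2)]] p0 that(4) by (simp add: \<phi>_def)
    then show ?thesis using K that(3) by auto
  qed
  \<comment> \<open>A change of sign in time would give \<phi> a zero by the intermediate value
    theorem, but at every time \<phi> equals plus or minus \<open>1/K\<close>.\<close>
  have same: "e = e'" if t: "a < t" "t < b" "a < t'" "t' < b" and e: "e = 1 \<or> e = -1" "e' = 1 \<or> e' = -1"
    and nu: "\<nu> (p0, t) = e *\<^sub>R nt (p0, t)" "\<nu> (p0, t') = e' *\<^sub>R nt (p0, t')" for t t' e e'
  proof (rule ccontr)
    assume "e \<noteq> e'"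
    have s: "\<phi> t * e > 0" "\<phi> t' * e' > 0" using sgn t e nu by blast+
    have "connected (\<phi> ` {a<..<b})"
      by (rule connected_continuous_image[OF cont]) simp
    moreover have "\<phi> t \<in> \<phi> ` {a<..<b}" "\<phi> t' \<in> \<phi> ` {a<..<b}" using t by auto
    moreover have "\<phi> t < 0 \<and> 0 < \<phi> t' \<or> \<phi> t' < 0 \<and> 0 < \<phi> t"
      using s e \<open>e \<noteq> e'\<close> by auto
    ultimately have "0 \<in> \<phi> ` {a<..<b}"
      using connected_contains_Icc[of "\<phi> ` {a<..<b}" "\<phi> t" "\<phi> t'"]
        connected_contains_Icc[of "\<phi> ` {a<..<b}" "\<phi> t'" "\<phi> t"] by auto
    then obtain r where r: "a < r" "r < b" "\<phi> r = 0" by auto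
    obtain e'' where "e'' = 1 \<or> e'' = -1" "\<nu> (p0, r) = e'' *\<^sub>R nt (p0, r)"
      by (rule nu_parallel[OF p0(2) r(1,2)])
    then show False using sgn[OF r(1,2)] r(3) by fastforce
  qed
  define m where "m = (a + b) / 2"
  have m: "a < m" "m < b" using ab by (simp_all add: m_def)
  obtain e where e: "e = 1 \<or> e = -1" "\<And>p. p \<in> S2 \<Longrightarrow> \<nu> (p, m) = e *\<^sub>R nt (p, m)"
    by (rule nu_sign_fixed_time[OF m]) blast
  show thesis
  proof (rule that[OF e(1)])
    fix p t assume p: "p \<in> S2" and t: "a < t" "t < b"
    obtain e' where e': "e' = 1 \<or> e' = -1" "\<And>p. p \<in> S2 \<Longrightarrow> \<nu> (p, t) = e' *\<^sub>R nt (p, t)"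
      by (rule nu_sign_fixed_time[OF t]) blast
    have "e = e'" by (rule same[OF m t e(1) e'(1) e(2)[OF p0(2)] e'(2)[OF p0(2)]])
    then show "\<nu> (p, t) = e *\<^sub>R nt (p, t)" using e'(2)[OF p] by simp
  qed
qed

text \<open>The inverse of the Gauss map gives the support function \<open>H\<close>, extended homogeneously of degree one; its gradient
  is the position vector and its Hessian is the inverse of the Weingarten map.\<close>
lemma local_support_function:
  assumes O: "(p0, t0) \<in> Om" and e: "e = 1 \<or> e = -1"
    and nu: "\<And>p t. p \<in> S2 \<Longrightarrow> a < t \<Longrightarrow> t < b \<Longrightarrow> \<nu> (p, t) = e *\<^sub>R nt (p, t)"
  obtains W V H where "open W" "W \<subseteq> Om" "(p0, t0) \<in> W" "open V" "smooth_on V H"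
    "\<And>p t. (p, t) \<in> W \<Longrightarrow> (N e (p, t), t) \<in> V"
    "\<And>z t. (z, t) \<in> V \<Longrightarrow> \<exists>p. (p, t) \<in> W \<and> N e (p, t) = z"
    "\<And>x v. x \<in> V \<Longrightarrow> pd (pd H (v, 0)) (fst x, 0) x = 0"
    "\<And>x f1 f2 f3. x \<in> V \<Longrightarrow> onf f1 f2 f3 \<Longrightarrow> pd H (0, 1) x = norm (fst x)^3 * hess_e2 H f1 f2 f3 x"
    "\<And>p t f1 f2 f3. (p, t) \<in> W \<Longrightarrow> onf f1 f2 f3 \<Longrightarrow> Qfun X \<nu> t (p /\<^sub>R norm p) =
       curvQ (norm (N e (p, t)) * hess_tr H f1 f2 f3 (N e (p, t), t)) (norm (N e (p, t))^2 * hess_e2 H f1 f2 f3 (N e (p, t), t))"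
    "\<And>p t v. (p, t) \<in> W \<Longrightarrow> v \<bullet> N e (p, t) = 0 \<Longrightarrow> v \<noteq> 0 \<Longrightarrow> hs H v v (N e (p, t), t) > 0"
    "\<And>p t. (p, t) \<in> W \<Longrightarrow> \<exists>f1 f2. onf f1 f2 (N e (p, t) /\<^sub>R norm (N e (p, t))) \<and> hs H f1 f2 (N e (p, t), t) = 0"
proof -
  have inj0: "u = 0" if "pd (N e) (u, 0) (p0, t0) = 0" for u
    using N_injective[OF O e _ that] nu O by (simp add: mem_Om)
  obtain W V g where W: "open W" "W \<subseteq> Om" "(p0, t0) \<in> W" "open V"
    and hom: "homeomorphism W V (\<lambda>x. (N e x, snd x)) g" and g: "smooth_on V g"
    and "\<And>x u. x \<in> W \<Longrightarrow> pd (N e) (u, 0) x = 0 \<Longrightarrow> u = 0"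
    by (rule smooth_local_inverse[OF open_Om smooth_N O inj0]) blast+
  have h: "\<And>y. y \<in> V \<Longrightarrow> (N e (g y), snd (g y)) = y" "g ` V = W"
    "\<And>x. x \<in> W \<Longrightarrow> g (N e x, snd x) = x" "(\<lambda>x. (N e x, snd x)) ` W = V"
    using hom unfolding homeomorphism_def by blast+
  have gV: "g x \<in> W" "N e (g x) = fst x" "snd (g x) = snd x" if "x \<in> V" for x
  proof -
    show "g x \<in> W" using h(2) that by blast
    show "N e (g x) = fst x" "snd (g x) = snd x" using h(1)[OF that] by (simp_all add: prod_eq_iff)
  qed
  have gN: "g (N e (p, t), t) = (p, t)" "(N e (p, t), t) \<in> V" if "(p, t) \<in> W" for p t
  proof -
    show "g (N e (p, t), t) = (p, t)" using h(3)[OF that] by simp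
    have "(N e (p, t), snd (p, t)) \<in> V" using h(4) that by blast
    then show "(N e (p, t), t) \<in> V" by simp
  qed
  have gO: "g x \<in> Om" if "x \<in> V" for x using gV(1)[OF that] W(2) by blast
  \<comment> \<open>\<open>Y (g x)\<close> is the point of the patch whose outer normal has the
    direction of \<open>fst x\<close>; since \<open>fst x\<close> need not be a unit vector, this is
    the support function extended with degree one.\<close>
  define H where "H x = Y (g x) \<bullet> fst x" for x
  have smYg: "smooth_on V (\<lambda>x. Y (g x))"
    by (rule smooth_on_compose[OF W(4) open_Om g smooth_Y]) (use gO in auto)
  have smH: "smooth_on V H"
    unfolding H_def[abs_def] by (intro smooth_on_inner smYg smooth_on_linear bounded_linear_fst W(4))
  have pdg: "snd (pd g v x) = snd v" "pd (N e) (pd g v x) (g x) = fst v" if "x \<in> V" for x v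
  proof -
    have g': "(g has_derivative (\<lambda>v. pd g v x)) (at x)" by (rule pd_has_derivative[OF g that])
    have "((\<lambda>x. snd (g x)) has_derivative snd) (at x)"
      by (rule has_derivative_transform_within_open[OF _ W(4) that, of snd]) (auto simp: gV intro: derivative_intros)
    from has_derivative_unique[OF has_derivative_snd[OF g'] this] show "snd (pd g v x) = snd v" by (rule fun_cong)
    have 1: "((\<lambda>x. N e (g x)) has_derivative fst) (at x)"
      by (rule has_derivative_transform_within_open[OF _ W(4) that, of fst]) (auto simp: gV intro: derivative_intros)
    have 2: "((\<lambda>x. N e (g x)) has_derivative (\<lambda>v. pd (N e) (pd g v x) (g x))) (at x)"
      by (rule has_derivative_compose[OF g' pd_has_derivative[OF smooth_N gO[OF that]]])
    from has_derivative_unique[OF 2 1] show "pd (N e) (pd g v x) (g x) = fst v" by (rule fun_cong)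
  qed
  have pdYg: "((\<lambda>x. Y (g x)) has_derivative (\<lambda>v. pd Y (pd g v x) (g x))) (at x)" if "x \<in> V" for x
    by (rule has_derivative_compose[OF pd_has_derivative[OF g that] pd_has_derivative[OF smooth_Y gO[OF that]]])
  have normal: "pd Y (u, 0) (g x) \<bullet> fst x = 0" if "x \<in> V" for x u
    using N_normal[of "fst (g x)" "snd (g x)" e u] gO[OF that] gV(2)[OF that] by (simp add: inner_commute)
  \<comment> \<open>Moving the point of contact within the surface contributes nothing, because
    \<open>fst x\<close> is normal there. So the spatial gradient of \<open>H\<close> involves no
    derivative of \<open>Y\<close>, and the Hessian only a first one.\<close>
  have pdH: "pd H v x = snd v * (pd Y (0, 1) (g x) \<bullet> fst x) + Y (g x) \<bullet> fst v" if "x \<in> V" for x v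
  proof -
    have "(H has_derivative (\<lambda>v. Y (g x) \<bullet> fst v + pd Y (pd g v x) (g x) \<bullet> fst x)) (at x)"
      unfolding H_def[abs_def]
      by (rule has_derivative_inner[OF pdYg[OF that] has_derivative_fst[OF has_derivative_ident]])
    then have "pd H v x = Y (g x) \<bullet> fst v + pd Y (pd g v x) (g x) \<bullet> fst x" by (rule pd_eqI)
    moreover have "pd g v x = (fst (pd g v x), 0) + snd v *\<^sub>R (0, 1)"
      using pdg(1)[OF that, of v] by (simp add: prod_eq_iff)
    then have "pd Y (pd g v x) (g x) = pd Y (fst (pd g v x), 0) (g x) + snd v *\<^sub>R pd Y (0, 1) (g x)"
      using linear_add[OF pd_linear[OF smooth_Y gO[OF that]], of "(fst (pd g v x), 0)" "snd v *\<^sub>R (0, 1)"]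
        linear_scale[OF pd_linear[OF smooth_Y gO[OF that]], of "snd v" "(0, 1)"] by simp
    ultimately show ?thesis using normal[OF that] by (simp add: inner_add_left)
  qed
  have hsH: "hs H v w x = pd Y (fst (pd g (w, 0) x), 0) (g x) \<bullet> v" "pd (N e) (fst (pd g (w, 0) x), 0) (g x) = w"
    if "x \<in> V" for v w x
  proof -
    have u: "pd g (w, 0) x = (fst (pd g (w, 0) x), 0)" using pdg(1)[OF that, of "(w, 0)"] by (simp add: prod_eq_iff)
    have "hs H v w x = pd (\<lambda>x. Y (g x) \<bullet> v) (w, 0) x"
      by (rule pd_cong[OF W(4) that _ smooth_on_pd[OF smH]]) (simp add: pdH)
    also have "\<dots> = pd Y (pd g (w, 0) x) (g x) \<bullet> v"
      by (rule pd_eqI[OF bounded_linear.has_derivative[OF bounded_linear_inner_left pdYg[OF that]]])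
    finally show "hs H v w x = pd Y (fst (pd g (w, 0) x), 0) (g x) \<bullet> v" using u by simp
    show "pd (N e) (fst (pd g (w, 0) x), 0) (g x) = w" using pdg(2)[OF that, of "(w, 0)"] u by simp
  qed
  have local: "pd (pd H (v, 0)) (fst x, 0) x = 0"
    "onf f1 f2 f3 \<Longrightarrow> pd H (0, 1) x = norm (fst x)^3 * hess_e2 H f1 f2 f3 x"
    "onf f1 f2 f3 \<Longrightarrow> Qfun X \<nu> (snd x) (fst (g x) /\<^sub>R norm (fst (g x))) =
       curvQ (norm (fst x) * hess_tr H f1 f2 f3 x) (norm (fst x)^2 * hess_e2 H f1 f2 f3 x)"
    "w \<bullet> fst x = 0 \<Longrightarrow> w \<noteq> 0 \<Longrightarrow> hs H w w x > 0"
    "\<exists>f1 f2. onf f1 f2 (fst x /\<^sub>R norm (fst x)) \<and> hs H f1 f2 x = 0"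
    if x: "x \<in> V" for x v w f1 f2 f3
  proof -
    obtain p t where pt: "g x = (p, t)" by (cases "g x")
    have t: "snd x = t" "N e (p, t) = fst x" using gV(2,3)[OF x] pt by simp_all
    have O': "(p, t) \<in> Om" using gO[OF x] pt by simp
    have ab: "a < t" "t < b" using O' by (simp_all add: mem_Om)
    have nu': "\<And>q. q \<in> S2 \<Longrightarrow> \<nu> (q, t) = e *\<^sub>R nt (q, t)" using nu ab by blast
    have nz: "norm (fst x) = norm p" using norm_N[OF e O'] t by simp
    have ppos: "norm p > 0" using O' by (simp add: mem_Om)
    obtain M where M: "linear M" "\<And>u v. M u \<bullet> v = u \<bullet> M v" "M (N e (p, t)) = 0"
      "\<And>u. M (pd (N e) (u, 0) (p, t)) = norm p *\<^sub>R pd Y (u, 0) (p, t)"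
      "\<And>f1 f2 f3. onf f1 f2 f3 \<Longrightarrow> gauss_curv X \<nu> t (p /\<^sub>R norm p) = 1 / e23 M f1 f2 f3 \<and> e23 M f1 f2 f3 > 0 \<and>
         Qfun X \<nu> t (p /\<^sub>R norm p) = curvQ (tr3 M f1 f2 f3) (e23 M f1 f2 f3)"
      "\<And>v. v \<bullet> N e (p, t) = 0 \<Longrightarrow> v \<noteq> 0 \<Longrightarrow> M v \<bullet> v > 0"
      by (rule inverse_weingarten[OF O' e nu']) blast+
    \<comment> \<open>The Hessian and \<open>M\<close> both take a change of the normal to the
      change of position; the factor accounts for the degree -1 of the Hessian.\<close>
    have hM: "norm p * hs H v w x = M w \<bullet> v" for v w
      using hsH(1)[OF x, of v w] hsH(2)[OF x, of w] M(4)[of "fst (pd g (w, 0) x)"] pt by simp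
    have "norm p * hs H v (fst x) x = 0" using hM[of v "fst x"] M(3) t by simp
    then show "pd (pd H (v, 0)) (fst x, 0) x = 0" using ppos by simp
    have "norm p * hs H w w x > 0" if "w \<bullet> fst x = 0" "w \<noteq> 0" using hM[of w w] M(6)[of w] that t by simp
    then show "hs H w w x > 0" if "w \<bullet> fst x = 0" "w \<noteq> 0" using that ppos zero_less_mult_pos by blast
    show "\<exists>f1 f2. onf f1 f2 (fst x /\<^sub>R norm (fst x)) \<and> hs H f1 f2 x = 0"
    proof -
      have "norm (fst x /\<^sub>R norm (fst x)) = 1" using ppos nz by simp
      moreover have "M (fst x /\<^sub>R norm (fst x)) = 0" using M(3) t by (simp add: linear_scale[OF M(1)])
      ultimately obtain f1 f2 r1 r2 where f: "onf f1 f2 (fst x /\<^sub>R norm (fst x))" "M f1 = r1 *\<^sub>R f1" "M f2 = r2 *\<^sub>R f2"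
        by (rule eigenframe[OF M(1,2)])
      have "norm p * hs H f1 f2 x = 0" using hM[of f1 f2] f(3) onf_inner[OF f(1)] by simp
      then show ?thesis using f(1) ppos by auto
    qed
    have tr: "norm (fst x) * hess_tr H f1 f2 f3 x = tr3 M f1 f2 f3"
      unfolding hess_tr_def tr3_def nz distrib_left hM ..
    have e2: "norm (fst x)^2 * hess_e2 H f1 f2 f3 x = e23 M f1 f2 f3"
    proof -
      have "norm p^2 * hess_e2 H f1 f2 f3 x = (norm p * hs H f1 f1 x) * (norm p * hs H f2 f2 x) - (norm p * hs H f1 f2 x)^2
        + (norm p * hs H f1 f1 x) * (norm p * hs H f3 f3 x) - (norm p * hs H f1 f3 x)^2
        + (norm p * hs H f2 f2 x) * (norm p * hs H f3 f3 x) - (norm p * hs H f2 f3 x)^2"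
        unfolding hess_e2_def by (simp add: power2_eq_square algebra_simps)
      also have "\<dots> = e23 M f1 f2 f3"
        unfolding hM e23_def using M(2)[of f2 f1] M(2)[of f3 f1] M(2)[of f3 f2] by (simp add: inner_commute)
      finally show ?thesis by (simp add: nz)
    qed
    show "Qfun X \<nu> (snd x) (fst (g x) /\<^sub>R norm (fst (g x))) =
       curvQ (norm (fst x) * hess_tr H f1 f2 f3 x) (norm (fst x)^2 * hess_e2 H f1 f2 f3 x)" if "onf f1 f2 f3"
      using M(5)[OF that] by (simp add: tr e2 t pt)
    show "pd H (0, 1) x = norm (fst x)^3 * hess_e2 H f1 f2 f3 x" if "onf f1 f2 f3"
    proof -
      \<comment> \<open>The time derivative of \<open>H\<close> is the velocity tested against a
        normal of length \<open>norm p\<close>; with the two factors of the norm in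
        \<open>e2\<close> this makes the cube.\<close>
      have "pd H (0, 1) x = pd Y (0, 1) (p, t) \<bullet> N e (p, t)"
        using pdH[OF x, of "(0, 1)"] pt t by simp
      also have "\<dots> = e23 M f1 f2 f3 * (\<nu> (p /\<^sub>R norm p, t) \<bullet> N e (p, t))"
        using speed[OF O'] M(5)[OF that] by simp
      also have "\<nu> (p /\<^sub>R norm p, t) = e *\<^sub>R nt (p, t)"
      proof -
        have "p /\<^sub>R norm p \<in> S2" using ppos by simp
        then show ?thesis using nu'[of "p /\<^sub>R norm p"] nt_scale[of "inverse (norm p)" p t] ppos by simp
      qed
      also have "e *\<^sub>R nt (p, t) \<bullet> N e (p, t) = norm p"
      proof -
        have "nt (p, t) \<bullet> nt (p, t) = 1" using nt_facts(1)[OF O'] by (simp add: dot_square_norm)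
        then show ?thesis using e by (auto simp: N_def)
      qed
      also have "e23 M f1 f2 f3 * norm p = norm (fst x)^3 * hess_e2 H f1 f2 f3 x"
        unfolding e2[symmetric] nz by (simp add: power2_eq_square power3_eq_cube)
      finally show ?thesis .
    qed
  qed
  show thesis
  proof (rule that[OF W smH])
    show "(N e (p, t), t) \<in> V" if "(p, t) \<in> W" for p t by (rule gN(2)[OF that])
    show "\<exists>p. (p, t) \<in> W \<and> N e (p, t) = z" if "(z, t) \<in> V" for z t
    proof -
      have "g (z, t) = (fst (g (z, t)), t)" using gV(3)[OF that] by (simp add: prod_eq_iff)
      then show ?thesis using gV(1,2)[OF that] by (metis fst_conv)
    qed
    show "pd (pd H (v, 0)) (fst x, 0) x = 0" if "x \<in> V" for x v by (rule local(1)[OF that])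
    show "pd H (0, 1) x = norm (fst x)^3 * hess_e2 H f1 f2 f3 x" if "x \<in> V" "onf f1 f2 f3" for x f1 f2 f3
      by (rule local(2)[OF that])
    show "Qfun X \<nu> t (p /\<^sub>R norm p) =
       curvQ (norm (N e (p, t)) * hess_tr H f1 f2 f3 (N e (p, t), t)) (norm (N e (p, t))^2 * hess_e2 H f1 f2 f3 (N e (p, t), t))"
      if "(p, t) \<in> W" "onf f1 f2 f3" for p t f1 f2 f3
      using local(3)[OF gN(2)[OF that(1)] that(2)] gN(1)[OF that(1)] by simp
    show "hs H v v (N e (p, t), t) > 0" if "(p, t) \<in> W" "v \<bullet> N e (p, t) = 0" "v \<noteq> 0" for p t v
      using local(4)[OF gN(2)[OF that(1)], of v] that by simp
    show "\<exists>f1 f2. onf f1 f2 (N e (p, t) /\<^sub>R norm (N e (p, t))) \<and> hs H f1 f2 (N e (p, t), t) = 0"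
      if "(p, t) \<in> W" for p t
      using local(5)[OF gN(2)[OF that]] by simp
  qed
qed

end

section \<open>Continuity of the curvature quantity and evolution of its maximum\<close>

lemma isCont_hess:
  assumes "open V" "smooth_on V H" "x \<in> V"
  shows "isCont (hess_tr H f1 f2 f3) x" "isCont (hess_e2 H f1 f2 f3) x"
proof -
  have hs: "isCont (hs H v w) x" for v w
    using smooth_on_continuous_on[OF smooth_on_pd[OF smooth_on_pd[OF assms(2)]]] assms(1,3)
    by (simp add: continuous_on_eq_continuous_at)
  show "isCont (hess_tr H f1 f2 f3) x"
    unfolding hess_tr_def[abs_def] by (intro continuous_add hs)
  show "isCont (hess_e2 H f1 f2 f3) x"
    unfolding hess_e2_def[abs_def] by (intro continuous_add continuous_diff continuous_mult continuous_power hs)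
qed

lemma DERIV_nonpos_left_bound:
  fixes F :: "real \<Rightarrow> real"
  assumes "(F has_real_derivative D) (at t)" "D \<le> 0" "e > 0"
  shows "eventually (\<lambda>s. F t - e * (t - s) \<le> F s) (at_left t)"
proof -
  have "((\<lambda>s. (F s - F t) / (s - t)) \<longlongrightarrow> D) (at t)"
    using assms(1) by (simp add: has_field_derivative_iff)
  then have "eventually (\<lambda>s. (F s - F t) / (s - t) < e) (at t)"
    by (rule order_tendstoD) (use assms in simp)
  then have "eventually (\<lambda>s. (F s - F t) / (s - t) < e) (at_left t)"
    using eventually_at_split by blast
  moreover have "eventually (\<lambda>s. s < t) (at_left t)"
    by (simp add: eventually_at_filter)
  ultimately show ?thesis
  proof eventually_elim
    case (elim s)
    then have "F s - F t > e * (s - t)" by (simp add: neg_divide_less_eq)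
    then show ?case by (simp add: algebra_simps)
  qed
qed

context convex_flow begin

text \<open>Continuity is not visible in the \<open>Max\<close> and \<open>Min\<close> of a set of
  eigenvalues. It is read off from the local formula in terms of \<open>H\<close> with one fixed
  frame, whose denominator is positive at the base point.\<close>

lemma Qfun_continuous:
  "continuous_on (Sigma S2 (\<lambda>_. {a<..<b})) (\<lambda>x. Qfun X \<nu> (snd x) (fst x))"
proof -
  obtain e where e: "e = 1 \<or> e = -1"
    and nu: "\<And>p t. p \<in> S2 \<Longrightarrow> a < t \<Longrightarrow> t < b \<Longrightarrow> \<nu> (p, t) = e *\<^sub>R nt (p, t)"
    by (rule nu_sign) blast
  let ?S = "Sigma S2 (\<lambda>_. {a<..<b})"
  have "continuous (at x0 within ?S) (\<lambda>x. Qfun X \<nu> (snd x) (fst x))" if x0S: "x0 \<in> ?S" for x0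
  proof -
    obtain p0 t0 where x0: "x0 = (p0, t0)" "norm p0 = 1" "a < t0" "t0 < b" using x0S by auto
    have O: "(p0, t0) \<in> Om" using x0 by (auto simp: mem_Om)
    obtain W V H where W: "open W" "W \<subseteq> Om" "(p0, t0) \<in> W" and V: "open V" "smooth_on V H"
      and WV: "\<And>p t. (p, t) \<in> W \<Longrightarrow> (N e (p, t), t) \<in> V"
      and VW: "\<And>z t. (z, t) \<in> V \<Longrightarrow> \<exists>p. (p, t) \<in> W \<and> N e (p, t) = z"
      and hom: "\<And>x v. x \<in> V \<Longrightarrow> pd (pd H (v, 0)) (fst x, 0) x = 0"
      and fl: "\<And>x f1 f2 f3. x \<in> V \<Longrightarrow> onf f1 f2 f3 \<Longrightarrow> pd H (0, 1) x = norm (fst x)^3 * hess_e2 H f1 f2 f3 x"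
      and Q: "\<And>p t f1 f2 f3. (p, t) \<in> W \<Longrightarrow> onf f1 f2 f3 \<Longrightarrow> Qfun X \<nu> t (p /\<^sub>R norm p) =
       curvQ (norm (N e (p, t)) * hess_tr H f1 f2 f3 (N e (p, t), t)) (norm (N e (p, t))^2 * hess_e2 H f1 f2 f3 (N e (p, t), t))"
      and pos: "\<And>p t v. (p, t) \<in> W \<Longrightarrow> v \<bullet> N e (p, t) = 0 \<Longrightarrow> v \<noteq> 0 \<Longrightarrow> hs H v v (N e (p, t), t) > 0"
      and fr: "\<And>p t. (p, t) \<in> W \<Longrightarrow> \<exists>f1 f2. onf f1 f2 (N e (p, t) /\<^sub>R norm (N e (p, t))) \<and> hs H f1 f2 (N e (p, t), t) = 0"
      by (rule local_support_function[OF O e nu]) blast+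
    define z0 where "z0 = N e (p0, t0)"
    have z0: "norm z0 = 1" using norm_N[OF e O] x0 by (simp add: z0_def)
    obtain f1 f2 where f: "onf f1 f2 z0" using fr[OF W(3)] z0 by (auto simp: z0_def)
    have zV: "(z0, t0) \<in> V" unfolding z0_def by (rule WV[OF W(3)])
    have ne: "f1 \<noteq> 0" "f2 \<noteq> 0" using f by (auto simp: onf_def)
    have "hs H f1 f1 (z0, t0) > 0" "hs H f2 f2 (z0, t0) > 0"
      using pos[OF W(3), of f1] pos[OF W(3), of f2] onf_inner[OF f] ne by (simp_all add: z0_def)
    moreover have "hs H z0 z0 (z0, t0) = 0" using hom[OF zV, of z0] by simp
    ultimately have T: "hess_tr H f1 f2 z0 (z0, t0) > 0" by (simp add: hess_tr_def)
    have Nc: "isCont (\<lambda>x. (N e x, snd x)) (p0, t0)"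
    proof -
      have "isCont (N e) (p0, t0)"
        using smooth_on_continuous_on[OF smooth_N] O open_Om by (simp add: continuous_on_eq_continuous_at)
      then show ?thesis by (intro continuous_Pair continuous_snd continuous_ident)
    qed
    have "isCont (\<lambda>x. curvQ (norm (fst x) * hess_tr H f1 f2 z0 x) (norm (fst x)^2 * hess_e2 H f1 f2 z0 x)) (z0, t0)"
      unfolding curvQ_def
      by (intro continuous_divide continuous_mult continuous_diff continuous_power continuous_norm continuous_fst
          continuous_ident continuous_const isCont_hess[OF V zV]) (use T z0 in auto)
    then have "isCont (\<lambda>x. curvQ (norm (N e x) * hess_tr H f1 f2 z0 (N e x, snd x)) (norm (N e x)^2 * hess_e2 H f1 f2 z0 (N e x, snd x))) (p0, t0)"
      using isCont_o2[OF Nc, of "\<lambda>x. curvQ (norm (fst x) * hess_tr H f1 f2 z0 x) (norm (fst x)^2 * hess_e2 H f1 f2 z0 x)"]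
      by (simp add: z0_def)
    then have c: "continuous (at x0 within ?S) (\<lambda>x. curvQ (norm (N e x) * hess_tr H f1 f2 z0 (N e x, snd x)) (norm (N e x)^2 * hess_e2 H f1 f2 z0 (N e x, snd x)))"
      unfolding x0(1) by (rule continuous_at_imp_continuous_at_within)
    obtain r where r: "r > 0" "ball (p0, t0) r \<subseteq> W" using W openE by blast
    show ?thesis
    proof (rule continuous_transform_within[OF c r(1) x0S])
      fix x assume x: "x \<in> ?S" "dist x x0 < r"
      have "x \<in> W" using x(2) r(2) unfolding x0(1) by (auto simp: dist_commute)
      moreover have "norm (fst x) = 1" using x(1) by auto
      ultimately show "curvQ (norm (N e x) * hess_tr H f1 f2 z0 (N e x, snd x)) (norm (N e x)^2 * hess_e2 H f1 f2 z0 (N e x, snd x))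
          = Qfun X \<nu> (snd x) (fst x)"
        using Q[of "fst x" "snd x", OF _ f] by simp
    qed
  qed
  then show ?thesis by (simp add: continuous_on_eq_continuous_within)
qed

definition Mx where "Mx t = (SUP p\<in>S2. Qfun X \<nu> t p)"

lemma Qfun_slice:
  assumes "a < t" "t < b"
  shows "continuous_on S2 (\<lambda>p. Qfun X \<nu> t p)"
proof -
  have "continuous_on S2 (\<lambda>p. (p, t))" by (intro continuous_intros)
  moreover have "(\<lambda>p. (p, t)) ` S2 \<subseteq> Sigma S2 (\<lambda>_. {a<..<b})" using assms by auto
  ultimately have "continuous_on S2 (\<lambda>p. Qfun X \<nu> (snd (p, t)) (fst (p, t)))"
    by (rule continuous_on_compose2[OF Qfun_continuous])
  then show ?thesis by simp
qed

lemma S2_nonempty: "(S2 :: (real^3) set) \<noteq> {}"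
  using norm_axis_1[of 1] by (metis dist_0_norm empty_iff mem_sphere)

text \<open>By compactness the supremum is a maximum, so \<open>SUP\<close> has its intended
  meaning.\<close>

lemma Mx_attained:
  assumes t: "a < t" "t < b"
  obtains p0 where "p0 \<in> S2" "Mx t = Qfun X \<nu> t p0"
    "\<And>p. p \<in> S2 \<Longrightarrow> Qfun X \<nu> t p \<le> Mx t"
proof -
  obtain p0 where p0: "p0 \<in> S2" "\<And>p. p \<in> S2 \<Longrightarrow> Qfun X \<nu> t p \<le> Qfun X \<nu> t p0"
    using continuous_attains_sup[OF compact_sphere S2_nonempty Qfun_slice[OF t]] by blast
  have "Mx t = Qfun X \<nu> t p0"
    unfolding Mx_def by (rule cSup_eq_maximum) (use p0 in auto)
  then show thesis using that p0 by simp
qed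

lemma Mx_upper: "a < t \<Longrightarrow> t < b \<Longrightarrow> p \<in> S2 \<Longrightarrow> Qfun X \<nu> t p \<le> Mx t"
  using Mx_attained[of t] by metis

text \<open>Carry the maximiser at time \<open>s\<close> over to time \<open>t\<close>: uniform
  continuity on a compact slab controls the change of value wherever that point is.\<close>

lemma Mx_upper_semicontinuous:
  assumes t: "a < t" "t < b" and e: "0 < e"
  shows "eventually (\<lambda>s. Mx s < Mx t + e) (at t)"
proof -
  define d where "d = min (t - a) (b - t) / 2"
  have d: "d > 0" "a < t - d" "t + d < b" using t by (auto simp: d_def min_def field_simps)
  let ?K = "Sigma S2 (\<lambda>_. {t - d..t + d})"
  have "compact ?K" by (rule compact_Times[OF compact_sphere compact_Icc])
  moreover have "continuous_on ?K (\<lambda>x. Qfun X \<nu> (snd x) (fst x))"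
    by (rule continuous_on_subset[OF Qfun_continuous]) (use d in auto)
  ultimately have "uniformly_continuous_on ?K (\<lambda>x. Qfun X \<nu> (snd x) (fst x))"
    by (rule compact_uniformly_continuous[rotated])
  then obtain \<delta> where \<delta>: "\<delta> > 0"
    "\<And>x x'. x \<in> ?K \<Longrightarrow> x' \<in> ?K \<Longrightarrow> dist x' x < \<delta> \<Longrightarrow> dist (Qfun X \<nu> (snd x') (fst x')) (Qfun X \<nu> (snd x) (fst x)) < e / 2"
    using e unfolding uniformly_continuous_on_def by (metis half_gt_zero)
  have "Mx s < Mx t + e" if s: "dist s t < min \<delta> d" for s
  proof -
    have sd: "s \<in> {t - d..t + d}" using s by (auto simp: dist_real_def)
    then have s': "a < s" "s < b" using d by auto
    obtain p where p: "p \<in> S2" "Mx s = Qfun X \<nu> s p" using Mx_attained[OF s'] by metis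
    have "dist (Qfun X \<nu> s p) (Qfun X \<nu> t p) < e / 2"
      using \<delta>(2)[of "(p, t)" "(p, s)"] p(1) sd d(1) s by (simp add: dist_Pair_Pair)
    then have "Qfun X \<nu> s p - Qfun X \<nu> t p < e / 2" unfolding dist_real_def by linarith
    then show ?thesis
      using Mx_upper[OF t p(1)] p(2) e by linarith
  qed
  then show ?thesis
    unfolding eventually_at using \<delta>(1) d(1) by (intro exI[of _ "min \<delta> d"]) auto
qed

text \<open>At a maximiser at time \<open>t0\<close> the normal \<open>z0\<close> is kept fixed, not
  the particle. The value \<open>F\<close> at that normal lies below \<open>Mx\<close>, with
  equality at \<open>t0\<close> and a nonpositive derivative there, so it is a barrier from below to
  the left of \<open>t0\<close>.\<close>

lemma Mx_left_bound:
  assumes t0: "a < t0" "t0 < b" and \<epsilon>: "0 < \<epsilon>"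
  shows "eventually (\<lambda>s. Mx t0 - \<epsilon> * (t0 - s) \<le> Mx s) (at_left t0)"
proof -
  obtain p0 where p0: "p0 \<in> S2" "Mx t0 = Qfun X \<nu> t0 p0" using Mx_attained[OF t0] by metis
  have np0: "norm p0 = 1" using p0 by simp
  obtain e where e: "e = 1 \<or> e = -1"
    and nu: "\<And>p t. p \<in> S2 \<Longrightarrow> a < t \<Longrightarrow> t < b \<Longrightarrow> \<nu> (p, t) = e *\<^sub>R nt (p, t)"
    by (rule nu_sign) blast
  have O: "(p0, t0) \<in> Om" using np0 t0 by (auto simp: mem_Om)
  obtain W V H where W: "open W" "W \<subseteq> Om" "(p0, t0) \<in> W" and V: "open V" "smooth_on V H"
    and WV: "\<And>p t. (p, t) \<in> W \<Longrightarrow> (N e (p, t), t) \<in> V"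
    and VW: "\<And>z t. (z, t) \<in> V \<Longrightarrow> \<exists>p. (p, t) \<in> W \<and> N e (p, t) = z"
    and hom: "\<And>x v. x \<in> V \<Longrightarrow> pd (pd H (v, 0)) (fst x, 0) x = 0"
    and fl: "\<And>x f1 f2 f3. x \<in> V \<Longrightarrow> onf f1 f2 f3 \<Longrightarrow> pd H (0, 1) x = norm (fst x)^3 * hess_e2 H f1 f2 f3 x"
    and Q: "\<And>p t f1 f2 f3. (p, t) \<in> W \<Longrightarrow> onf f1 f2 f3 \<Longrightarrow> Qfun X \<nu> t (p /\<^sub>R norm p) =
       curvQ (norm (N e (p, t)) * hess_tr H f1 f2 f3 (N e (p, t), t)) (norm (N e (p, t))^2 * hess_e2 H f1 f2 f3 (N e (p, t), t))"
    and pos: "\<And>p t v. (p, t) \<in> W \<Longrightarrow> v \<bullet> N e (p, t) = 0 \<Longrightarrow> v \<noteq> 0 \<Longrightarrow> hs H v v (N e (p, t), t) > 0"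
    and fr: "\<And>p t. (p, t) \<in> W \<Longrightarrow> \<exists>f1 f2. onf f1 f2 (N e (p, t) /\<^sub>R norm (N e (p, t))) \<and> hs H f1 f2 (N e (p, t), t) = 0"
    by (rule local_support_function[OF O e nu]) blast+
  define z0 where "z0 = N e (p0, t0)"
  have z0: "norm z0 = 1" using norm_N[OF e O] np0 by (simp add: z0_def)
  obtain f1 f2 where f: "onf f1 f2 z0" "hs H f1 f2 (z0, t0) = 0" using fr[OF W(3)] z0 by (auto simp: z0_def)
  have zV: "(z0, t0) \<in> V" unfolding z0_def by (rule WV[OF W(3)])
  have ne: "f1 \<noteq> 0" "f2 \<noteq> 0" using f(1) by (auto simp: onf_def)
  have pos': "hs H f1 f1 (z0, t0) > 0" "hs H f2 f2 (z0, t0) > 0"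
    using pos[OF W(3), of f1] pos[OF W(3), of f2] onf_inner[OF f(1)] ne by (simp_all add: z0_def)
  \<comment> \<open>Every point of \<open>V\<close> comes from an actual surface point, so the local
    formula never exceeds the maximum. This gives both the spatial maximum condition at
    \<open>t0\<close> and the barrier at other times.\<close>
  have QV: "curvQ (norm z * hess_tr H f1 f2 z0 (z, t)) (norm z^2 * hess_e2 H f1 f2 z0 (z, t)) \<le> Mx t" if zt: "(z, t) \<in> V" for z t
  proof -
    obtain p where p: "(p, t) \<in> W" "N e (p, t) = z" using VW[OF zt] by blast
    then have pO: "p \<noteq> 0" "a < t" "t < b" using W(2) by (auto simp: mem_Om)
    have "p /\<^sub>R norm p \<in> S2" using pO by simp
    from Mx_upper[OF pO(2,3) this] show ?thesis using Q[OF p(1) f(1)] p(2) by simp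
  qed
  define F where "F t = curvQ (hess_tr H f1 f2 z0 (z0, t)) (hess_e2 H f1 f2 z0 (z0, t))" for t
  have F0: "F t0 = Mx t0"
    using Q[OF W(3) f(1)] z0 np0 p0(2) by (simp add: F_def z0_def)
  have Vz: "eventually (\<lambda>z. (z, t0) \<in> V) (nhds z0)"
  proof -
    have "open ((\<lambda>z. (z, t0)) -` V)" by (intro open_vimage V continuous_intros)
    from eventually_nhds_in_open[OF this, of z0] show ?thesis using zV by simp
  qed
  have Vt: "eventually (\<lambda>t. (z0, t) \<in> V) (nhds t0)"
  proof -
    have "open ((\<lambda>t. (z0, t)) -` V)" by (intro open_vimage V continuous_intros)
    from eventually_nhds_in_open[OF this, of t0] show ?thesis using zV by simp
  qed
  have max: "eventually (\<lambda>z. curvQ (norm z * hess_tr H f1 f2 z0 (z, t0)) (norm z^2 * hess_e2 H f1 f2 z0 (z, t0))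
      \<le> curvQ (hess_tr H f1 f2 z0 (z0, t0)) (hess_e2 H f1 f2 z0 (z0, t0))) (nhds z0)"
    using Vz by eventually_elim (use QV F0 in \<open>simp add: F_def\<close>)
  have on: "norm f1 = 1" "norm f2 = 1" "f1 \<bullet> z0 = 0" "f2 \<bullet> z0 = 0" using f(1) by (auto simp: onf_def)
  have fl': "pd H (0, 1) x = norm (fst x)^3 * hess_e2 H f1 f2 z0 x" if "x \<in> V" for x by (rule fl[OF that f(1)])
  obtain D where D: "D \<le> 0" "(F has_real_derivative D) (at t0)"
    unfolding F_def[abs_def]
    by (rule max_speed_nonpos[OF V zV on(1,2) z0 on(3,4) hom fl' f(2) pos' max])
  have "eventually (\<lambda>t. F t \<le> Mx t) (nhds t0)"
    using Vt by eventually_elim (use QV[of z0] z0 in \<open>simp add: F_def\<close>)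
  then have "eventually (\<lambda>t. F t \<le> Mx t) (at_left t0)"
    using eventually_nhds_conv_at eventually_at_split by blast
  moreover have "eventually (\<lambda>s. F t0 - \<epsilon> * (t0 - s) \<le> F s) (at_left t0)"
    by (rule DERIV_nonpos_left_bound[OF D(2,1) \<epsilon>])
  ultimately show ?thesis
    by eventually_elim (simp add: F0)
qed

lemma Mx_nonincreasing:
  assumes "a < t1" "t1 \<le> t2" "t2 < b"
  shows "Mx t2 \<le> Mx t1"
  by (rule nonincreasing_of_left_bound[of a b Mx, OF Mx_upper_semicontinuous Mx_left_bound assms])

end

unbundle no cross3_syntax

theorem theorem7p1:
  fixes X \<nu> :: "(real^3) \<times> real \<Rightarrow> real^3" and a b :: real and U :: "((real^3) \<times> real) set"
  assumes "a < b"
    and "open U" and "S2 \<times> {a<..<b} \<subseteq> U" and "smooth_on U X"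
    and embedded: "\<forall>t\<in>{a<..<b}. inj_on (\<lambda>p. X (p, t)) S2"
    and immersed: "\<forall>t\<in>{a<..<b}. \<forall>p\<in>S2. \<forall>u. u \<bullet> p = 0 \<and> u \<noteq> 0 \<longrightarrow> dsl X t p u \<noteq> 0"
    and unit_normal: "\<forall>t\<in>{a<..<b}. \<forall>p\<in>S2. norm (\<nu> (p, t)) = 1 \<and>
                        (\<forall>u. u \<bullet> p = 0 \<longrightarrow> \<nu> (p, t) \<bullet> dsl X t p u = 0)"
    and outer: "\<forall>t\<in>{a<..<b}. \<forall>p\<in>S2.
                  eventually (\<lambda>s. X (p, t) + s *\<^sub>R \<nu> (p, t) \<in> outside ((\<lambda>q. X (q, t)) ` S2)) (at_right 0)"
    and strictly_convex: "\<forall>t\<in>{a<..<b}. \<forall>p\<in>S2. \<forall>k. principal_curvature X \<nu> t p k \<longrightarrow> k > 0"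
    and flow: "\<forall>t\<in>{a<..<b}. \<forall>p\<in>S2.
                 ((\<lambda>s. X (p, s)) has_vector_derivative (1 / gauss_curv X \<nu> t p) *\<^sub>R \<nu> (p, t)) (at t)"
  shows "\<forall>t1 t2. a < t1 \<and> t1 \<le> t2 \<and> t2 < b \<longrightarrow>
           (SUP p\<in>S2. Qfun X \<nu> t2 p) \<le> (SUP p\<in>S2. Qfun X \<nu> t1 p)"
proof -
  have "(p, t) \<in> U" if "p \<in> S2" "a < t" "t < b" for p t using assms(3) that by auto
  then interpret convex_flow X \<nu> a b U
    using assms by unfold_locales
  show ?thesis using Mx_nonincreasing unfolding Mx_def by blast
qed

end
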